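(* Let $d\ge 1$ and let $X\subseteq\mathbb{T}_{\pm}^d$ be an arbitrary set. Then the following are equivalent: (i) $X$ is an intersection of finitely many closed linear tropical halfspaces. (ii) $X=\mathrm{cone}_{TC}(x_1,\dots,x_m)$ for a finite (nonempty) collection of points $\{x_1,\dots,x_m\}\subseteq\mathbb{T}_{\pm}^d$. (iii) There exists a finite collection of polyhedral cones $\mathbf{P}_1,\dots,\mathbf{P}_m\subseteq\mathbb{K}^d$ such that $\bigcap_i\mathrm{sval}(\mathbf{P}_i)=X$. (iv) There exists a finite collection of linear halfspaces $\mathbf{H}_1,\dots,\mathbf{H}_m\subseteq\mathbb{K}^d$ such that $\bigcap_i\mathrm{sval}(\mathbf{H}_i)=X$.
   Context: Signed tropical numbers. Let $\mathbb{O}=-\infty$ be the tropical zero. $\mathbb{T}_{>\mathbb{O}}=\mathbb{R}$ (positive numbers), $\mathbb{T}_{<\mathbb{O}}=\{\ominus r: r\in\mathbb{R}\}$ (negative numbers), $\mathbb{T}_{\ge\mathbb{O}}=\mathbb{R}\cup\{\mathbb{O}\}$, $\mathbb{T}_{\pm}=\mathbb{T}_{>\mathbb{O}}\cup\mathbb{T}_{<\mathbb{O}}\cup\{\mathbb{O}\}$, balanced numbers $\mathbb{T}_{\bullet}=\{\bullet r: r\in\mathbb{R}\}\cup\{\mathbb{O}\}$, symmetrized semiring $\mathbb{S}=\mathbb{T}_{\pm}\cup\mathbb{T}_{\bullet}$. The norm is $|r|=|\ominus r|=|\bullet r|=r$ and $|\mathbb{O}|=\mathbb{O}$; the sign $\mathrm{tsgn}$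 takes values in $\{\oplus,\ominus,\bullet,\mathbb{O}\}$. Addition on $\mathbb{S}$: $x\oplus y$ equals $x$ if $|x|>|y|$, $y$ if $|y|>|x|$, $x$ if $|x|=|y|$ and $\mathrm{tsgn}(x)=\mathrm{tsgn}(y)$, and $\bullet|x|$ if $|x|=|y|$ and the signs differ. Multiplication: $x\odot y$ has norm $|x|+|y|$ and sign the product of signs (with $\oplus,\ominus,\bullet$ multiplying like $1,-1,0$); $\mathbb{O}$ is absorbing. The multiplicative unit is the real number $0$. Closed tropical halfspaces. For $a=(a_0,\dots,a_d)\in\mathbb{T}_{\pm}^{d+1}$ with $(a_1,\dots,a_d)\ne(\mathbb{O},\dots,\mathbb{O})$, $\overline{\mathcal{H}}^+(a)=\{x\in\mathbb{T}_{\pm}^d: a_0\oplus a_1\odot x_1\oplus\dots\oplus a_d\odot x_d\in\mathbb{T}_{>\mathbb{O}}\cup\mathbb{T}_{\bullet}\}$; it is linear if $a_0=\mathbb{O}$. Finite collections in (i), (iii), (iv) may be empty; an empty intersection is $\mathbb{T}_{\pm}^d$. TC-convexity. For two points $x,y\in\mathbb{T}_{\pm}^d$, $\mathrm{conv}_{TC}(x,y)$ is the intersection of all closed halfspaces $\overline{\mathcal{H}}^+(a)$ containing both. A set $S$ is TC-convex if $\mathrm{conv}_{TC}(x,y)\subseteq S$ for all $x,y\in S$. For $M\subseteq\mathbb{T}_{\pm}^d$, $\mathrm{conv}_{TC}(M)$ is the intersection of all TC-convex sets containing $M$, and $\mathrm{cone}_{TC}(M)=\{\lambda\odot x:\lambda\in\mathbb{T}_{\ge\mathbb{O}},\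 x\in\mathrm{conv}_{TC}(M)\}$. Puiseux series. $\mathbb{K}$ is the field of generalized real Puiseux series: formal series $\gamma=\sum_i c_it^{\alpha_i}$ with $\alpha_i\in\mathbb{R}$, nonzero $c_i\in\mathbb{R}$, $\alpha_0>\alpha_1>\cdots$, where $(\alpha_i)$ is finite (possibly empty, giving $0$) or unbounded. $\gamma\neq0$ is positive iff $c_0>0$; this makes $\mathbb{K}$ an ordered (real closed) field. A polyhedral cone is a set $\{\mathbf{x}\in\mathbb{K}^d:\mathbf{A}\mathbf{x}\ge0\}$ for a matrix $\mathbf{A}\in\mathbb{K}^{n\times d}$; a linear halfspace is $\{\mathbf{x}\in\mathbb{K}^d:\mathbf{a}_1\mathbf{x}_1+\dots+\mathbf{a}_d\mathbf{x}_d\ge0\}$ with $(\mathbf{a}_1,\dots,\mathbf{a}_d)\ne0$. The signed valuation $\mathrm{sval}:\mathbb{K}\to\mathbb{T}_{\pm}$ sends $\gamma$ to $\alpha_0$ if $\gamma>0$, to $\mathbb{O}$ if $\gamma=0$, to $\ominus\alpha_0$ if $\gamma<0$; it is extended componentwise to vectors and to sets by taking images. *)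

theory Defs
  imports "HOL-Analysis.Finite_Cartesian_Product" "HOL-Library.Extended_Real"
begin

section \<open>The symmetrized tropical semiring\<close>

text \<open>
  \<open>TZero\<close> is the tropical zero; \<open>Pos r\<close>, \<open>Neg r\<close> and \<open>Bal r\<close> are the positive, negative and
  balanced numbers of norm \<open>r\<close>.
\<close>

datatype symtrop = TZero | Pos real | Neg real | Bal real

datatype tropsign = SPlus | SMinus | SBal | SZero

primrec tnorm :: "symtrop \<Rightarrow> ereal" where
  "tnorm TZero = -\<infinity>"
| "tnorm (Pos r) = ereal r"
| "tnorm (Neg r) = ereal r"
| "tnorm (Bal r) = ereal r"

primrec tsgn :: "symtrop \<Rightarrow> tropsign" where
  "tsgn TZero = SZero"
| "tsgn (Pos r) = SPlus"
| "tsgn (Neg r) = SMinus"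
| "tsgn (Bal r) = SBal"

text \<open>
  In \<open>tropical_add\<close>, if two elements have equal norm and different signs, then neither of them is
  \<open>TZero\<close>, so \<open>real_of_ereal\<close> is applied to a real number only.  The semiring unit \<open>1\<close> is the
  positive number of norm \<open>0\<close>, while \<open>0 :: symtrop\<close> is the tropical zero.
\<close>

definition tropical_add :: "symtrop \<Rightarrow> symtrop \<Rightarrow> symtrop" where
  "tropical_add x y =
     (if tnorm x > tnorm y then x
      else if tnorm y > tnorm x then y
      else if tsgn x = tsgn y then x
      else Bal (real_of_ereal (tnorm x)))"

lemma tropical_add_simps [simp]:
  "tropical_add TZero x = x" "tropical_add x TZero = x"
  "tropical_add (Pos r) (Pos s) = Pos (max r s)"
  "tropical_add (Neg r) (Neg s) = Neg (max r s)"
  "tropical_add (Bal r) (Bal s) = Bal (max r s)"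
  "tropical_add (Pos r) (Neg s) = (if s < r then Pos r else if r < s then Neg s else Bal r)"
  "tropical_add (Neg r) (Pos s) = (if s < r then Neg r else if r < s then Pos s else Bal r)"
  "tropical_add (Pos r) (Bal s) = (if s < r then Pos r else Bal s)"
  "tropical_add (Bal r) (Pos s) = (if r < s then Pos s else Bal r)"
  "tropical_add (Neg r) (Bal s) = (if s < r then Neg r else Bal s)"
  "tropical_add (Bal r) (Neg s) = (if r < s then Neg s else Bal r)"
  by (cases x; auto simp: tropical_add_def max_def)+

fun tropical_mult :: "symtrop \<Rightarrow> symtrop \<Rightarrow> symtrop" where
  "tropical_mult TZero y = TZero"
| "tropical_mult x TZero = TZero"
| "tropical_mult (Pos r) (Pos s) = Pos (r + s)"
| "tropical_mult (Pos r) (Neg s) = Neg (r + s)"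
| "tropical_mult (Neg r) (Pos s) = Neg (r + s)"
| "tropical_mult (Neg r) (Neg s) = Pos (r + s)"
| "tropical_mult (Bal r) (Pos s) = Bal (r + s)"
| "tropical_mult (Bal r) (Neg s) = Bal (r + s)"
| "tropical_mult (Bal r) (Bal s) = Bal (r + s)"
| "tropical_mult (Pos r) (Bal s) = Bal (r + s)"
| "tropical_mult (Neg r) (Bal s) = Bal (r + s)"

instantiation symtrop :: comm_semiring_1
begin

definition zero_symtrop :: symtrop where "0 = TZero"
definition one_symtrop :: symtrop where "1 = Pos 0"
definition plus_symtrop :: "symtrop \<Rightarrow> symtrop \<Rightarrow> symtrop" where "x + y = tropical_add x y"
definition times_symtrop :: "symtrop \<Rightarrow> symtrop \<Rightarrow> symtrop" where "x * y = tropical_mult x y"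

instance
proof
  fix a b c :: symtrop
  show "a + b + c = a + (b + c)"
    by (cases a; cases b; cases c; simp add: plus_symtrop_def max_def)
  show "a + b = b + a"
    by (cases a; cases b; simp add: plus_symtrop_def max_def)
  show "0 + a = a"
    by (cases a) (auto simp: plus_symtrop_def zero_symtrop_def)
  show "a * b * c = a * (b * c)"
    by (cases a; cases b; cases c) (auto simp: times_symtrop_def)
  show "a * b = b * a"
    by (cases a; cases b) (auto simp: times_symtrop_def)
  show "1 * a = a"
    by (cases a) (auto simp: times_symtrop_def one_symtrop_def)
  show "(a + b) * c = a * c + b * c"
    by (cases a; cases b; cases c; simp add: plus_symtrop_def times_symtrop_def max_def)
  show "0 * a = 0"
    by (simp add: times_symtrop_def zero_symtrop_def)
  show "a * 0 = 0"
    by (cases a) (auto simp: times_symtrop_def zero_symtrop_def)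
  show "(0 :: symtrop) \<noteq> 1"
    by (simp add: zero_symtrop_def one_symtrop_def)
qed

end

definition tpos :: "symtrop set" where "tpos = range Pos"
definition tneg :: "symtrop set" where "tneg = range Neg"
definition tnonneg :: "symtrop set" where "tnonneg = tpos \<union> {0}"
definition tsigned :: "symtrop set" where "tsigned = tpos \<union> tneg \<union> {0}"
definition tbalanced :: "symtrop set" where "tbalanced = range Bal \<union> {0}"

definition signed_vecs :: "(symtrop ^ 'd) set" where
  "signed_vecs = {x. \<forall>i. x $ i \<in> tsigned}"


section \<open>Closed tropical halfspaces and TC-convexity\<close>

definition closed_halfspace :: "symtrop \<Rightarrow> symtrop ^ 'd \<Rightarrow> (symtrop ^ 'd) set" where
  "closed_halfspace a0 a =
     {x \<in> signed_vecs. a0 + (\<Sum>i\<in>UNIV. a $ i * x $ i) \<in> tpos \<union> tbalanced}"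

definition is_closed_halfspace :: "(symtrop ^ 'd) set \<Rightarrow> bool" where
  "is_closed_halfspace H \<longleftrightarrow>
     (\<exists>a0\<in>tsigned. \<exists>a\<in>signed_vecs. a \<noteq> 0 \<and> H = closed_halfspace a0 a)"

definition is_closed_linear_halfspace :: "(symtrop ^ 'd) set \<Rightarrow> bool" where
  "is_closed_linear_halfspace H \<longleftrightarrow> (\<exists>a\<in>signed_vecs. a \<noteq> 0 \<and> H = closed_halfspace 0 a)"

text \<open>Intersections are taken inside \<open>signed_vecs\<close>, which is the value of the empty one.\<close>

definition signed_Inter :: "(symtrop ^ 'd) set set \<Rightarrow> (symtrop ^ 'd) set" where
  "signed_Inter F = signed_vecs \<inter> \<Inter>F"

definition conv_TC2 :: "symtrop ^ 'd \<Rightarrow> symtrop ^ 'd \<Rightarrow> (symtrop ^ 'd) set" where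
  "conv_TC2 x y = signed_Inter {H. is_closed_halfspace H \<and> x \<in> H \<and> y \<in> H}"

definition TC_convex :: "(symtrop ^ 'd) set \<Rightarrow> bool" where
  "TC_convex S \<longleftrightarrow> S \<subseteq> signed_vecs \<and> (\<forall>x\<in>S. \<forall>y\<in>S. conv_TC2 x y \<subseteq> S)"

definition conv_TC :: "(symtrop ^ 'd) set \<Rightarrow> (symtrop ^ 'd) set" where
  "conv_TC M = signed_Inter {S. TC_convex S \<and> M \<subseteq> S}"

definition cone_TC :: "(symtrop ^ 'd) set \<Rightarrow> (symtrop ^ 'd) set" where
  "cone_TC M = {l *s x |l x. l \<in> tnonneg \<and> x \<in> conv_TC M}"


section \<open>Generalized real Puiseux series\<close>

text \<open>
  A series is represented by its coefficient function, which maps an exponent to the coefficient of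
  the corresponding power of \<open>t\<close>; its support is a set of exponents that can be listed as a
  strictly decreasing sequence which is finite or unbounded.
\<close>

definition puiseux_exponents :: "real set \<Rightarrow> bool" where
  "puiseux_exponents A \<longleftrightarrow>
     finite A \<or>
     (\<exists>\<alpha> :: nat \<Rightarrow> real. (\<forall>i. \<alpha> (Suc i) < \<alpha> i) \<and> (\<forall>b. \<exists>i. \<alpha> i < b) \<and> A = range \<alpha>)"

lemma puiseux_exponents_iff:
  "puiseux_exponents A \<longleftrightarrow> (\<forall>b. finite {a \<in> A. b \<le> a})"
proof
  assume "puiseux_exponents A"
  then consider "finite A" | \<alpha> :: "nat \<Rightarrow> real"
    where "\<forall>i. \<alpha> (Suc i) < \<alpha> i" "\<forall>b. \<exists>i. \<alpha> i < b" "A = range \<alpha>"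
    unfolding puiseux_exponents_def by blast
  then show "\<forall>b. finite {a \<in> A. b \<le> a}"
  proof cases
    case 1
    then show ?thesis by simp
  next
    case 2
    show ?thesis
    proof
      fix b
      obtain k where k: "\<alpha> k < b" using 2 by blast
      have anti: "\<alpha> j \<le> \<alpha> i" if "i \<le> j" for i j
        using lift_Suc_antimono_le[of \<alpha> i j] 2(1) that by (simp add: less_imp_le)
      have "{a \<in> A. b \<le> a} \<subseteq> \<alpha> ` {..<k}"
      proof
        fix a assume "a \<in> {a \<in> A. b \<le> a}"
        then obtain i where i: "a = \<alpha> i" "b \<le> \<alpha> i" using 2 by auto
        have "i < k" using anti[of k i] i k by (cases "i < k") auto
        then show "a \<in> \<alpha> ` {..<k}" using i by auto
      qed
      then show "finite {a \<in> A. b \<le> a}" by (rule finite_subset) simp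
    qed
  qed
next
  assume fin: "\<forall>b. finite {a \<in> A. b \<le> a}"
  show "puiseux_exponents A"
  proof (cases "finite A")
    case True
    then show ?thesis by (simp add: puiseux_exponents_def)
  next
    case inf: False
    have max_ex: "\<exists>m\<in>B. \<forall>y\<in>B. y \<le> m" if B: "B \<subseteq> A" "B \<noteq> {}" for B
    proof -
      obtain b where b: "b \<in> B" using B by blast
      have f: "finite {a \<in> B. b \<le> a}"
        by (rule finite_subset[OF _ fin[rule_format, of b]]) (use B in auto)
      let ?m = "Max {a \<in> B. b \<le> a}"
      have m: "?m \<in> {a \<in> B. b \<le> a}" by (rule Max_in) (use f b in auto)
      have "y \<le> ?m" if "y \<in> B" for y
      proof (cases "b \<le> y")
        case True
        then show ?thesis using f that by (intro Max_ge) auto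
      next
        case False
        then show ?thesis using m by auto
      qed
      then show ?thesis using m by blast
    qed
    have ne: "{a \<in> A. a < x} \<noteq> {}" for x
    proof
      assume "{a \<in> A. a < x} = {}"
      then have "A = {a \<in> A. x \<le> a}" by (auto simp: not_less)
      then show False using inf fin by metis
    qed
    define nxt where "nxt x = (SOME m. m \<in> A \<and> m < x \<and> (\<forall>y\<in>A. y < x \<longrightarrow> y \<le> m))" for x
    have nxt: "nxt x \<in> A \<and> nxt x < x \<and> (\<forall>y\<in>A. y < x \<longrightarrow> y \<le> nxt x)" for x
      unfolding nxt_def
      by (rule someI_ex) (use max_ex[of "{a \<in> A. a < x}"] ne[of x] in auto)
    have "A \<noteq> {}" using inf by auto
    then obtain m where m: "m \<in> A" "\<forall>y\<in>A. y \<le> m" using max_ex[of A] by auto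
    define \<alpha> where "\<alpha> = rec_nat m (\<lambda>_. nxt)"
    have \<alpha>0: "\<alpha> 0 = m" and \<alpha>S: "\<alpha> (Suc n) = nxt (\<alpha> n)" for n
      by (simp_all add: \<alpha>_def)
    have inA: "\<alpha> n \<in> A" for n
      by (cases n) (use m nxt in \<open>auto simp: \<alpha>0 \<alpha>S\<close>)
    have dec: "\<alpha> (Suc i) < \<alpha> i" for i using nxt by (simp add: \<alpha>S)
    have "inj \<alpha>"
    proof (rule injI)
      fix i j assume eq: "\<alpha> i = \<alpha> j"
      have "\<alpha> j < \<alpha> i" if "i < j" for i j
        using lift_Suc_mono_less[of "\<lambda>i. - \<alpha> i" i j] dec that by simp
      then show "i = j" using eq by (metis less_irrefl linorder_neqE_nat)
    qed
    then have infr: "infinite (range \<alpha>)" by (simp add: finite_image_iff)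
    have unb: "\<exists>i. \<alpha> i < b" for b
    proof (rule ccontr)
      assume "\<not> (\<exists>i. \<alpha> i < b)"
      then have "range \<alpha> \<subseteq> {a \<in> A. b \<le> a}" using inA by (auto simp: not_less)
      then show False using fin infr finite_subset by blast
    qed
    have "a \<in> range \<alpha>" if a: "a \<in> A" for a
    proof (rule ccontr)
      assume n: "a \<notin> range \<alpha>"
      have "a < \<alpha> i" for i
      proof (induction i)
        case 0
        then show ?case using n m a \<alpha>0 by (metis order_le_less rangeI)
      next
        case (Suc i)
        then have "a \<le> \<alpha> (Suc i)" using nxt a by (simp add: \<alpha>S)
        then show ?case using n by (metis order_le_less rangeI)
      qed
      then show False using unb[of a] by (metis less_asym)
    qed
    then have "A = range \<alpha>" using inA by auto
    then show ?thesis using dec unb unfolding puiseux_exponents_def by blast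
  qed
qed

typedef puiseux = "{f :: real \<Rightarrow> real. puiseux_exponents {a. f a \<noteq> 0}}"
  morphisms pcoeff Abs_puiseux
  by (rule exI[of _ "\<lambda>_. 0"]) (simp add: puiseux_exponents_def)

lemma puiseux_eqI: "(\<And>a. pcoeff f a = pcoeff g a) \<Longrightarrow> f = g"
  by (metis ext pcoeff_inject)

lemma pcoeff_Abs:
  assumes "\<And>b. finite {a. f a \<noteq> 0 \<and> b \<le> a}"
  shows "pcoeff (Abs_puiseux f) = f"
  by (rule Abs_puiseux_inverse) (use assms in \<open>simp add: puiseux_exponents_iff\<close>)

lemma finite_pcoeff_ge: "finite {a. pcoeff f a \<noteq> 0 \<and> b \<le> a}"
  using pcoeff[of f] by (simp add: puiseux_exponents_iff)

lemma pcoeff_bounded: "\<exists>M. \<forall>a. pcoeff f a \<noteq> 0 \<longrightarrow> a \<le> M"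
proof (cases "{a. pcoeff f a \<noteq> 0 \<and> 0 \<le> a} = {}")
  case True
  then show ?thesis by (intro exI[of _ 0]) force
next
  case False
  let ?S = "{a. pcoeff f a \<noteq> 0 \<and> 0 \<le> a}"
  have m: "Max ?S \<in> ?S" by (rule Max_in) (use False finite_pcoeff_ge in auto)
  have "a \<le> Max ?S" if "pcoeff f a \<noteq> 0" for a
  proof (cases "0 \<le> a")
    case True
    then show ?thesis using that finite_pcoeff_ge by (intro Max_ge) auto
  next
    case False
    then show ?thesis using m by auto
  qed
  then show ?thesis by blast
qed

text \<open>The leading exponent is the largest element of the support; it is only used for nonzero series.\<close>

definition lead_exp :: "puiseux \<Rightarrow> real" where
  "lead_exp f = (GREATEST a. pcoeff f a \<noteq> 0)"

lemma lead_exp_eqI: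
  assumes "pcoeff f a \<noteq> 0" "\<And>b. a < b \<Longrightarrow> pcoeff f b = 0"
  shows "lead_exp f = a"
  unfolding lead_exp_def
  by (rule Greatest_equality) (use assms in \<open>auto simp: not_less[symmetric]\<close>)

instantiation puiseux :: "{zero, one, plus, minus, uminus, times}"
begin

definition zero_puiseux :: puiseux where "0 = Abs_puiseux (\<lambda>_. 0)"
definition one_puiseux :: puiseux where "1 = Abs_puiseux (\<lambda>a. if a = 0 then 1 else 0)"
definition plus_puiseux :: "puiseux \<Rightarrow> puiseux \<Rightarrow> puiseux" where
  "f + g = Abs_puiseux (\<lambda>a. pcoeff f a + pcoeff g a)"
definition minus_puiseux :: "puiseux \<Rightarrow> puiseux \<Rightarrow> puiseux" where
  "f - g = Abs_puiseux (\<lambda>a. pcoeff f a - pcoeff g a)"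
definition uminus_puiseux :: "puiseux \<Rightarrow> puiseux" where
  "- f = Abs_puiseux (\<lambda>a. - pcoeff f a)"
text \<open>The index set of the sum below is finite by lemma \<open>finite_mult_support\<close>.\<close>
definition times_puiseux :: "puiseux \<Rightarrow> puiseux \<Rightarrow> puiseux" where
  "f * g = Abs_puiseux (\<lambda>c. \<Sum>a\<in>{a. pcoeff f a \<noteq> 0 \<and> pcoeff g (c - a) \<noteq> 0}.
     pcoeff f a * pcoeff g (c - a))"

instance ..

end

lemma finite_mult_support: "finite {a. pcoeff f a \<noteq> 0 \<and> pcoeff g (c - a) \<noteq> 0}"
proof -
  obtain M where "\<forall>a. pcoeff g a \<noteq> 0 \<longrightarrow> a \<le> M" using pcoeff_bounded by blast
  then have "{a. pcoeff f a \<noteq> 0 \<and> pcoeff g (c - a) \<noteq> 0} \<subseteq> {a. pcoeff f a \<noteq> 0 \<and> c - M \<le> a}"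
    by (auto simp: algebra_simps)
  then show ?thesis by (rule finite_subset) (rule finite_pcoeff_ge)
qed

lemma pcoeff_zero [simp]: "pcoeff 0 a = 0"
  unfolding zero_puiseux_def by (subst pcoeff_Abs) auto

lemma pcoeff_one: "pcoeff 1 a = (if a = 0 then 1 else 0)"
  unfolding one_puiseux_def by (subst pcoeff_Abs) auto

lemma pcoeff_plus [simp]: "pcoeff (f + g) a = pcoeff f a + pcoeff g a"
  unfolding plus_puiseux_def
proof (subst pcoeff_Abs)
  fix b
  show "finite {a. pcoeff f a + pcoeff g a \<noteq> 0 \<and> b \<le> a}"
    by (rule finite_subset[OF _ finite_UnI[OF finite_pcoeff_ge[of f b] finite_pcoeff_ge[of g b]]]) auto
qed simp

lemma pcoeff_minus [simp]: "pcoeff (f - g) a = pcoeff f a - pcoeff g a"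
  unfolding minus_puiseux_def
proof (subst pcoeff_Abs)
  fix b
  show "finite {a. pcoeff f a - pcoeff g a \<noteq> 0 \<and> b \<le> a}"
    by (rule finite_subset[OF _ finite_UnI[OF finite_pcoeff_ge[of f b] finite_pcoeff_ge[of g b]]]) auto
qed simp

lemma pcoeff_uminus [simp]: "pcoeff (- f) a = - pcoeff f a"
  unfolding uminus_puiseux_def
  by (subst pcoeff_Abs) (auto intro: finite_pcoeff_ge)

lemma pcoeff_times:
  "pcoeff (f * g) c =
     (\<Sum>a\<in>{a. pcoeff f a \<noteq> 0 \<and> pcoeff g (c - a) \<noteq> 0}. pcoeff f a * pcoeff g (c - a))"
  unfolding times_puiseux_def
proof (subst pcoeff_Abs)
  fix b
  let ?h = "\<lambda>c. \<Sum>a\<in>{a. pcoeff f a \<noteq> 0 \<and> pcoeff g (c - a) \<noteq> 0}. pcoeff f a * pcoeff g (c - a)"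
  obtain M where M: "\<forall>a. pcoeff f a \<noteq> 0 \<longrightarrow> a \<le> M" using pcoeff_bounded by blast
  obtain N where N: "\<forall>a. pcoeff g a \<noteq> 0 \<longrightarrow> a \<le> N" using pcoeff_bounded by blast
  let ?A = "{a. pcoeff f a \<noteq> 0 \<and> b - N \<le> a}"
  let ?B = "{a. pcoeff g a \<noteq> 0 \<and> b - M \<le> a}"
  have "{c. ?h c \<noteq> 0 \<and> b \<le> c} \<subseteq> (\<lambda>(x, y). x + y) ` (?A \<times> ?B)"
  proof
    fix c assume "c \<in> {c. ?h c \<noteq> 0 \<and> b \<le> c}"
    then have h: "?h c \<noteq> 0" and bc: "b \<le> c" by auto
    obtain a where "a \<in> {a. pcoeff f a \<noteq> 0 \<and> pcoeff g (c - a) \<noteq> 0}"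
      using h by (rule sum.not_neutral_contains_not_neutral)
    then have a: "pcoeff f a \<noteq> 0" "pcoeff g (c - a) \<noteq> 0" by auto
    then have "a \<le> M" "c - a \<le> N" using M N by auto
    then have "a \<in> ?A" "c - a \<in> ?B" using a bc by auto
    then show "c \<in> (\<lambda>(x, y). x + y) ` (?A \<times> ?B)"
      by (intro image_eqI[of _ _ "(a, c - a)"]) auto
  qed
  then show "finite {c. ?h c \<noteq> 0 \<and> b \<le> c}"
    by (rule finite_subset) (intro finite_imageI finite_cartesian_product finite_pcoeff_ge)
qed simp

lemma pcoeff_times_eq:
  assumes "finite A" "\<And>a. pcoeff f a \<noteq> 0 \<Longrightarrow> pcoeff g (c - a) \<noteq> 0 \<Longrightarrow> a \<in> A"
  shows "pcoeff (f * g) c = (\<Sum>a\<in>A. pcoeff f a * pcoeff g (c - a))"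
  unfolding pcoeff_times by (rule sum.mono_neutral_left) (use assms in auto)

lemma pcoeff_times_nz:
  assumes "pcoeff (f * g) c \<noteq> 0"
  shows "\<exists>a. pcoeff f a \<noteq> 0 \<and> pcoeff g (c - a) \<noteq> 0"
  using assms sum.not_neutral_contains_not_neutral unfolding pcoeff_times by blast

lemma pcoeff_times_bound:
  assumes "\<And>a. pcoeff f a \<noteq> 0 \<Longrightarrow> a \<le> M" "\<And>a. pcoeff g a \<noteq> 0 \<Longrightarrow> a \<le> N" "pcoeff (f * g) c \<noteq> 0"
  shows "c \<le> M + N"
proof -
  obtain a where "pcoeff f a \<noteq> 0" "pcoeff g (c - a) \<noteq> 0" using pcoeff_times_nz[OF assms(3)] by blast
  then have "a \<le> M" "c - a \<le> N" using assms by auto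
  then show ?thesis by simp
qed

lemma puiseux_mult_commute: "f * g = g * (f :: puiseux)"
proof (rule puiseux_eqI)
  fix c
  show "pcoeff (f * g) c = pcoeff (g * f) c"
    unfolding pcoeff_times
    by (rule sum.reindex_bij_witness[of _ "\<lambda>a. c - a" "\<lambda>a. c - a"]) auto
qed

lemma puiseux_mult_assoc: "f * g * h = f * (g * (h :: puiseux))"
proof (rule puiseux_eqI)
  fix x
  obtain F where F: "\<forall>a. pcoeff f a \<noteq> 0 \<longrightarrow> a \<le> F" using pcoeff_bounded by blast
  obtain G where G: "\<forall>a. pcoeff g a \<noteq> 0 \<longrightarrow> a \<le> G" using pcoeff_bounded by blast
  obtain H where H: "\<forall>a. pcoeff h a \<noteq> 0 \<longrightarrow> a \<le> H" using pcoeff_bounded by blast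
  define A where "A = {a. pcoeff f a \<noteq> 0 \<and> x - G - H \<le> a}"
  define C where "C = {a. pcoeff h a \<noteq> 0 \<and> x - F - G \<le> a}"
  have fA: "finite A" and fC: "finite C" unfolding A_def C_def by (rule finite_pcoeff_ge)+
  have fg: "pcoeff (f * g) (x - c) = (\<Sum>a\<in>A. pcoeff f a * pcoeff g (x - c - a))" if "c \<in> C" for c
  proof (rule pcoeff_times_eq[OF fA])
    fix a assume a: "pcoeff f a \<noteq> 0" "pcoeff g (x - c - a) \<noteq> 0"
    have "x - c - a \<le> G" "c \<le> H" using a G H that by (auto simp: C_def)
    then show "a \<in> A" using a by (simp add: A_def)
  qed
  have gh: "pcoeff (h * g) (x - a) = (\<Sum>c\<in>C. pcoeff h c * pcoeff g (x - a - c))" if "a \<in> A" for a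
  proof (rule pcoeff_times_eq[OF fC])
    fix c assume c: "pcoeff h c \<noteq> 0" "pcoeff g (x - a - c) \<noteq> 0"
    have "x - a - c \<le> G" "a \<le> F" using c F G that by (auto simp: A_def)
    then show "c \<in> C" using c by (simp add: C_def)
  qed
  have "pcoeff (f * g * h) x = pcoeff (h * (f * g)) x"
    by (simp only: puiseux_mult_commute)
  also have "\<dots> = (\<Sum>c\<in>C. pcoeff h c * pcoeff (f * g) (x - c))"
  proof (rule pcoeff_times_eq[OF fC])
    fix c assume c: "pcoeff h c \<noteq> 0" "pcoeff (f * g) (x - c) \<noteq> 0"
    have "x - c \<le> F + G" using pcoeff_times_bound[OF _ _ c(2), of F G] F G by auto
    then show "c \<in> C" using c by (simp add: C_def)
  qed
  also have "\<dots> = (\<Sum>c\<in>C. \<Sum>a\<in>A. pcoeff h c * (pcoeff f a * pcoeff g (x - c - a)))"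
    by (rule sum.cong[OF refl]) (simp add: fg sum_distrib_left)
  also have "\<dots> = (\<Sum>a\<in>A. \<Sum>c\<in>C. pcoeff h c * (pcoeff f a * pcoeff g (x - c - a)))"
    by (rule sum.swap)
  also have "\<dots> = (\<Sum>a\<in>A. pcoeff f a * pcoeff (h * g) (x - a))"
  proof (rule sum.cong[OF refl])
    fix a assume "a \<in> A"
    moreover have "x - c - a = x - a - c" for c by simp
    ultimately show "(\<Sum>c\<in>C. pcoeff h c * (pcoeff f a * pcoeff g (x - c - a))) =
        pcoeff f a * pcoeff (h * g) (x - a)"
      by (simp only: gh sum_distrib_left mult.left_commute)
  qed
  also have "\<dots> = pcoeff (f * (h * g)) x"
  proof (rule pcoeff_times_eq[symmetric, OF fA])
    fix a assume a: "pcoeff f a \<noteq> 0" "pcoeff (h * g) (x - a) \<noteq> 0"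
    have "x - a \<le> H + G" using pcoeff_times_bound[OF _ _ a(2), of H G] H G by auto
    then show "a \<in> A" using a by (simp add: A_def)
  qed
  also have "\<dots> = pcoeff (f * (g * h)) x" by (simp only: puiseux_mult_commute[of h g])
  finally show "pcoeff (f * g * h) x = pcoeff (f * (g * h)) x" .
qed

instance puiseux :: comm_ring_1
proof
  fix a b c :: puiseux
  show "a * b * c = a * (b * c)" by (rule puiseux_mult_assoc)
  show "a * b = b * a" by (rule puiseux_mult_commute)
  show "1 * a = a"
  proof (rule puiseux_eqI)
    fix x
    show "pcoeff (1 * a) x = pcoeff a x"
      by (subst pcoeff_times_eq[of "{0}"]) (auto simp: pcoeff_one split: if_splits)
  qed
  show "(a + b) * c = a * c + b * c"
  proof (rule puiseux_eqI)
    fix x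
    let ?A = "{y. pcoeff a y \<noteq> 0 \<and> pcoeff c (x - y) \<noteq> 0} \<union> {y. pcoeff b y \<noteq> 0 \<and> pcoeff c (x - y) \<noteq> 0}"
    have fin: "finite ?A" by (intro finite_UnI finite_mult_support)
    have "pcoeff ((a + b) * c) x = (\<Sum>y\<in>?A. pcoeff (a + b) y * pcoeff c (x - y))"
      by (rule pcoeff_times_eq[OF fin]) auto
    moreover have "pcoeff (a * c) x = (\<Sum>y\<in>?A. pcoeff a y * pcoeff c (x - y))"
      by (rule pcoeff_times_eq[OF fin]) auto
    moreover have "pcoeff (b * c) x = (\<Sum>y\<in>?A. pcoeff b y * pcoeff c (x - y))"
      by (rule pcoeff_times_eq[OF fin]) auto
    ultimately show "pcoeff ((a + b) * c) x = pcoeff (a * c + b * c) x"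
      by (simp add: sum.distrib distrib_right)
  qed
  show "(0 :: puiseux) \<noteq> 1"
  proof
    assume "(0 :: puiseux) = 1"
    then have "pcoeff 0 0 = pcoeff 1 0" by simp
    then show False by (simp add: pcoeff_one)
  qed
qed (auto intro!: puiseux_eqI)

lemma pcoeff_sum: "pcoeff (\<Sum>i\<in>I. f i) a = (\<Sum>i\<in>I. pcoeff (f i) a)"
  by (induction I rule: infinite_finite_induct) auto

lemma lead_exp:
  assumes "f \<noteq> 0"
  shows "pcoeff f (lead_exp f) \<noteq> 0" and "lead_exp f < b \<Longrightarrow> pcoeff f b = 0"
proof -
  obtain a where a: "pcoeff f a \<noteq> 0" using assms puiseux_eqI[of f 0] by auto
  let ?S = "{b. pcoeff f b \<noteq> 0 \<and> a \<le> b}"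
  have fin: "finite ?S" by (rule finite_pcoeff_ge)
  have m: "Max ?S \<in> ?S" by (rule Max_in) (use fin a in auto)
  have gt: "pcoeff f b = 0" if "Max ?S < b" for b
  proof (rule ccontr)
    assume "pcoeff f b \<noteq> 0"
    moreover have "a \<le> b" using m that by auto
    ultimately have "b \<le> Max ?S" using fin by (intro Max_ge) auto
    then show False using that by simp
  qed
  have nz: "pcoeff f (Max ?S) \<noteq> 0" using m by blast
  have eq: "lead_exp f = Max ?S" by (rule lead_exp_eqI[OF nz gt])
  show "pcoeff f (lead_exp f) \<noteq> 0" unfolding eq by (rule nz)
  show "lead_exp f < b \<Longrightarrow> pcoeff f b = 0" unfolding eq by (rule gt)
qed


subsection \<open>Inverses\<close>

definition pmono :: "real \<Rightarrow> real \<Rightarrow> puiseux" where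
  "pmono c a = Abs_puiseux (\<lambda>x. if x = a then c else 0)"

lemma pcoeff_pmono: "pcoeff (pmono c a) x = (if x = a then c else 0)"
  unfolding pmono_def
proof (subst pcoeff_Abs)
  fix b
  show "finite {x. (if x = a then c else 0) \<noteq> 0 \<and> b \<le> x}"
    by (rule finite_subset[of _ "{a}"]) auto
qed simp

lemma pcoeff_pmono_times: "pcoeff (pmono c a * f) x = c * pcoeff f (x - a)"
  by (subst pcoeff_times_eq[of "{a}"]) (auto simp: pcoeff_pmono split: if_splits)

lemma one_minus_invertible:
  fixes u :: puiseux
  assumes u: "\<And>a. pcoeff u a \<noteq> 0 \<Longrightarrow> a < 0"
  shows "\<exists>g. (1 - u) * g = 1"
proof -
  obtain e where e: "e > 0" "\<And>a. pcoeff u a \<noteq> 0 \<Longrightarrow> a \<le> - e"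
  proof (cases "u = 0")
    case True
    then show ?thesis using that[of 1] by auto
  next
    case False
    then show ?thesis
      using that[of "- lead_exp u"] u lead_exp[of u] by (force simp: not_less[symmetric])
  qed
  have pw: "a \<le> - (real n * e)" if "pcoeff (u ^ n) a \<noteq> 0" for n a
    using that
  proof (induction n arbitrary: a)
    case 0
    then show ?case by (simp add: pcoeff_one split: if_splits)
  next
    case (Suc n)
    have "a \<le> - e + - (real n * e)"
      by (rule pcoeff_times_bound[of u _ "u ^ n"]) (use e Suc in auto)
    then show ?case by (simp add: algebra_simps)
  qed
  define N where "N x = nat \<lceil>- x / e\<rceil>" for x
  have zero: "pcoeff (u ^ n) x = 0" if "n > N x" for n x
  proof (rule ccontr)
    assume "pcoeff (u ^ n) x \<noteq> 0"
    then have "real n * e \<le> - x" using pw by force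
    then have "real n \<le> - x / e" using e by (simp add: field_simps)
    then have "n \<le> N x" unfolding N_def by linarith
    then show False using that by simp
  qed
  have Nmono: "N y \<le> N x" if "x \<le> y" for x y
    unfolding N_def using that e by (intro nat_mono ceiling_mono divide_right_mono) auto
  define G where "G k = (\<Sum>n\<le>k. u ^ n)" for k
  have G_eq: "pcoeff (G k) x = pcoeff (G (N x)) x" if "N x \<le> k" for k x
    unfolding G_def pcoeff_sum
    by (rule sum.mono_neutral_right) (use that zero in auto)
  define g where "g = Abs_puiseux (\<lambda>x. pcoeff (G (N x)) x)"
  have g: "pcoeff g x = pcoeff (G (N x)) x" for x
    unfolding g_def
  proof (subst pcoeff_Abs)
    fix b
    have "pcoeff (G (N a)) a = pcoeff (G (N b)) a" if "b \<le> a" for a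
      using G_eq[OF Nmono[OF that]] by simp
    then have "{a. pcoeff (G (N a)) a \<noteq> 0 \<and> b \<le> a} \<subseteq> {a. pcoeff (G (N b)) a \<noteq> 0 \<and> b \<le> a}"
      by auto
    then show "finite {a. pcoeff (G (N a)) a \<noteq> 0 \<and> b \<le> a}"
      by (rule finite_subset) (rule finite_pcoeff_ge)
  qed simp
  have "(1 - u) * g = 1"
  proof (rule puiseux_eqI)
    fix x
    have agree: "pcoeff g y = pcoeff (G (N x)) y" if "x \<le> y" for y
      using g[of y] G_eq[OF Nmono[OF that]] by simp
    have le0: "a \<le> 0" if "pcoeff (1 - u) a \<noteq> 0" for a
      using that u[of a] by (auto simp: pcoeff_one split: if_splits)
    have "pcoeff ((1 - u) * g) x = pcoeff ((1 - u) * G (N x)) x"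
    proof -
      have eq: "pcoeff g (x - a) = pcoeff (G (N x)) (x - a)" if "pcoeff (1 - u) a \<noteq> 0" for a
        using le0[OF that] by (intro agree) simp
      have "{a. pcoeff (1 - u) a \<noteq> 0 \<and> pcoeff g (x - a) \<noteq> 0} =
            {a. pcoeff (1 - u) a \<noteq> 0 \<and> pcoeff (G (N x)) (x - a) \<noteq> 0}"
        by (rule Collect_cong) (metis eq)
      then show ?thesis
        unfolding pcoeff_times by (rule sum.cong) (metis (mono_tags, lifting) mem_Collect_eq eq)
    qed
    also have "(1 - u) * G (N x) = 1 - u ^ Suc (N x)"
      unfolding G_def by (rule sum_gp_basic)
    also have "pcoeff \<dots> x = pcoeff 1 x" using zero[where n="Suc (N x)" and x=x] by simp
    finally show "pcoeff ((1 - u) * g) x = pcoeff 1 x" .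
  qed
  then show ?thesis by blast
qed

lemma puiseux_invertible:
  fixes f :: puiseux
  assumes "f \<noteq> 0"
  shows "\<exists>g. f * g = 1"
proof -
  define a where "a = lead_exp f"
  define c where "c = pcoeff f a"
  have c: "c \<noteq> 0" using lead_exp[OF assms] by (simp add: c_def a_def)
  define m where "m = pmono (1 / c) (- a)"
  have coeff: "pcoeff (m * f) x = pcoeff f (x + a) / c" for x
    by (simp add: m_def pcoeff_pmono_times)
  have "\<exists>g. (1 - (1 - m * f)) * g = 1"
  proof (rule one_minus_invertible)
    fix x assume x: "pcoeff (1 - m * f) x \<noteq> 0"
    show "x < 0"
    proof (rule ccontr)
      assume "\<not> x < 0"
      then consider "x = 0" | "x > 0" by linarith
      then show False
      proof cases
        case 1
        then show False using x c by (simp add: coeff pcoeff_one c_def)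
      next
        case 2
        then have "pcoeff f (x + a) = 0" using lead_exp(2)[OF assms] by (simp add: a_def)
        then show False using x 2 by (simp add: coeff pcoeff_one)
      qed
    qed
  qed
  then obtain g where "m * f * g = 1" by auto
  then have "f * (m * g) = 1" by (simp add: ac_simps)
  then show ?thesis by blast
qed


subsection \<open>The ordered field structure\<close>

definition puiseux_pos :: "puiseux \<Rightarrow> bool" where
  "puiseux_pos f \<longleftrightarrow> f \<noteq> 0 \<and> pcoeff f (lead_exp f) > 0"

lemma puiseux_posI:
  assumes "pcoeff f a > 0" "\<And>b. a < b \<Longrightarrow> pcoeff f b = 0"
  shows "puiseux_pos f"
proof -
  have "lead_exp f = a" by (rule lead_exp_eqI) (use assms in auto)
  moreover have "f \<noteq> 0" using assms(1) by auto
  ultimately show ?thesis using assms by (simp add: puiseux_pos_def)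
qed

lemma puiseux_pos_add:
  assumes "puiseux_pos f" "puiseux_pos g"
  shows "puiseux_pos (f + g)"
proof (rule puiseux_posI)
  let ?m = "max (lead_exp f) (lead_exp g)"
  have "f \<noteq> 0" "g \<noteq> 0" "pcoeff f (lead_exp f) > 0" "pcoeff g (lead_exp g) > 0"
    using assms by (auto simp: puiseux_pos_def)
  note l = this lead_exp(2)[OF this(1)] lead_exp(2)[OF this(2)]
  show "pcoeff (f + g) ?m > 0"
    using l by (cases "lead_exp f" "lead_exp g" rule: linorder_cases) (auto simp: max_def)
  show "\<And>b. ?m < b \<Longrightarrow> pcoeff (f + g) b = 0" using l by auto
qed

lemma puiseux_pos_mult:
  assumes "puiseux_pos f" "puiseux_pos g"
  shows "puiseux_pos (f * g)"
proof (rule puiseux_posI)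
  let ?a = "lead_exp f" and ?b = "lead_exp g"
  have "f \<noteq> 0" "g \<noteq> 0" "pcoeff f ?a > 0" "pcoeff g ?b > 0"
    using assms by (auto simp: puiseux_pos_def)
  note l = this lead_exp(2)[OF this(1)] lead_exp(2)[OF this(2)]
  have le: "\<And>x. pcoeff f x \<noteq> 0 \<Longrightarrow> x \<le> ?a" "\<And>x. pcoeff g x \<noteq> 0 \<Longrightarrow> x \<le> ?b"
    using l by (meson not_less)+
  have "pcoeff (f * g) (?a + ?b) = (\<Sum>x\<in>{?a}. pcoeff f x * pcoeff g (?a + ?b - x))"
    by (rule pcoeff_times_eq) (use le in force)+
  then show "pcoeff (f * g) (?a + ?b) > 0" using l by simp
  show "\<And>c. ?a + ?b < c \<Longrightarrow> pcoeff (f * g) c = 0"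
    using pcoeff_times_bound[OF le] by (meson not_less)
qed

lemma puiseux_pos_uminus_iff: "puiseux_pos (- f) \<longleftrightarrow> f \<noteq> 0 \<and> pcoeff f (lead_exp f) < 0"
proof -
  have "lead_exp (- f) = lead_exp f" by (simp add: lead_exp_def)
  moreover have "- f = 0 \<longleftrightarrow> f = 0" by simp
  ultimately show ?thesis by (simp only: puiseux_pos_def pcoeff_uminus neg_0_less_iff_less)
qed

lemma puiseux_pos_cases: "f = 0 \<or> puiseux_pos f \<or> puiseux_pos (- f)"
  using lead_exp(1)[of f] unfolding puiseux_pos_uminus_iff by (auto simp: puiseux_pos_def)

lemma puiseux_pos_antisym: "puiseux_pos f \<Longrightarrow> \<not> puiseux_pos (- f)"
  unfolding puiseux_pos_uminus_iff by (auto simp: puiseux_pos_def)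

instantiation puiseux :: linordered_field
begin

definition less_puiseux :: "puiseux \<Rightarrow> puiseux \<Rightarrow> bool" where
  "f < g \<longleftrightarrow> puiseux_pos (g - f)"
definition less_eq_puiseux :: "puiseux \<Rightarrow> puiseux \<Rightarrow> bool" where
  "f \<le> g \<longleftrightarrow> f = g \<or> puiseux_pos (g - f)"
definition abs_puiseux :: "puiseux \<Rightarrow> puiseux" where
  "\<bar>f :: puiseux\<bar> = (if f < 0 then - f else f)"
definition sgn_puiseux :: "puiseux \<Rightarrow> puiseux" where
  "sgn (f :: puiseux) = (if f = 0 then 0 else if 0 < f then 1 else - 1)"
definition inverse_puiseux :: "puiseux \<Rightarrow> puiseux" where
  "inverse (f :: puiseux) = (if f = 0 then 0 else THE g. f * g = 1)"
definition divide_puiseux :: "puiseux \<Rightarrow> puiseux \<Rightarrow> puiseux" where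
  "f div g = f * inverse (g :: puiseux)"

instance
proof
  fix x y z :: puiseux
  show "(x < y) = (x \<le> y \<and> \<not> y \<le> x)"
    using puiseux_pos_antisym[of "y - x"] by (auto simp: less_puiseux_def less_eq_puiseux_def puiseux_pos_def)
  show "x \<le> x" by (simp add: less_eq_puiseux_def)
  show "x \<le> y \<Longrightarrow> y \<le> z \<Longrightarrow> x \<le> z"
    using puiseux_pos_add[of "y - x" "z - y"] by (auto simp: less_eq_puiseux_def)
  show "x \<le> y \<Longrightarrow> y \<le> x \<Longrightarrow> x = y"
    using puiseux_pos_antisym[of "y - x"] by (auto simp: less_eq_puiseux_def)
  show "x \<le> y \<or> y \<le> x"
    using puiseux_pos_cases[of "y - x"] by (auto simp: less_eq_puiseux_def)
  show "x \<le> y \<Longrightarrow> z + x \<le> z + y" by (auto simp: less_eq_puiseux_def)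
  show "x < y \<Longrightarrow> 0 < z \<Longrightarrow> z * x < z * y"
    using puiseux_pos_mult[of z "y - x"] by (simp add: less_puiseux_def right_diff_distrib)
  show "\<bar>x\<bar> = (if x < 0 then - x else x)" by (rule abs_puiseux_def)
  show "sgn x = (if x = 0 then 0 else if 0 < x then 1 else - 1)" by (rule sgn_puiseux_def)
  show "inverse x * x = 1" if "x \<noteq> 0"
  proof -
    from puiseux_invertible[OF that] obtain g where g: "x * g = 1" by blast
    have "h = g" if "x * h = 1" for h
    proof -
      have "h = (x * g) * h" using g by simp
      also have "\<dots> = g * (x * h)" by (simp add: ac_simps)
      finally show ?thesis using that by simp
    qed
    then have "(THE g. x * g = 1) = g" using g by (rule the_equality[rotated])
    then show ?thesis using that g by (simp add: inverse_puiseux_def mult.commute)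
  qed
  show "x div y = x * inverse y" by (rule divide_puiseux_def)
  show "inverse (0 :: puiseux) = 0" by (simp add: inverse_puiseux_def)
qed

end

lemma puiseux_zero_less_iff: "0 < f \<longleftrightarrow> f \<noteq> 0 \<and> pcoeff f (lead_exp f) > 0"
  by (simp add: less_puiseux_def puiseux_pos_def)


section \<open>Polyhedral cones and signed valuation\<close>

text \<open>
  The number \<open>n\<close> of rows of the matrix may depend on the cone, so the matrix is given as the family
  of its rows \<open>A 0, \<dots>, A (n - 1)\<close>.
\<close>

definition is_polyhedral_cone :: "(puiseux ^ 'd) set \<Rightarrow> bool" where
  "is_polyhedral_cone P \<longleftrightarrow>
     (\<exists>(n :: nat) (A :: nat \<Rightarrow> puiseux ^ 'd).
        P = {x. \<forall>i<n. 0 \<le> (\<Sum>j\<in>UNIV. A i $ j * x $ j)})"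

definition is_linear_halfspace :: "(puiseux ^ 'd) set \<Rightarrow> bool" where
  "is_linear_halfspace H \<longleftrightarrow> (\<exists>a. a \<noteq> 0 \<and> H = {x. 0 \<le> (\<Sum>j\<in>UNIV. a $ j * x $ j)})"

definition sval :: "puiseux \<Rightarrow> symtrop" where
  "sval f = (if f = 0 then 0 else if 0 < f then Pos (lead_exp f) else Neg (lead_exp f))"

definition sval_vec :: "puiseux ^ 'd \<Rightarrow> symtrop ^ 'd" where
  "sval_vec x = (\<chi> i. sval (x $ i))"

end

theory Submission
  imports Defs
begin

text \<open>
  Signed tropical numbers are encoded as real numbers, so that a closed linear halfspace becomes
  \<open>half a = {x. some term a i * x i of maximal absolute value is nonnegative}\<close>, a relation that is
  symmetric in \<open>a\<close> and \<open>x\<close>.  TC-convex cones turn out to be the sets closed under nonnegative scaling,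
  left sums (ties are won by the left operand) and filling in of a coordinate that is the only one to
  cancel.

  Double description in every orthant shows that an intersection of finitely many halfspaces is
  finitely generated.  By symmetry of \<open>half\<close>, the converse reduces to a separation statement: a point
  \<open>w\<close> outside the cone \<open>C\<close> generated by a finite set violates some halfspace that contains \<open>C\<close>.  If \<open>w\<close>
  lies both in the cone generated by \<open>C\<close> and \<open>e\<^sub>j\<close> and in the one generated by \<open>C\<close> and \<open>-e\<^sub>j\<close>, then it lies
  in \<open>C\<close>; this allows to add all unit vectors with suitable signs to \<open>C\<close>, whereupon the dual variables
  have fixed signs and tropical Fourier--Motzkin elimination applies.

  For the polyhedral cones, ordinary Fourier--Motzkin elimination over the Puiseux series gives finitely
  many inequalities valid on the cone that detect whether the cone meets a box; a fibre of the
  valuation is a union of boxes, so the valuations of these inequalities cut out the image.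
\<close>

section \<open>Signed tropical cones in the real model\<close>

text \<open>Under \<open>exp\<close>, products of signed tropical numbers become products of reals
  and norms become absolute values; a sum is positive or balanced exactly if some nonnegative term
  has maximal absolute value, so balanced numbers need no counterpart. What remains of them is the
  fill rule. It must be restricted to a single cancelling coordinate: \<open>(1, 1)\<close> and
  \<open>(-1, -1)\<close> satisfy \<open>half (1, -1)\<close>, but \<open>(-1, 1)\<close> does not,
  so simultaneous cancellations cannot be filled independently. This restriction shapes the proof.
  Eliminating a dual variable joins two generators that cancel at one coordinate, and ties elsewhere
  would block the fill. With all unit vectors present the cone is upward closed, and tied entries
  can first be raised to positive ones. The price is the sign case distinction, whose undoing needs
  control over a cone to which one unit vector has been adjoined. For polyhedral cones the
  multipliers of the elimination must not depend on the box: the fibres involve infinitely many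
  boxes, but only finitely many tropical inequalities are allowed.\<close>

definition lsum :: "('i \<Rightarrow> real) \<Rightarrow> ('i \<Rightarrow> real) \<Rightarrow> 'i \<Rightarrow> real" where
  "lsum x y = (\<lambda>i. if \<bar>x i\<bar> < \<bar>y i\<bar> then y i else x i)"

definition half :: "('i \<Rightarrow> real) \<Rightarrow> ('i \<Rightarrow> real) \<Rightarrow> bool" where
  "half a x \<longleftrightarrow> (\<exists>i. \<forall>j. \<bar>a j * x j\<bar> \<le> a i * x i)"

definition tc_cone :: "('i \<Rightarrow> real) set \<Rightarrow> bool" where
  "tc_cone C \<longleftrightarrow>
     (\<lambda>_. 0) \<in> C \<and>
     (\<forall>x\<in>C. \<forall>l\<ge>0. (\<lambda>i. l * x i) \<in> C) \<and>
     (\<forall>x\<in>C. \<forall>y\<in>C. lsum x y \<in> C) \<and>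
     (\<forall>x\<in>C. \<forall>y\<in>C. \<forall>k r. x k = - y k \<longrightarrow> (\<forall>i. i \<noteq> k \<longrightarrow> x i = - y i \<longrightarrow> x i = 0) \<longrightarrow>
        \<bar>r\<bar> \<le> \<bar>x k\<bar> \<longrightarrow> (lsum x y)(k := r) \<in> C)"

lemma tc_coneD:
  assumes "tc_cone C"
  shows tc_cone_zero: "(\<lambda>_. 0) \<in> C"
    and tc_cone_scale: "\<And>x l. x \<in> C \<Longrightarrow> 0 \<le> l \<Longrightarrow> (\<lambda>i. l * x i) \<in> C"
    and tc_cone_lsum: "\<And>x y. x \<in> C \<Longrightarrow> y \<in> C \<Longrightarrow> lsum x y \<in> C"
    and tc_cone_fill: "\<And>x y k r. x \<in> C \<Longrightarrow> y \<in> C \<Longrightarrow> x k = - y k \<Longrightarrow>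
      (\<And>i. i \<noteq> k \<Longrightarrow> x i = - y i \<Longrightarrow> x i = 0) \<Longrightarrow> \<bar>r\<bar> \<le> \<bar>x k\<bar> \<Longrightarrow> (lsum x y)(k := r) \<in> C"
  using assms unfolding tc_cone_def by blast+

lemma tc_coneI:
  assumes "(\<lambda>_. 0) \<in> C"
    and "\<And>x l. x \<in> C \<Longrightarrow> 0 \<le> l \<Longrightarrow> (\<lambda>i. l * x i) \<in> C"
    and "\<And>x y. x \<in> C \<Longrightarrow> y \<in> C \<Longrightarrow> lsum x y \<in> C"
    and "\<And>x y k r. x \<in> C \<Longrightarrow> y \<in> C \<Longrightarrow> x k = - y k \<Longrightarrow>
      (\<And>i. i \<noteq> k \<Longrightarrow> x i = - y i \<Longrightarrow> x i = 0) \<Longrightarrow> \<bar>r\<bar> \<le> \<bar>x k\<bar> \<Longrightarrow> (lsum x y)(k := r) \<in> C"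
  shows "tc_cone C"
  using assms unfolding tc_cone_def by blast

lemma tc_cone_Inter: "(\<And>C. C \<in> F \<Longrightarrow> tc_cone C) \<Longrightarrow> tc_cone (\<Inter>F)"
  by (rule tc_coneI) (auto intro: tc_coneD)

lemma tc_cone_hull: "tc_cone (tc_cone hull M)"
  by (rule hull_in) (simp add: tc_cone_Inter)

lemma half_commute: "half a x \<longleftrightarrow> half x a"
  by (simp add: half_def mult.commute)

text \<open>A term of maximal absolute value is either nonnegative or matched by a positive one. In
  this form each negative term asks for its own counterweight, which is convenient once the signs of
  the terms are known.\<close>

lemma half_iff_neg:
  fixes a x :: "'i::finite \<Rightarrow> real"
  shows "half a x \<longleftrightarrow> (\<forall>i. a i * x i < 0 \<longrightarrow> (\<exists>j. - (a i * x i) \<le> a j * x j))"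
proof
  assume "half a x"
  then obtain k where k: "\<bar>a j * x j\<bar> \<le> a k * x k" for j unfolding half_def by blast
  show "\<forall>i. a i * x i < 0 \<longrightarrow> (\<exists>j. - (a i * x i) \<le> a j * x j)"
    using k by (metis abs_le_D2)
next
  assume R: "\<forall>i. a i * x i < 0 \<longrightarrow> (\<exists>j. - (a i * x i) \<le> a j * x j)"
  let ?S = "range (\<lambda>j. \<bar>a j * x j\<bar>)"
  have "Max ?S \<in> ?S" by (rule Max_in) auto
  then obtain k where k: "Max ?S = \<bar>a k * x k\<bar>" by (rule rangeE)
  have m: "\<bar>a j * x j\<bar> \<le> \<bar>a k * x k\<bar>" for j unfolding k[symmetric] by (rule Max_ge) auto
  show "half a x"
  proof (cases "a k * x k < 0")
    case True
    then obtain l where l: "- (a k * x k) \<le> a l * x l" using R by blast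
    have "\<bar>a j * x j\<bar> \<le> a l * x l" for j using m[of j] l True by linarith
    then show ?thesis unfolding half_def by blast
  next
    case False
    then show ?thesis using m unfolding half_def by (intro exI[of _ k]) auto
  qed
qed

text \<open>The dominating term of the sum comes from the operand with the larger maximum, the left
  one on a tie; if it were overwritten at its index, the other maximum would be larger. For the fill
  rule with a positive maximum, the two witnesses cannot both sit at \<open>k\<close>, where the
  entries have opposite signs, and at any other index the larger value survives because nothing
  cancels there.\<close>

lemma half_tc_cone:
  fixes a :: "'i::finite \<Rightarrow> real"
  shows "tc_cone {x. half a x}"
proof (rule tc_coneI; clarsimp)
  show "half a (\<lambda>_. 0)" by (simp add: half_def)
next
  fix x :: "'i \<Rightarrow> real" and l :: real
  assume "half a x" "0 \<le> l"
  then obtain k where k: "\<bar>a j * x j\<bar> \<le> a k * x k" for j unfolding half_def by blast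
  have "\<bar>a j * (l * x j)\<bar> \<le> a k * (l * x k)" for j
    using mult_left_mono[OF k[of j] \<open>0 \<le> l\<close>] \<open>0 \<le> l\<close> by (simp add: abs_mult ac_simps)
  then show "half a (\<lambda>i. l * x i)" unfolding half_def by blast
next
  fix x y :: "'i \<Rightarrow> real"
  assume "half a x" "half a y"
  then obtain k l where k: "\<And>j. \<bar>a j\<bar> * \<bar>x j\<bar> \<le> a k * x k" and l: "\<And>j. \<bar>a j\<bar> * \<bar>y j\<bar> \<le> a l * y l"
    unfolding half_def abs_mult by blast
  have b: "\<bar>a j\<bar> * \<bar>lsum x y j\<bar> \<le> max (a k * x k) (a l * y l)" for j
    using k[of j] l[of j] by (auto simp: lsum_def)
  show "half a (lsum x y)"
  proof (cases "a l * y l \<le> a k * x k")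
    case True
    have "a k * x k \<le> a k * lsum x y k"
    proof (cases "\<bar>x k\<bar> < \<bar>y k\<bar> \<and> a k \<noteq> 0")
      case c: True
      then have "\<bar>a k\<bar> * \<bar>x k\<bar> < \<bar>a k\<bar> * \<bar>y k\<bar>" by simp
      moreover have "a k * x k \<le> \<bar>a k\<bar> * \<bar>x k\<bar>" by (metis abs_ge_self abs_mult)
      ultimately show ?thesis using l[of k] True by linarith
    qed (auto simp: lsum_def)
    then show ?thesis unfolding half_def abs_mult using b True
      by (intro exI[of _ k]) (metis max.absorb1 order_trans)
  next
    case False
    have "lsum x y l = y l"
    proof -
      have "\<bar>a l\<bar> * \<bar>x l\<bar> < a l * y l" using k[of l] False by linarith
      also have "\<dots> \<le> \<bar>a l\<bar> * \<bar>y l\<bar>" by (metis abs_ge_self abs_mult)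
      finally have "\<bar>x l\<bar> < \<bar>y l\<bar>" by (meson abs_ge_zero mult_less_cancel_left_pos mult_le_cancel_left not_less mult_left_mono)
      then show ?thesis by (simp add: lsum_def)
    qed
    then show ?thesis unfolding half_def abs_mult using b False
      by (intro exI[of _ l]) (metis max.absorb2 less_imp_le not_le)
  qed
next
  fix x y :: "'i \<Rightarrow> real" and k :: 'i and r :: real
  assume hx: "half a x" and hy: "half a y" and xk: "x k = - y k"
    and nc: "\<And>i. i \<noteq> k \<Longrightarrow> x i = - y i \<Longrightarrow> y i = 0" and r: "\<bar>r\<bar> \<le> \<bar>y k\<bar>"
  obtain i0 i1 where i0: "\<And>j. \<bar>a j\<bar> * \<bar>x j\<bar> \<le> a i0 * x i0" and i1: "\<And>j. \<bar>a j\<bar> * \<bar>y j\<bar> \<le> a i1 * y i1"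
    using hx hy unfolding half_def abs_mult by blast
  let ?z = "(lsum x y)(k := r)"
  have rk: "\<bar>a k\<bar> * \<bar>r\<bar> \<le> \<bar>a k\<bar> * \<bar>y k\<bar>" using r by (simp add: mult_left_mono)
  have b: "\<bar>a j\<bar> * \<bar>?z j\<bar> \<le> max (a i0 * x i0) (a i1 * y i1)" for j
    using i0[of j] i1[of j] rk i1[of k] by (auto simp: lsum_def le_max_iff_disj)
  have up: "a j * t \<le> \<bar>a j\<bar> * \<bar>t\<bar>" for j t by (metis abs_ge_self abs_mult)
  have key: "\<exists>i. max (a i0 * x i0) (a i1 * y i1) \<le> a i * ?z i"
  proof (cases "a i0 * x i0 \<le> 0 \<and> a i1 * y i1 \<le> 0")
    case True
    then have "\<bar>a j\<bar> * \<bar>?z j\<bar> = 0" for j using b[of j] by (smt (verit) abs_ge_zero mult_nonneg_nonneg)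
    then have "a i0 * ?z i0 = 0" by (metis abs_eq_0 mult_eq_0_iff)
    then show ?thesis using True by (intro exI[of _ i0]) auto
  next
    case pos: False
    show ?thesis
    proof (cases "a i1 * y i1 \<le> a i0 * x i0 \<and> i0 \<noteq> k")
      case True
      then have a0: "\<bar>a i0\<bar> > 0" using pos by auto
      have "\<bar>a i0\<bar> * \<bar>y i0\<bar> \<le> \<bar>a i0\<bar> * \<bar>x i0\<bar>" using i1[of i0] up[of i0 "x i0"] True by linarith
      then have "\<bar>y i0\<bar> \<le> \<bar>x i0\<bar>" using a0 by simp
      then show ?thesis using True by (intro exI[of _ i0]) (simp add: lsum_def)
    next
      case F: False
      have ge: "a i0 * x i0 \<le> a i1 * y i1"
      proof (cases "i0 = k")
        case True
        then show ?thesis using i1[of k] up[of k "x k"] xk by (simp; linarith)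
      qed (use F in auto)
      then have p1: "a i1 * y i1 > 0" using pos by linarith
      then have a1: "\<bar>a i1\<bar> > 0" by auto
      have i1k: "i1 \<noteq> k"
      proof
        assume e: "i1 = k"
        then have "\<bar>a k\<bar> * \<bar>x k\<bar> = a k * y k" using i1[of k] up[of k "y k"] xk by simp
        then have "a i0 * x i0 \<ge> a i1 * y i1" using i0[of k] e by simp
        then have "i0 = k" using F by auto
        then show False using p1 ge e xk i0[of k] i1[of k] pos up[of k "y k"] by (auto simp: max_def)
      qed
      have "\<bar>a i1\<bar> * \<bar>x i1\<bar> \<le> \<bar>a i1\<bar> * \<bar>y i1\<bar>" using i0[of i1] up[of i1 "y i1"] ge by linarith
      then have le: "\<bar>x i1\<bar> \<le> \<bar>y i1\<bar>" using a1 by simp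
      have "lsum x y i1 = y i1"
        using le nc[OF i1k] p1 by (auto simp: lsum_def abs_if split: if_splits)
      then show ?thesis using ge i1k by (intro exI[of _ i1]) simp
    qed
  qed
  then obtain i where "max (a i0 * x i0) (a i1 * y i1) \<le> a i * ?z i" by blast
  then show "half a ?z" unfolding half_def abs_mult using b by (meson order_trans)
qed

text \<open>Nonzero factors per coordinate preserve comparisons of absolute values and
  cancellations. With factors 1 and -1 this transports statements between orthants.\<close>

lemma tc_cone_reflect:
  assumes C: "tc_cone C" and s: "\<And>i. s i \<noteq> (0::real)"
  shows "tc_cone {x. (\<lambda>i. s i * x i) \<in> C}"
proof -
  have l: "(\<lambda>i. s i * lsum x y i) = lsum (\<lambda>i. s i * x i) (\<lambda>i. s i * y i)" for x y
    using s by (auto simp: lsum_def fun_eq_iff abs_mult)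
  show ?thesis
  proof (rule tc_coneI; clarsimp)
    show "(\<lambda>i. 0) \<in> C" using tc_cone_zero[OF C] .
  next
    fix x :: "'a \<Rightarrow> real" and t :: real
    assume "(\<lambda>i. s i * x i) \<in> C" "0 \<le> t"
    from tc_cone_scale[OF C this] show "(\<lambda>i. s i * (t * x i)) \<in> C" by (simp add: ac_simps)
  next
    fix x y
    assume "(\<lambda>i. s i * x i) \<in> C" "(\<lambda>i. s i * y i) \<in> C"
    then show "(\<lambda>i. s i * lsum x y i) \<in> C" unfolding l by (rule tc_cone_lsum[OF C])
  next
    fix x y :: "'a \<Rightarrow> real" and k r
    assume *: "(\<lambda>i. s i * x i) \<in> C" "(\<lambda>i. s i * y i) \<in> C" "x k = - y k"
      "\<And>i. i \<noteq> k \<Longrightarrow> x i = - y i \<Longrightarrow> y i = 0" "\<bar>r\<bar> \<le> \<bar>y k\<bar>"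
    have "(lsum (\<lambda>i. s i * x i) (\<lambda>i. s i * y i))(k := s k * r) \<in> C"
    proof (rule tc_cone_fill[OF C *(1,2)])
      fix i assume "i \<noteq> k" "s i * x i = - (s i * y i)"
      then have "x i = - y i" using s[of i] by (metis mult_cancel_left mult_minus_right)
      then show "s i * x i = 0" using *(4)[OF \<open>i \<noteq> k\<close>] by simp
    qed (use *(3,5) in \<open>auto simp: abs_mult intro: mult_left_mono\<close>)
    moreover have "(lsum (\<lambda>i. s i * x i) (\<lambda>i. s i * y i))(k := s k * r) = (\<lambda>i. s i * (if i = k then r else lsum x y i))"
      by (auto simp: l[symmetric])
    ultimately show "(\<lambda>i. s i * (if i = k then r else lsum x y i)) \<in> C" by simp
  qed
qed

lemma half_reflect: "half (\<lambda>i. s i * a i) x \<longleftrightarrow> half a (\<lambda>i. s i * x i)"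
  by (simp add: half_def ac_simps)

section \<open>Adjoining a unit vector to a cone, and undoing it\<close>

definition unitv :: "'i \<Rightarrow> 'i \<Rightarrow> real" where
  "unitv j = (\<lambda>i. if i = j then 1 else 0)"

lemma unitv_simps [simp]: "unitv j j = 1" "i \<noteq> j \<Longrightarrow> unitv j i = 0"
  by (simp_all add: unitv_def)

lemma lsum_absorb_left: "0 \<le> t \<Longrightarrow> t \<le> 1 \<Longrightarrow> lsum x (\<lambda>i. t * x i) = x"
  by (auto simp: lsum_def fun_eq_iff abs_mult) (smt (verit) mult_left_le_one_le abs_ge_zero)

lemma lsum_assoc: "lsum (lsum x y) z = lsum x (lsum y z)"
  by (auto simp: lsum_def fun_eq_iff)

lemma abs_lsum: "\<bar>lsum x y i\<bar> = max \<bar>x i\<bar> \<bar>y i\<bar>"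
  by (auto simp: lsum_def)

lemma lsum_mono: "x i \<le> x' i \<Longrightarrow> y i \<le> y' i \<Longrightarrow> lsum x y i \<le> lsum x' y' i"
  by (auto simp: lsum_def split: if_splits)

text \<open>The operand that is larger at \<open>j\<close> is scaled down until it contributes
  exactly the wanted entry, or until it cancels the other one and the fill rule supplies the entry.
  Off \<open>j\<close> the unscaled operand wins.\<close>

lemma segment_along_coordinate:
  assumes C: "tc_cone C" and u: "u \<in> C" and v: "v \<in> C"
    and eq: "\<And>i. i \<noteq> j \<Longrightarrow> u i = w i" "\<And>i. i \<noteq> j \<Longrightarrow> v i = w i"
    and le: "u j \<le> w j" "w j \<le> v j"
  shows "w \<in> C"
proof -
  have main: "w \<in> C" if u: "u \<in> C" and v: "v \<in> C"
    and eq: "\<And>i. i \<noteq> j \<Longrightarrow> u i = w i" "\<And>i. i \<noteq> j \<Longrightarrow> v i = w i"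
    and le: "min (u j) (v j) \<le> w j" "w j \<le> max (u j) (v j)" and ab: "\<bar>u j\<bar> \<le> \<bar>v j\<bar>" for u v
  proof (cases "\<bar>w j\<bar> > \<bar>u j\<bar>")
    case True
    define t where "t = w j / v j"
    have nz: "v j \<noteq> 0" using True ab le by auto
    have t: "0 \<le> t" "t \<le> 1" using True ab le unfolding t_def
      by (auto simp: divide_simps min_def max_def abs_if split: if_splits)
    have "lsum u (\<lambda>i. t * v i) = w"
    proof
      fix i
      show "lsum u (\<lambda>i. t * v i) i = w i"
      proof (cases "i = j")
        case True
        have "t * v j = w j" using nz by (simp add: t_def)
        then show ?thesis using True \<open>\<bar>w j\<bar> > \<bar>u j\<bar>\<close> by (simp add: lsum_def)
      next
        case False
        have "\<bar>t * w i\<bar> \<le> \<bar>w i\<bar>" using t by (simp add: abs_mult mult_left_le_one_le)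
        then show ?thesis using eq[OF False] by (simp add: lsum_def)
      qed
    qed
    then show ?thesis using tc_cone_lsum[OF C u tc_cone_scale[OF C v t(1)]] by simp
  next
    case False
    show ?thesis
    proof (cases "u j = w j")
      case True
      then have "u = w" using eq by (metis ext)
      then show ?thesis using u by simp
    next
      case ne: False
      then have opp: "u j * v j < 0" "v j \<noteq> 0" using False le ab
        by (auto simp: min_def max_def abs_if mult_less_0_iff split: if_splits)
      define t where "t = - u j / v j"
      have t: "0 \<le> t" "t \<le> 1" "t * v j = - u j" using opp ab unfolding t_def
        by (auto simp: divide_simps mult_less_0_iff abs_if split: if_splits)
      have "(lsum u (\<lambda>i. t * v i))(j := w j) \<in> C"
      proof (rule tc_cone_fill[OF C u tc_cone_scale[OF C v t(1)]])
        fix i assume i: "i \<noteq> j" "u i = - (t * v i)"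
        then have "u i * (1 + t) = 0" using eq by (simp add: algebra_simps)
        then show "u i = 0" using t by auto
      qed (use t False in auto)
      moreover have "(lsum u (\<lambda>i. t * v i))(j := w j) = w"
      proof
        fix i
        have "\<bar>t * w i\<bar> \<le> \<bar>w i\<bar>" using t by (simp add: abs_mult mult_left_le_one_le)
        then show "((lsum u (\<lambda>i. t * v i))(j := w j)) i = w i" using eq[of i] by (simp add: lsum_def)
      qed
      ultimately show ?thesis by simp
    qed
  qed
  show ?thesis
  proof (cases "\<bar>u j\<bar> \<le> \<bar>v j\<bar>")
    case True
    show ?thesis by (rule main[OF u v eq _ _ True]) (use le in linarith)+
  next
    case False
    show ?thesis by (rule main[OF v u eq(2,1)]) (use le False in linarith)+
  qed
qed

text \<open>
  \<open>upshadow C j\<close> contains the cone generated by \<open>C\<close> and the unit vector of coordinate \<open>j\<close>.  A vector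
  whose \<open>j\<close>-th entry is positive may have used up a cancellation at \<open>j\<close> in \<open>C\<close>; such a cancellation
  is resolved by composing with an element of \<open>C\<close> from the left.
\<close>

definition upshadow :: "('i \<Rightarrow> real) set \<Rightarrow> 'i \<Rightarrow> ('i \<Rightarrow> real) set" where
  "upshadow C j = {u.
     (u j \<le> 0 \<longrightarrow> (\<exists>c\<in>C. (\<forall>i. i \<noteq> j \<longrightarrow> c i = u i) \<and> c j \<le> u j)) \<and>
     (u j > 0 \<longrightarrow> (\<forall>v\<in>C. \<bar>v j\<bar> = u j \<longrightarrow>
        (\<exists>c\<in>C. (\<forall>i. i \<noteq> j \<longrightarrow> c i = lsum v u i) \<and> c j \<le> v j)))}"

lemma upshadow_nonpos:
  assumes "u \<in> upshadow C j" "u j \<le> 0"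
  obtains c where "c \<in> C" "\<And>i. i \<noteq> j \<Longrightarrow> c i = u i" "c j \<le> u j"
  using assms unfolding upshadow_def by blast

text \<open>The bound at \<open>j\<close> suffices for the second clause too: \<open>v\<close> is
  composed with \<open>c\<close>, and as \<open>c j\<close> is at most
  \<open>\<bar>v j\<bar>\<close>, it can overwrite \<open>v j\<close> only by something
  smaller.\<close>

lemma upshadowI:
  assumes C: "tc_cone C" and c: "c \<in> C" "\<And>i. i \<noteq> j \<Longrightarrow> c i = u i" "c j \<le> u j"
  shows "u \<in> upshadow C j"
proof -
  have "\<exists>c\<in>C. (\<forall>i. i \<noteq> j \<longrightarrow> c i = lsum v u i) \<and> c j \<le> v j" if "v \<in> C" "\<bar>v j\<bar> = u j" for v
    using tc_cone_lsum[OF C \<open>v \<in> C\<close> c(1)] that c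
    by (intro bexI[of _ "lsum v c"]) (auto simp: lsum_def)
  then show ?thesis using c unfolding upshadow_def by blast
qed

text \<open>Extends the second clause to left operands that are merely large enough at
  \<open>j\<close>. If \<open>x j\<close> is positive, \<open>v\<close> is shrunk to meet it
  exactly, and the shrunken copy is absorbed by composing with \<open>v\<close> once more. This last
  composition also leaves only two possibilities for the entry at \<open>j\<close>.\<close>

lemma upshadow_compose:
  assumes C: "tc_cone C" and x: "x \<in> upshadow C j" and q: "x j \<le> \<bar>v j\<bar>" and v: "v \<in> C"
  obtains c where "c \<in> C" "\<And>i. i \<noteq> j \<Longrightarrow> c i = lsum v x i" "c j = v j \<or> c j < - \<bar>v j\<bar>"
proof -
  have "\<exists>c\<in>C. (\<forall>i. i \<noteq> j \<longrightarrow> c i = lsum v x i) \<and> c j \<le> \<bar>v j\<bar>"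
  proof (cases "x j \<le> 0")
    case True
    then obtain c where "c \<in> C" "\<And>i. i \<noteq> j \<Longrightarrow> c i = x i" "c j \<le> x j"
      using upshadow_nonpos[OF x] by blast
    then show ?thesis using True tc_cone_lsum[OF C v \<open>c \<in> C\<close>]
      by (intro bexI[of _ "lsum v c"]) (auto simp: lsum_def)
  next
    case False
    define t where "t = x j / \<bar>v j\<bar>"
    have vj: "\<bar>v j\<bar> > 0" using False q by linarith
    then have t: "0 \<le> t" "t \<le> 1" using q False by (auto simp: t_def divide_simps)
    have "\<bar>t * v j\<bar> = x j" using vj False by (simp add: t_def abs_mult)
    then obtain c where c: "c \<in> C" "\<And>i. i \<noteq> j \<Longrightarrow> c i = lsum (\<lambda>i. t * v i) x i" "c j \<le> t * v j"
      using x False tc_cone_scale[OF C v t(1)] unfolding upshadow_def by auto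
    have "lsum v c i = lsum v x i" if "i \<noteq> j" for i
    proof -
      have "lsum v c i = lsum v (lsum (\<lambda>i. t * v i) x) i" using c(2)[OF that] by (simp add: lsum_def)
      also have "\<dots> = lsum v x i" by (simp only: lsum_assoc[symmetric] lsum_absorb_left[OF t])
      finally show ?thesis .
    qed
    moreover have "lsum v c j \<le> \<bar>v j\<bar>"
    proof -
      have "\<bar>t * v j\<bar> \<le> \<bar>v j\<bar>" using t by (simp add: abs_mult mult_left_le_one_le)
      then show ?thesis using c(3) by (auto simp: lsum_def)
    qed
    ultimately show ?thesis using tc_cone_lsum[OF C v c(1)] by blast
  qed
  then obtain c where c: "c \<in> C" "\<And>i. i \<noteq> j \<Longrightarrow> c i = lsum v x i" "c j \<le> \<bar>v j\<bar>" by blast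
  show thesis
  proof (rule that)
    show "lsum v c \<in> C" by (rule tc_cone_lsum[OF C v c(1)])
    show "lsum v c i = lsum v x i" if "i \<noteq> j" for i using c(2)[OF that] by (simp add: lsum_def)
    show "lsum v c j = v j \<or> lsum v c j < - \<bar>v j\<bar>" using c(3) by (auto simp: lsum_def)
  qed
qed

lemma lsum_distrib_left:
  "c i = lsum v x i \<Longrightarrow> d i = lsum v y i \<Longrightarrow> lsum c d i = lsum v (lsum x y) i"
  by (auto simp: lsum_def)

text \<open>Wherever the smaller multiple of \<open>y\<close> beats \<open>x\<close>, the vector
  \<open>y\<close> itself beats both. So a vector can be used on the left without winning the ties
  it ought to lose.\<close>

lemma lsum_premult_absorb:
  assumes "0 \<le> t" "t < 1"
  shows "lsum (lsum (\<lambda>i. t * y i) x) y i = lsum x y i"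
proof -
  have "\<bar>t * y i\<bar> < \<bar>y i\<bar> \<or> y i = 0" using assms by (auto simp: abs_mult)
  then show ?thesis by (auto simp: lsum_def)
qed

lemma lsum_fill_commute:
  assumes "\<And>i. i \<noteq> k \<Longrightarrow> x i = - y i \<Longrightarrow> x i = 0"
  shows "(lsum x y)(k := r) = (lsum y x)(k := (r :: real))"
proof
  fix i
  have "lsum x y i = lsum y x i" if "i \<noteq> k"
    using assms[OF that] by (auto simp: lsum_def abs_if split: if_splits)
  then show "((lsum x y)(k := r)) i = ((lsum y x)(k := r)) i" by simp
qed

text \<open>Elements of \<open>C\<close> obtained from the operands are composed so that the entries
  off \<open>j\<close> are as prescribed and the entry at \<open>j\<close> only gets smaller. A
  positive entry at \<open>j\<close> is removed by composing with a vector that is negative there; a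
  test vector \<open>v\<close> distributes over the sum.\<close>

lemma upshadow_tc_cone:
  assumes C: "tc_cone C"
  shows "tc_cone (upshadow C j)"
proof (rule tc_coneI)
  show zero: "(\<lambda>_. 0) \<in> upshadow C j"
    by (rule upshadowI[OF C tc_cone_zero[OF C]]) auto
next
  fix x :: "'a \<Rightarrow> real" and l :: real
  assume x: "x \<in> upshadow C j" and l: "0 \<le> l"
  show "(\<lambda>i. l * x i) \<in> upshadow C j"
  proof (cases "l = 0 \<or> x j \<le> 0")
    case True
    then obtain c where "c \<in> C" "\<And>i. i \<noteq> j \<Longrightarrow> l * c i = l * x i" "l * c j \<le> l * x j"
    proof (cases "l = 0")
      case False
      then obtain c where "c \<in> C" "\<And>i. i \<noteq> j \<Longrightarrow> c i = x i" "c j \<le> x j"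
        using upshadow_nonpos[OF x] True by blast
      then show thesis using that[of c] l by (simp add: mult_left_mono)
    qed (use tc_cone_zero[OF C] in auto)
    then show ?thesis
      by (intro upshadowI[OF C tc_cone_scale[OF C _ l]]) auto
  next
    case False
    then have lp: "l > 0" and xj: "x j > 0" using l by auto
    have "\<exists>c\<in>C. (\<forall>i. i \<noteq> j \<longrightarrow> c i = lsum v (\<lambda>i. l * x i) i) \<and> c j \<le> v j"
      if v: "v \<in> C" "\<bar>v j\<bar> = l * x j" for v
    proof -
      have l': "0 \<le> 1 / l" using lp by simp
      have "\<bar>1 / l * v j\<bar> = x j" using lp v by (simp add: abs_mult)
      then obtain c where c: "c \<in> C" "\<And>i. i \<noteq> j \<Longrightarrow> c i = lsum (\<lambda>i. 1 / l * v i) x i" "c j \<le> 1 / l * v j"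
        using x xj tc_cone_scale[OF C v(1) l'] unfolding upshadow_def by auto
      have "l * lsum (\<lambda>i. 1 / l * v i) x i = lsum v (\<lambda>i. l * x i) i" for i
        using lp by (auto simp: lsum_def abs_mult field_simps)
      moreover have "l * c j \<le> v j" using c(3) lp by (simp add: field_simps)
      ultimately show ?thesis
        using c tc_cone_scale[OF C c(1) l] by (intro bexI[of _ "\<lambda>i. l * c i"]) auto
    qed
    then show ?thesis using lp xj unfolding upshadow_def by (auto simp: mult_le_0_iff)
  qed
next
  fix x y :: "'a \<Rightarrow> real"
  assume x: "x \<in> upshadow C j" and y: "y \<in> upshadow C j"
  show "lsum x y \<in> upshadow C j"
  proof (cases "lsum x y j \<le> 0")
    case neg: True
    consider "x j \<le> 0" "y j \<le> 0" | "x j < 0" "0 < y j" "y j \<le> - x j" | "y j < 0" "0 < x j" "x j < - y j"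
      using neg unfolding lsum_def by (smt (verit))
    then show ?thesis
    proof cases
      case 1
      obtain c where c: "c \<in> C" "\<And>i. i \<noteq> j \<Longrightarrow> c i = x i" "c j \<le> x j" using upshadow_nonpos[OF x 1(1)] by blast
      obtain d where d: "d \<in> C" "\<And>i. i \<noteq> j \<Longrightarrow> d i = y i" "d j \<le> y j" using upshadow_nonpos[OF y 1(2)] by blast
      show ?thesis
        by (rule upshadowI[OF C tc_cone_lsum[OF C c(1) d(1)]])
          (use c d in \<open>auto intro: lsum_mono simp: lsum_def\<close>)
    next
      \<comment> \<open>Here \<open>x\<close> wins at \<open>j\<close> and is the left operand as
        well, so its representative can itself do the composing.\<close>
      case 2
      obtain c where c: "c \<in> C" "\<And>i. i \<noteq> j \<Longrightarrow> c i = x i" "c j \<le> x j"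
        using upshadow_nonpos[OF x] 2 by auto
      obtain d where d: "d \<in> C" "\<And>i. i \<noteq> j \<Longrightarrow> d i = lsum c y i" "d j = c j \<or> d j < - \<bar>c j\<bar>"
        using upshadow_compose[OF C y _ c(1)] 2 c(3) by auto
      show ?thesis
        by (rule upshadowI[OF C d(1)]) (use c d 2 in \<open>auto simp: lsum_def\<close>)
    next
      \<comment> \<open>Here \<open>y\<close> wins at \<open>j\<close>, but placed on the left it
        would also win ties that belong to \<open>x\<close>. A multiple of \<open>c\<close> just
        large enough at \<open>j\<close> does the composing, and \<open>c\<close> itself is added on
        the right.\<close>
      case 3
      obtain c where c: "c \<in> C" "\<And>i. i \<noteq> j \<Longrightarrow> c i = y i" "c j \<le> y j"
        using upshadow_nonpos[OF y] 3 by auto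
      define t where "t = x j / \<bar>c j\<bar>"
      have t: "0 \<le> t" "t < 1" "\<bar>t * c j\<bar> = x j" using 3 c(3) unfolding t_def by (auto simp: abs_mult divide_simps)
      obtain d where d: "d \<in> C" "\<And>i. i \<noteq> j \<Longrightarrow> d i = lsum (\<lambda>i. t * c i) x i" "d j = t * c j \<or> d j < - \<bar>t * c j\<bar>"
        using upshadow_compose[OF C x _ tc_cone_scale[OF C c(1) t(1)]] t(3) by auto
      have eq: "lsum d c i = lsum x y i" if "i \<noteq> j" for i
      proof -
        have "lsum d c i = lsum (lsum (\<lambda>i. t * c i) x) c i" using d(2)[OF that] by (simp add: lsum_def)
        also have "\<dots> = lsum x c i" by (rule lsum_premult_absorb[OF t(1,2)])
        finally show ?thesis using c(2)[OF that] by (simp add: lsum_def)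
      qed
      have "t * c j \<le> 0" using t(1) 3 c(3) by (simp add: mult_nonneg_nonpos)
          then have "d j \<le> 0" using d(3) by auto
      then have "lsum d c j \<le> lsum x y j" using c(3) 3 by (auto simp: lsum_def)
      then show ?thesis using upshadowI[OF C tc_cone_lsum[OF C d(1) c(1)]] eq by blast
    qed
  next
    case pos: False
    have "\<exists>c\<in>C. (\<forall>i. i \<noteq> j \<longrightarrow> c i = lsum v (lsum x y) i) \<and> c j \<le> v j"
      if v: "v \<in> C" "\<bar>v j\<bar> = lsum x y j" for v
    proof -
      have le: "x j \<le> \<bar>v j\<bar>" "y j \<le> \<bar>v j\<bar>" using abs_lsum[of x y j] v pos by (auto simp: le_max_iff_disj)
      obtain c where c: "c \<in> C" "\<And>i. i \<noteq> j \<Longrightarrow> c i = lsum v x i" "c j = v j \<or> c j < - \<bar>v j\<bar>"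
        using upshadow_compose[OF C x le(1) v(1)] by blast
      obtain d where d: "d \<in> C" "\<And>i. i \<noteq> j \<Longrightarrow> d i = lsum v y i" "d j = v j \<or> d j < - \<bar>v j\<bar>"
        using upshadow_compose[OF C y le(2) v(1)] by blast
      have "lsum c d i = lsum v (lsum x y) i" if "i \<noteq> j" for i
        by (rule lsum_distrib_left) (use c(2) d(2) that in blast)+
      moreover have "lsum c d j \<le> v j" using c(3) d(3) by (auto simp: lsum_def)
      ultimately show ?thesis using tc_cone_lsum[OF C c(1) d(1)] by blast
    qed
    then show ?thesis using pos unfolding upshadow_def by auto
  qed
  note lsum_closed = this
next
  \<comment> \<open>The degenerate fill at \<open>j\<close>: both entries vanish, which forces
    \<open>r = 0\<close>.\<close>
  have lsum_case: "(lsum x y)(j := 0) \<in> upshadow C j"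
    if x: "x \<in> upshadow C j" "x j = 0" and y: "y \<in> upshadow C j" "y j = 0" for x y
  proof -
    obtain c where c: "c \<in> C" "\<And>i. i \<noteq> j \<Longrightarrow> c i = x i" "c j \<le> x j"
      using upshadow_nonpos[OF x(1)] x(2) by auto
    obtain d where d: "d \<in> C" "\<And>i. i \<noteq> j \<Longrightarrow> d i = y i" "d j \<le> y j"
      using upshadow_nonpos[OF y(1)] y(2) by auto
    show ?thesis
      by (rule upshadowI[OF C tc_cone_lsum[OF C c(1) d(1)]])
        (use c d x y in \<open>auto simp: lsum_def\<close>)
  qed
  \<comment> \<open>As nothing else cancels, the sum is symmetric off \<open>k\<close>, hence the
    harmless assumption \<open>y j \<le> x j\<close>.\<close>
  have main: "(lsum x y)(k := r) \<in> upshadow C j"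
    if x: "x \<in> upshadow C j" and y: "y \<in> upshadow C j" and xk: "x k = - y k"
      and nc: "\<And>i. i \<noteq> k \<Longrightarrow> x i = - y i \<Longrightarrow> x i = 0" and r: "\<bar>r\<bar> \<le> \<bar>x k\<bar>" and yx: "y j \<le> x j"
    for x y k r
  proof -
    let ?z = "(lsum x y)(k := r)"
    show ?thesis
    proof (cases "k = j")
      case kj: True
      show ?thesis
      proof (cases "y j = 0")
        case True
        then show ?thesis using lsum_case x y xk r kj by simp
      next
        case False
        then have yj: "y j < 0" using yx xk kj by auto
        obtain c where c: "c \<in> C" "\<And>i. i \<noteq> j \<Longrightarrow> c i = y i" "c j \<le> y j"
          using upshadow_nonpos[OF y] yj by auto
        \<comment> \<open>With the representative of \<open>y\<close> on the left, the entry at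
          \<open>j\<close> falls to at most \<open>y j = - \<bar>x j\<bar>\<close>, which is below
          every admissible \<open>r\<close>.\<close>
        obtain d where d: "d \<in> C" "\<And>i. i \<noteq> j \<Longrightarrow> d i = lsum c x i" "d j = c j \<or> d j < - \<bar>c j\<bar>"
          using upshadow_compose[OF C x _ c(1)] xk kj yj c(3) by auto
        show ?thesis
        proof (rule upshadowI[OF C d(1)])
          show "d i = ?z i" if "i \<noteq> j" for i
            using d(2)[OF that] c(2)[OF that] nc[of i] that kj
            by (auto simp: lsum_def abs_if split: if_splits)
          show "d j \<le> ?z j" using d(3) c(3) r xk kj yj by auto
        qed
      qed
    next
      case kj: False
      then have zj: "?z j = lsum x y j" by simp
      have ncj: "x j = - y j \<Longrightarrow> x j = 0" by (rule nc[OF kj[symmetric]])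
      show ?thesis
      proof (cases "lsum x y j \<le> 0")
        case neg: True
        show ?thesis
        proof (cases "x j \<le> 0")
          case True
          then have yj: "y j \<le> 0" using yx by simp
          obtain c where c: "c \<in> C" "\<And>i. i \<noteq> j \<Longrightarrow> c i = x i" "c j \<le> x j" using upshadow_nonpos[OF x True] by blast
          obtain d where d: "d \<in> C" "\<And>i. i \<noteq> j \<Longrightarrow> d i = y i" "d j \<le> y j" using upshadow_nonpos[OF y yj] by blast
          have "(lsum c d)(k := r) \<in> C"
          proof (rule tc_cone_fill[OF C c(1) d(1)])
            fix i assume i: "i \<noteq> k" "c i = - d i"
            show "c i = 0"
              using i nc[of i] c(2)[of i] d(2)[of i] c(3) d(3) True yj by (cases "i = j") auto
          qed (use xk r kj c d in auto)
          then show ?thesis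
            by (rule upshadowI[OF C]) (use c d kj in \<open>auto intro: lsum_mono simp: lsum_def\<close>)
        next
          case False
          then have 3: "0 < x j" "y j < 0" "x j < - y j"
            using neg ncj by (auto simp: lsum_def abs_if split: if_splits)
          obtain c where c: "c \<in> C" "\<And>i. i \<noteq> j \<Longrightarrow> c i = y i" "c j \<le> y j"
            using upshadow_nonpos[OF y] 3 by auto
          define t where "t = x j / \<bar>c j\<bar>"
          have t: "0 \<le> t" "t < 1" "\<bar>t * c j\<bar> = x j" using 3 c(3) unfolding t_def by (auto simp: abs_mult divide_simps)
          obtain d where d: "d \<in> C" "\<And>i. i \<noteq> j \<Longrightarrow> d i = lsum (\<lambda>i. t * c i) x i" "d j = t * c j \<or> d j < - \<bar>t * c j\<bar>"
            using upshadow_compose[OF C x _ tc_cone_scale[OF C c(1) t(1)]] t(3) by auto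
          have tc: "\<bar>t * c i\<bar> < \<bar>c i\<bar> \<or> c i = 0" for i using t by (auto simp: abs_mult)
          have eq: "lsum d c i = lsum x y i" if "i \<noteq> j" for i
          proof -
            have "lsum d c i = lsum (lsum (\<lambda>i. t * c i) x) c i" using d(2)[OF that] by (simp add: lsum_def)
            also have "\<dots> = lsum x c i" by (rule lsum_premult_absorb[OF t(1,2)])
            finally show ?thesis using c(2)[OF that] by (simp add: lsum_def)
          qed
          have "t * c j \<le> 0" using t(1) 3 c(3) by (simp add: mult_nonneg_nonpos)
          then have dj: "d j \<le> 0" using d(3) by auto
          then have le: "lsum d c j \<le> lsum x y j" using c(3) 3 by (auto simp: lsum_def)
          have dk: "d k = x k" using d(2)[OF kj] c(2)[OF kj] tc[of k] xk by (auto simp: lsum_def)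
          have "(lsum d c)(k := r) \<in> C"
          proof (rule tc_cone_fill[OF C d(1) c(1)])
            fix i assume i: "i \<noteq> k" "d i = - c i"
            show "d i = 0"
            proof (cases "i = j")
              case True
              then show ?thesis using i dj c(3) 3 by auto
            next
              case False
              then show ?thesis using i nc[of i] c(2)[of i] d(2)[of i] tc[of i]
                by (auto simp: lsum_def split: if_splits)
            qed
          qed (use xk r kj c dk in auto)
          then show ?thesis by (rule upshadowI[OF C]) (use eq le kj in auto)
        qed
      next
        case pos: False
        have "\<exists>c\<in>C. (\<forall>i. i \<noteq> j \<longrightarrow> c i = lsum v ?z i) \<and> c j \<le> v j"
          if v: "v \<in> C" "\<bar>v j\<bar> = ?z j" for v
        proof -
          have le: "x j \<le> \<bar>v j\<bar>" "y j \<le> \<bar>v j\<bar>" using abs_lsum[of x y j] v pos zj by (auto simp: le_max_iff_disj)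
          have vj: "v j \<noteq> 0" using v(2) zj pos by auto
          obtain c where c: "c \<in> C" "\<And>i. i \<noteq> j \<Longrightarrow> c i = lsum v x i" "c j = v j \<or> c j < - \<bar>v j\<bar>"
            using upshadow_compose[OF C x le(1) v(1)] by blast
          obtain d where d: "d \<in> C" "\<And>i. i \<noteq> j \<Longrightarrow> d i = lsum v y i" "d j = v j \<or> d j < - \<bar>v j\<bar>"
            using upshadow_compose[OF C y le(2) v(1)] by blast
          have eq: "lsum c d i = lsum v (lsum x y) i" if "i \<noteq> j" for i
            by (rule lsum_distrib_left) (use c(2) d(2) that in blast)+
          have lej: "lsum c d j \<le> v j" using c(3) d(3) by (auto simp: lsum_def)
          show ?thesis
          \<comment> \<open>If \<open>v\<close> is smaller than the cancelling entries, the
            cancellation at \<open>k\<close> survives in \<open>c\<close> and \<open>d\<close> and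
            can be filled; otherwise \<open>v\<close> decides the entry at \<open>k\<close>.\<close>
          proof (cases "\<bar>v k\<bar> < \<bar>x k\<bar>")
            case True
            have "(lsum c d)(k := lsum v ?z k) \<in> C"
            proof (rule tc_cone_fill[OF C c(1) d(1)])
              fix i assume i: "i \<noteq> k" "c i = - d i"
              show "c i = 0"
              proof (cases "i = j")
                case True
                then show ?thesis using i c(3) d(3) vj by auto
              next
                case False
                then show ?thesis using i nc[of i] c(2)[of i] d(2)[of i]
                  by (auto simp: lsum_def split: if_splits)
              qed
            qed (use True xk r kj c(2)[of k] d(2)[of k] in \<open>auto simp: lsum_def\<close>)
            moreover have "((lsum c d)(k := lsum v ?z k)) i = lsum v ?z i" if "i \<noteq> j" for i
              using eq[OF that] by (simp add: lsum_def)
            ultimately show ?thesis using lej kj by (intro bexI[of _ "(lsum c d)(k := lsum v ?z k)"]) auto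
          next
            case False
            have "lsum c d i = lsum v ?z i" if "i \<noteq> j" for i
            proof (cases "i = k")
              case True
              then show ?thesis using False r xk c(2)[OF that] d(2)[OF that] by (simp add: lsum_def)
            next
              case F: False
              then show ?thesis using eq[OF that] by (simp add: lsum_def)
            qed
            then show ?thesis using lej tc_cone_lsum[OF C c(1) d(1)] by blast
          qed
        qed
        then show ?thesis using pos zj unfolding upshadow_def by auto
      qed
    qed
  qed
  fix x y :: "'a \<Rightarrow> real" and k r
  assume *: "x \<in> upshadow C j" "y \<in> upshadow C j" "x k = - y k"
    "\<And>i. i \<noteq> k \<Longrightarrow> x i = - y i \<Longrightarrow> x i = 0" "\<bar>r\<bar> \<le> \<bar>x k\<bar>"
  show "(lsum x y)(k := r) \<in> upshadow C j"
  proof (cases "y j \<le> x j")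
    case True
    then show ?thesis using main * by blast
  next
    case False
    have "(lsum y x)(k := r) \<in> upshadow C j"
    proof (rule main[OF *(2,1)])
      show "y i = 0" if "i \<noteq> k" "y i = - x i" for i using *(4)[OF that(1)] that(2) by simp
    qed (use *(3,5) False in auto)
    then show ?thesis using lsum_fill_commute[of k x y r, OF *(4)] by simp
  qed
qed

lemma unitv_in_upshadow:
  assumes C: "tc_cone C"
  shows "unitv j \<in> upshadow C j"
proof -
  have "\<exists>c\<in>C. (\<forall>i. i \<noteq> j \<longrightarrow> c i = lsum v (unitv j) i) \<and> c j \<le> v j" if "v \<in> C" for v
    using that by (intro bexI[of _ v]) (auto simp: lsum_def)
  then show ?thesis unfolding upshadow_def by simp
qed

lemma tc_cone_hull_insert_unitv:
  assumes C: "tc_cone C"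
  shows "tc_cone hull (insert (unitv j) C) \<subseteq> upshadow C j"
proof (rule hull_minimal)
  show "insert (unitv j) C \<subseteq> upshadow C j"
    using unitv_in_upshadow[OF C] upshadowI[OF C] by blast
qed (rule upshadow_tc_cone[OF C])

text \<open>The analogue of resolution: a sign case distinction on one dual variable can be undone.\<close>

lemma unitv_resolution:
  assumes C: "tc_cone C"
    and pos: "w \<in> tc_cone hull (insert (unitv j) C)"
    and neg: "w \<in> tc_cone hull (insert (\<lambda>i. - unitv j i) C)"
  shows "w \<in> C"
proof -
  define s where "s = (\<lambda>i. if i = j then -1 else 1 :: real)"
  define r where "r x = (\<lambda>i. s i * x i)" for x :: "'a \<Rightarrow> real"
  have s0: "s i \<noteq> 0" for i by (simp add: s_def)
  have rr [simp]: "r (r x) = x" for x by (simp add: r_def s_def fun_eq_iff)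
  have rj: "r x j = - x j" and ri: "i \<noteq> j \<Longrightarrow> r x i = x i" for x i by (auto simp: r_def s_def)
  define C' where "C' = {x. r x \<in> C}"
  have C': "tc_cone C'" using tc_cone_reflect[OF C s0] by (simp add: C'_def r_def)
  have "tc_cone hull (insert (\<lambda>i. - unitv j i) C) \<subseteq> {x. r x \<in> upshadow C' j}"
  proof (rule hull_minimal)
    show "tc_cone {x. r x \<in> upshadow C' j}"
      using tc_cone_reflect[OF upshadow_tc_cone[OF C'] s0] by (simp add: r_def)
    have "r (\<lambda>i. - unitv j i) = unitv j" by (auto simp: r_def s_def unitv_def)
    moreover have "r c \<in> upshadow C' j" if "c \<in> C" for c
      by (rule upshadowI[OF C', of "r c"]) (use that in \<open>auto simp: C'_def\<close>)
    ultimately show "insert (\<lambda>i. - unitv j i) C \<subseteq> {x. r x \<in> upshadow C' j}"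
      using unitv_in_upshadow[OF C'] by auto
  qed
  then have wn: "r w \<in> upshadow C' j" using neg by blast
  have wp: "w \<in> upshadow C j" using pos tc_cone_hull_insert_unitv[OF C] by blast
  \<comment> \<open>On the side where the entry at \<open>j\<close> is positive, an element coming
    from the other side lies above it. A multiple of that element is a legitimate test vector, and
    it leaves no trace off \<open>j\<close>, where it equals \<open>u\<close> up to a factor of at
    most 1.\<close>
  have cross: "\<exists>c\<in>D. (\<forall>i. i \<noteq> j \<longrightarrow> c i = u i) \<and> c j \<le> u j"
    if u: "u \<in> upshadow D j" "u j > 0" and D: "tc_cone D"
      and v: "v \<in> D" "\<And>i. i \<noteq> j \<Longrightarrow> v i = u i" "u j \<le> v j" for u v and D :: "('a \<Rightarrow> real) set"
  proof -
    define t where "t = u j / v j"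
    have t: "0 \<le> t" "t \<le> 1" "t * v j = u j" using u(2) v(3) by (auto simp: t_def)
    have "\<bar>t * v j\<bar> = u j" using t(3) u(2) by simp
    then obtain c where c: "c \<in> D" "\<And>i. i \<noteq> j \<Longrightarrow> c i = lsum (\<lambda>i. t * v i) u i" "c j \<le> t * v j"
      using u tc_cone_scale[OF D v(1) t(1)] unfolding upshadow_def by auto
    have "c i = u i" if "i \<noteq> j" for i
    proof -
      have "\<bar>t * u i\<bar> < \<bar>u i\<bar> \<or> t * u i = u i" using t by (cases "t = 1") (auto simp: abs_mult)
      then show ?thesis using c(2)[OF that] v(2)[OF that] by (auto simp: lsum_def)
    qed
    then show ?thesis using c t by auto
  qed
  \<comment> \<open>The result is two elements of \<open>C\<close> that differ from \<open>w\<close>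
    at \<open>j\<close> only, one below and, after reflection, one above.\<close>
  have "(\<exists>c\<in>C. (\<forall>i. i \<noteq> j \<longrightarrow> c i = w i) \<and> c j \<le> w j) \<and>
      (\<exists>c\<in>C'. (\<forall>i. i \<noteq> j \<longrightarrow> c i = r w i) \<and> c j \<le> r w j)"
  proof (cases "w j" "0 :: real" rule: linorder_cases)
    case less
    then obtain c where c: "c \<in> C" "\<And>i. i \<noteq> j \<Longrightarrow> c i = w i" "c j \<le> w j"
      using upshadow_nonpos[OF wp] by auto
    have "\<exists>c\<in>C'. (\<forall>i. i \<noteq> j \<longrightarrow> c i = r w i) \<and> c j \<le> r w j"
      by (rule cross[OF wn _ C', of "r c"]) (use c less in \<open>auto simp: C'_def rj ri\<close>)
    then show ?thesis using c by blast
  next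
    case equal
    then show ?thesis using wp wn by (auto simp: upshadow_def rj)
  next
    case greater
    then obtain c where c: "c \<in> C'" "\<And>i. i \<noteq> j \<Longrightarrow> c i = r w i" "c j \<le> r w j"
      using upshadow_nonpos[OF wn] by (auto simp: rj)
    have "\<exists>c\<in>C. (\<forall>i. i \<noteq> j \<longrightarrow> c i = w i) \<and> c j \<le> w j"
      by (rule cross[OF wp greater C, of "r c"]) (use c in \<open>auto simp: C'_def rj ri\<close>)
    then show ?thesis using c by blast
  qed
  then obtain c d where c: "c \<in> C" "\<And>i. i \<noteq> j \<Longrightarrow> c i = w i" "c j \<le> w j"
    and d: "r d \<in> C" "\<And>i. i \<noteq> j \<Longrightarrow> d i = r w i" "d j \<le> r w j" unfolding C'_def by blast
  show ?thesis
    by (rule segment_along_coordinate[OF C c(1) d(1) c(2) _ c(3)]) (use d in \<open>auto simp: rj ri\<close>)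
qed

subsection \<open>Cones containing the nonnegative orthant\<close>

text \<open>A large multiple of a unit vector pushes one coordinate beyond any given value, and the
  segment along this coordinate contains everything in between. The coordinates are treated one
  after the other.\<close>

lemma tc_cone_upward_closed:
  fixes x :: "'i::finite \<Rightarrow> real"
  assumes C: "tc_cone C" and E: "\<And>j. unitv j \<in> C" and x: "x \<in> C" and le: "\<And>i. x i \<le> x' i"
  shows "x' \<in> C"
proof -
  have single: "u(j := r) \<in> C" if u: "u \<in> C" and r: "u j \<le> r" for u :: "'i \<Rightarrow> real" and j r
  proof -
    let ?R = "\<bar>u j\<bar> + \<bar>r\<bar> + 1"
    have "lsum u (\<lambda>i. ?R * unitv j i) \<in> C"
      by (rule tc_cone_lsum[OF C u tc_cone_scale[OF C E]]) simp
    then show ?thesis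
      by (rule segment_along_coordinate[OF C u, where j = j]) (use r in \<open>auto simp: lsum_def\<close>)
  qed
  have "(\<lambda>i. if i \<in> S then x' i else x i) \<in> C" if "finite S" for S
    using that
  proof induction
    case (insert j S)
    have "(\<lambda>i. if i \<in> insert j S then x' i else x i) = (\<lambda>i. if i \<in> S then x' i else x i)(j := x' j)"
      by auto
    then show ?case using single[OF insert.IH, of j "x' j"] insert.hyps le by simp
  qed (use x in simp)
  from this[of UNIV] show ?thesis by simp
qed

section \<open>Fourier-Motzkin elimination of one dual variable\<close>

lemma half_cong: "(\<And>j. x j * a j = y j * b j) \<Longrightarrow> half x a \<longleftrightarrow> half y b"
  by (simp add: half_def)

lemma half_mono_coordinate:
  assumes "half x (a(d := s))" "0 \<le> s" "s \<le> t" "0 \<le> x d"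
  shows "half x (a(d := t))"
proof -
  obtain i where i: "\<bar>x j * (a(d := s)) j\<bar> \<le> x i * (a(d := s)) i" for j
    using assms(1) unfolding half_def by blast
  have st: "x d * s \<le> x d * t" "0 \<le> x d * t" using assms by (auto intro: mult_left_mono)
  show ?thesis
  proof (cases "x i * (a(d := s)) i \<le> x d * t")
    case True
    have "\<bar>x j * (a(d := t)) j\<bar> \<le> x d * t" for j
      using i[of j] True st by (cases "j = d") auto
    then show ?thesis unfolding half_def by (intro exI[of _ d]) simp
  next
    case False
    then have "i \<noteq> d" using st by auto
    have "\<bar>x j * (a(d := t)) j\<bar> \<le> x i * a i" for j
      using i[of j] False st \<open>i \<noteq> d\<close> by (cases "j = d") auto
    then show ?thesis using \<open>i \<noteq> d\<close> unfolding half_def by (intro exI[of _ i]) simp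
  qed
qed

lemma half_antimono_coordinate:
  assumes "half x (a(d := t))" "0 \<le> s" "s \<le> t" "x d \<le> 0"
  shows "half x (a(d := s))"
proof -
  obtain i where i: "\<bar>x j * (a(d := t)) j\<bar> \<le> x i * (a(d := t)) i" for j
    using assms(1) unfolding half_def by blast
  have st: "x d * t \<le> x d * s" "x d * s \<le> 0" "x d * t \<le> 0"
    using assms by (auto intro: mult_left_mono_neg mult_nonpos_nonneg)
  have "x i * (a(d := t)) i \<le> x i * (a(d := s)) i" using st by auto
  moreover have "\<bar>x j * (a(d := s)) j\<bar> \<le> \<bar>x j * (a(d := t)) j\<bar>" for j using st by auto
  ultimately show ?thesis unfolding half_def using i by (meson order_trans)
qed

text \<open>If \<open>half\<close> fails with entry 0 at \<open>d\<close>, the largest term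
  \<open>k\<close> is negative, and the threshold is where the term at \<open>d\<close> balances it.
  This term strictly beats all positive terms off \<open>d\<close>; the strictness later tells from
  which of two combined rows a maximum stems.\<close>

lemma half_lower_bound:
  fixes x a :: "'i::finite \<Rightarrow> real"
  assumes xd: "0 < x d"
  obtains b where "0 \<le> b" "\<And>t. b \<le> t \<Longrightarrow> half x (a(d := t))"
    "b = 0 \<or> (\<exists>k. k \<noteq> d \<and> x d * b = - (x k * a k) \<and> (\<forall>j. j \<noteq> d \<longrightarrow> x j * a j < - (x k * a k)))"
proof (cases "half x (a(d := 0))")
  case True
  show ?thesis by (rule that[of 0]) (use half_mono_coordinate[OF True] xd in auto)
next
  case False
  let ?f = "\<lambda>j. x j * (a(d := 0)) j"
  have "Max (range (\<lambda>j. \<bar>?f j\<bar>)) \<in> range (\<lambda>j. \<bar>?f j\<bar>)" by (rule Max_in) auto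
  then obtain k where k: "Max (range (\<lambda>j. \<bar>?f j\<bar>)) = \<bar>?f k\<bar>" by (rule rangeE)
  have m: "\<bar>?f j\<bar> \<le> \<bar>?f k\<bar>" for j unfolding k[symmetric] by (rule Max_ge) auto
  have lt: "?f j < \<bar>?f k\<bar>" for j
  proof (rule ccontr)
    assume "\<not> ?f j < \<bar>?f k\<bar>"
    then have "\<bar>?f i\<bar> \<le> ?f j" for i using m[of i] by linarith
    then show False using False unfolding half_def by blast
  qed
  have neg: "?f k < 0" using lt[of k] by linarith
  then have kd: "k \<noteq> d" by auto
  show ?thesis
  proof (rule that[of "- (x k * a k) / x d"])
    show "0 \<le> - (x k * a k) / x d" using neg kd xd by (simp add: divide_simps)
    show "- (x k * a k) / x d = 0 \<or> (\<exists>k'. k' \<noteq> d \<and> x d * (- (x k * a k) / x d) = - (x k' * a k') \<and>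
        (\<forall>j. j \<noteq> d \<longrightarrow> x j * a j < - (x k' * a k')))"
    proof (intro disjI2 exI[of _ k] conjI allI impI)
      show "x j * a j < - (x k * a k)" if "j \<noteq> d" for j using lt[of j] that kd neg by simp
    qed (use kd xd in auto)
    fix t assume "- (x k * a k) / x d \<le> t"
    then have t: "- (x k * a k) \<le> x d * t" using xd by (simp add: divide_simps mult.commute)
    have "\<bar>x j * (a(d := t)) j\<bar> \<le> x d * t" for j
    proof (cases "j = d")
      case True
      then show ?thesis using t neg kd by simp
    next
      case False
      then show ?thesis using m[of j] kd neg t by simp
    qed
    then show "half x (a(d := t))" unfolding half_def by (intro exI[of _ d]) simp
  qed
qed

definition tmax :: "real \<Rightarrow> real \<Rightarrow> real" where
  "tmax u v = (if \<bar>u\<bar> < \<bar>v\<bar> then v else if \<bar>v\<bar> < \<bar>u\<bar> then u else max u v)"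

text \<open>Ties are resolved positively, which is harmless in the presence of the unit vectors.\<close>

definition eliminate :: "'i \<Rightarrow> ('i \<Rightarrow> real) \<Rightarrow> ('i \<Rightarrow> real) \<Rightarrow> 'i \<Rightarrow> real" where
  "eliminate d x y = (\<lambda>i. if i = d then 0 else tmax (x i / x d) (y i / - y d))"

text \<open>After scaling, the entries at \<open>d\<close> are 1 and -1. Ties elsewhere are raised
  to positive values by upward closure, so the cancellation at \<open>d\<close> is the only one and
  may be filled with 0.\<close>

lemma eliminate_in_cone:
  fixes x y :: "'i::finite \<Rightarrow> real"
  assumes C: "tc_cone C" and E: "\<And>j. unitv j \<in> C" and x: "x \<in> C" "0 < x d" and y: "y \<in> C" "y d < 0"
  shows "eliminate d x y \<in> C"
proof -
  define u where "u = (\<lambda>i. 1 / x d * x i)"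
  define v where "v = (\<lambda>i. 1 / - y d * y i)"
  have "u \<in> C" unfolding u_def by (rule tc_cone_scale[OF C x(1)]) (use x in simp)
  moreover have "v \<in> C" unfolding v_def by (rule tc_cone_scale[OF C y(1)]) (use y in simp)
  ultimately have uv: "u \<in> C" "v \<in> C" .
  have d: "u d = 1" "v d = - 1" using x y by (auto simp: u_def v_def)
  define p where "p = (\<lambda>i. if i \<noteq> d \<and> u i = - v i then \<bar>u i\<bar> else u i)"
  define q where "q = (\<lambda>i. if i \<noteq> d \<and> u i = - v i then \<bar>v i\<bar> else v i)"
  have p: "p \<in> C" by (rule tc_cone_upward_closed[OF C E uv(1)]) (auto simp: p_def)
  have q: "q \<in> C" by (rule tc_cone_upward_closed[OF C E uv(2)]) (auto simp: q_def)
  have "(lsum p q)(d := 0) \<in> C"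
  proof (rule tc_cone_fill[OF C p q])
    show "p i = 0" if "i \<noteq> d" "p i = - q i" for i
      using that by (auto simp: p_def q_def abs_if split: if_splits)
  qed (auto simp: p_def q_def d)
  moreover have "lsum p q i = tmax (u i) (v i)" if "i \<noteq> d" for i
  proof (cases "u i = - v i")
    case True
    then show ?thesis using that by (auto simp: lsum_def p_def q_def tmax_def)
  next
    case False
    then have "p i = u i" "q i = v i" by (auto simp: p_def q_def)
    then show ?thesis using False unfolding lsum_def tmax_def by (smt (verit))
  qed
  then have "(lsum p q)(d := 0) = eliminate d x y"
    by (auto simp: eliminate_def u_def v_def fun_eq_iff)
  ultimately show ?thesis by simp
qed

lemma tmax_zero_left [simp]: "tmax 0 v = v"
  by (auto simp: tmax_def)

lemma abs_tmax: "\<bar>tmax u v\<bar> = max \<bar>u\<bar> \<bar>v\<bar>"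
  by (auto simp: tmax_def)

lemma tmax_cases: "tmax u v = u \<or> tmax u v = v"
  by (auto simp: tmax_def)

text \<open>An entry 0 conforms to everything, so eliminated coordinates conform automatically;
  where \<open>w\<close> vanishes, the generators have to vanish too.\<close>

definition conform :: "real \<Rightarrow> real \<Rightarrow> bool" where
  "conform r s \<longleftrightarrow> 0 \<le> r * s \<and> (s = 0 \<longrightarrow> r = 0)"

text \<open>Rows positive at \<open>d\<close> bound the new entry from below, with \<open>m\<close>
  the largest bound, and the eliminated rows make the rows negative at \<open>d\<close> hold at
  \<open>m\<close>. The entry moves from \<open>a d\<close> towards \<open>m\<close> only in the
  direction that does not help \<open>w\<close>. If it must stay at \<open>a d\<close>, the rows
  that wanted it to move conform to \<open>w\<close> at \<open>d\<close> and hold by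
  \<open>M1\<close>.\<close>

lemma extend_eliminated_solution:
  fixes a w :: "'i::finite \<Rightarrow> real"
  assumes fin: "finite M" and e: "unitv d \<in> M" and a: "\<And>i. 0 \<le> a i"
    and M1: "\<And>x. x \<in> M \<Longrightarrow> conform (x d) (w d) \<Longrightarrow> half x a"
    and M2: "\<And>x y. x \<in> M \<Longrightarrow> y \<in> M \<Longrightarrow> 0 < x d \<Longrightarrow> y d < 0 \<Longrightarrow> half (eliminate d x y) a"
    and w: "\<not> half w a"
  shows "\<exists>b. (\<forall>i. 0 \<le> b i) \<and> (\<forall>x\<in>M. half x b) \<and> \<not> half w b"
proof -
  let ?P = "\<lambda>x b. 0 \<le> b \<and> (\<forall>t\<ge>b. half x (a(d := t))) \<and>
     (b = 0 \<or> (\<exists>k. k \<noteq> d \<and> x d * b = - (x k * a k) \<and> (\<forall>j. j \<noteq> d \<longrightarrow> x j * a j < - (x k * a k))))"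
  have "\<forall>x\<in>{x\<in>M. 0 < x d}. \<exists>b. ?P x b" using half_lower_bound[of _ d a] by (smt (verit) mem_Collect_eq)
  then obtain b where b: "\<forall>x\<in>{x\<in>M. 0 < x d}. ?P x (b x)" using bchoice[of "{x\<in>M. 0 < x d}" ?P] by blast
  define B where "B = insert 0 (b ` {x\<in>M. 0 < x d})"
  have finB: "finite B" "B \<noteq> {}" using fin by (auto simp: B_def)
  define m where "m = Max B"
  have m0: "0 \<le> m" unfolding m_def by (rule Max_ge) (use finB in \<open>auto simp: B_def\<close>)
  have mb: "b x \<le> m" if "x \<in> M" "0 < x d" for x
    unfolding m_def by (rule Max_ge) (use finB that in \<open>auto simp: B_def\<close>)
  have min: "m \<in> B" unfolding m_def by (rule Max_in[OF finB])
  have neg: "half y (a(d := m))" if y: "y \<in> M" "y d < 0" for y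
  proof (cases "m = 0")
    case True
    \<comment> \<open>The unit vector is the partner here: eliminating it against \<open>y\<close>
      just deletes the entry at \<open>d\<close>, up to scaling.\<close>
    let ?z = "eliminate d (unitv d) y"
    have z: "?z j = (if j = d then 0 else y j / - y d)" for j by (simp add: eliminate_def)
    obtain i where i: "\<bar>?z j * a j\<bar> \<le> ?z i * a i" for j
      using M2[OF e y(1) _ y(2)] unfolding half_def by auto
    have eq: "y j * (a(d := m)) j = - y d * (?z j * a j)" for j using y(2) True by (simp add: z)
    show ?thesis unfolding half_def
    proof (intro exI[of _ i] allI)
      fix j
      have "- y d * \<bar>?z j * a j\<bar> \<le> - y d * (?z i * a i)"
        by (rule mult_left_mono[OF i]) (use y(2) in simp)
      then show "\<bar>y j * (a(d := m)) j\<bar> \<le> y i * (a(d := m)) i"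
        unfolding eq abs_mult[of "- y d"] using y(2) by simp
    qed
  next
    case False
    then obtain x where x: "x \<in> M" "0 < x d" "m = b x" using min by (auto simp: B_def)
    then obtain k where k: "k \<noteq> d" "x d * m = - (x k * a k)" "\<And>j. j \<noteq> d \<Longrightarrow> x j * a j < - (x k * a k)"
      using b False by auto
    let ?z = "eliminate d x y"
    let ?p = "\<lambda>j. x j / x d * a j" and ?q = "\<lambda>j. y j / - y d * a j"
    obtain i where i: "\<bar>?z j * a j\<bar> \<le> ?z i * a i" for j
      using M2[OF x(1) y(1) x(2) y(2)] unfolding half_def by auto
    have za: "\<bar>?z j * a j\<bar> = max \<bar>?p j\<bar> \<bar>?q j\<bar>" if "j \<noteq> d" for j
      using that a[of j] by (simp add: eliminate_def abs_mult abs_tmax max_mult_distrib_right)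
    have mk: "\<bar>?p k\<bar> = m"
    proof -
      have "?p k = - m" using k(2) x(2) by (simp add: field_simps)
      then show ?thesis using m0 by simp
    qed
    have pm: "?p j < m" if "j \<noteq> d" for j using k(3)[OF that] k(2) x(2) by (simp add: field_simps)
    have ge: "m \<le> ?z i * a i" using i[of k] za[OF k(1)] mk by simp
    then have id: "i \<noteq> d" using m0 False by (auto simp: eliminate_def)
    \<comment> \<open>The maximum of the combined row is at least \<open>m\<close>, whereas every
      term of \<open>x\<close> off \<open>d\<close> is less than \<open>m\<close>; so it stems from
      \<open>y\<close>.\<close>
    then have zi: "?z i * a i = ?q i"
      using tmax_cases[of "x i / x d" "y i / - y d"] pm[OF id] ge by (auto simp: eliminate_def)
    have "\<bar>?q j\<bar> \<le> ?q i" if "j \<noteq> d" for j using i[of j] za[OF that] zi by simp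
    then have 1: "\<bar>y j * a j\<bar> \<le> y i * a i" if "j \<noteq> d" for j
      using y(2) that by (force simp: abs_mult divide_simps)
    have 2: "\<bar>y d * m\<bar> \<le> y i * a i" proof -
      have "y i * a i = - y d * ?q i" using y(2) by simp
      moreover have "- y d * m \<le> - y d * ?q i" by (rule mult_left_mono) (use ge zi y(2) in auto)
      moreover have "\<bar>y d * m\<bar> = - y d * m" using y(2) m0 by (simp add: abs_mult)
      ultimately show ?thesis by simp
    qed
    show ?thesis unfolding half_def using 1 2 id by (intro exI[of _ i]) auto
  qed
  define t where "t = (if 0 < w d then min (a d) m else if w d < 0 then max (a d) m else m)"
  have t0: "0 \<le> t" using a[of d] m0 by (auto simp: t_def)
  have "half x (a(d := t))" if x: "x \<in> M" for x
  proof (cases "x d" "0 :: real" rule: linorder_cases)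
    case less
    show ?thesis
    proof (cases "w d < 0 \<and> m \<le> a d")
      case True
      then have "t = a d" "conform (x d) (w d)" using less by (auto simp: t_def conform_def mult_nonpos_nonpos)
      then show ?thesis using M1[OF x] by simp
    next
      case False
      then have "t \<le> m" by (auto simp: t_def)
      then show ?thesis using half_antimono_coordinate[OF neg[OF x less] t0] less by simp
    qed
  next
    case equal
    then have "half x a" using M1[OF x] by (simp add: conform_def)
    moreover have "half x (a(d := t)) \<longleftrightarrow> half x a" by (rule half_cong) (use equal in simp)
    ultimately show ?thesis by simp
  next
    case greater
    show ?thesis
    proof (cases "0 < w d \<and> a d \<le> m")
      case True
      then have "t = a d" "conform (x d) (w d)" using greater by (auto simp: t_def conform_def)
      then show ?thesis using M1[OF x] by simp
    next
      case False
      then have "m \<le> t" by (auto simp: t_def)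
      then show ?thesis using b mb[OF x greater] x greater by auto
    qed
  qed
  moreover have "\<not> half w (a(d := t))"
  proof
    assume h: "half w (a(d := t))"
    have "half w (a(d := a d))"
    proof (cases "w d" "0 :: real" rule: linorder_cases)
      case less
      then show ?thesis using half_antimono_coordinate[OF h a[of d]] by (simp add: t_def)
    next
      case equal
      have "half w (a(d := t)) \<longleftrightarrow> half w a" by (rule half_cong) (use equal in simp)
      then show ?thesis using h by simp
    next
      case greater
      then show ?thesis using half_mono_coordinate[OF h t0, of "a d"] greater by (simp add: t_def)
    qed
    then show False using w by simp
  qed
  ultimately show ?thesis using a t0 by (intro exI[of _ "a(d := t)"]) auto
qed

text \<open>If each negative entry of \<open>w\<close> were reached by a multiple of a generator
  lying below the positive part of \<open>w\<close> elsewhere, the sum of these would put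
  \<open>w\<close> into \<open>C\<close>. So this fails for some entry \<open>i\<close>. Relative to
  \<open>w\<close>, the dual vector gives weight 1 to \<open>i\<close> and weight
  \<open>t < 1\<close> to the positive entries: for \<open>w\<close> the negative term wins, while
  every generator negative at \<open>i\<close> has a proportionally larger positive entry.\<close>

lemma conform_solution:
  fixes w :: "'i::finite \<Rightarrow> real"
  assumes C: "tc_cone C" and E: "\<And>j. unitv j \<in> C" and w: "w \<notin> C"
    and fin: "finite M" and M: "M \<subseteq> C" and conf: "\<And>x k. x \<in> M \<Longrightarrow> conform (x k) (w k)"
  shows "\<exists>a. (\<forall>i. 0 \<le> a i) \<and> (\<forall>x\<in>M. half x a) \<and> \<not> half w a"
proof -
  have "\<exists>i. w i < 0 \<and> (\<forall>x\<in>M. x i < 0 \<longrightarrow> (\<exists>k. 0 < w k \<and> w k * - x i < x k * - w i))"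
  proof (rule ccontr)
    assume "\<not> ?thesis"
    then have H: "\<exists>x\<in>M. x i < 0 \<and> (\<forall>k. 0 < w k \<longrightarrow> x k * - w i \<le> w k * - x i)" if "w i < 0" for i
      using that by (metis not_le)
    have part: "(\<lambda>k. if k = i then w i else max (w k) 0) \<in> C" if i: "w i < 0" for i
    proof -
      obtain x where x: "x \<in> M" "x i < 0" "\<And>k. 0 < w k \<Longrightarrow> x k * - w i \<le> w k * - x i"
        using H[OF i] by blast
      have pos: "0 \<le> w i / x i" using i x(2) by (simp add: divide_simps)
      show ?thesis
      proof (rule tc_cone_upward_closed[OF C E])
        show "(\<lambda>k. w i / x i * x k) \<in> C" by (rule tc_cone_scale[OF C _ pos]) (use x M in auto)
        show "w i / x i * x k \<le> (if k = i then w i else max (w k) 0)" for k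
        proof (cases "0 < w k")
          case True
          then show ?thesis using x(3)[OF True] x(2) i
            by (auto simp: divide_simps mult.commute max_def)
        next
          case False
          then have "x k \<le> 0" using conf[OF x(1), of k]
            by (cases "w k = 0") (auto simp: conform_def zero_le_mult_iff)
          then have "w i / x i * x k \<le> 0" by (rule mult_nonneg_nonpos[OF pos])
          then show ?thesis using x(2) by auto
        qed
      qed
    qed
    have "(\<lambda>k. if w k < 0 \<and> k \<notin> S then 0 else w k) \<in> C" if "finite S" for S
      using that
    proof induction
      case empty
      show ?case by (rule tc_cone_upward_closed[OF C E tc_cone_zero[OF C]]) auto
    next
      case (insert i S)
      show ?case
      proof (cases "w i < 0")
        case True
        have "(\<lambda>k. if w k < 0 \<and> k \<notin> insert i S then 0 else w k) =
            lsum (\<lambda>k. if w k < 0 \<and> k \<notin> S then 0 else w k) (\<lambda>k. if k = i then w i else max (w k) 0)"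
          using True insert.hyps by (auto simp: lsum_def fun_eq_iff)
        then show ?thesis using tc_cone_lsum[OF C insert.IH part[OF True]] by simp
      next
        case False
        then have "(\<lambda>k. if w k < 0 \<and> k \<notin> insert i S then 0 else w k) =
            (\<lambda>k. if w k < 0 \<and> k \<notin> S then 0 else w k)" by auto
        then show ?thesis using insert.IH by simp
      qed
    qed
    from this[of UNIV] show False using w by simp
  qed
  then obtain i where i: "w i < 0"
    and ex: "\<forall>x\<in>{x\<in>M. x i < 0}. \<exists>k. 0 < w k \<and> w k * - x i < x k * - w i" by blast
  obtain k where k: "\<And>x. x \<in> M \<Longrightarrow> x i < 0 \<Longrightarrow> 0 < w (k x) \<and> w (k x) * - x i < x (k x) * - w i"
    using bchoice[OF ex] by blast
  \<comment> \<open>The quotients are the least weights with which the chosen positive entries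
    outweigh the entry at \<open>i\<close>; \<open>1 / 2\<close> makes \<open>t\<close> positive
    even if there are none.\<close>
  define D where "D = insert (1 / 2) ((\<lambda>x. (w (k x) * - x i) / (x (k x) * - w i)) ` {x\<in>M. x i < 0})"
  have finD: "finite D" "D \<noteq> {}" using fin by (auto simp: D_def)
  define t where "t = Max D"
  have D1: "r < 1" if "r \<in> D" for r
  proof -
    have "(w (k x) * - x i) / (x (k x) * - w i) < 1" if x: "x \<in> M" "x i < 0" for x
    proof -
      have "0 < w (k x) * - x i" using k[OF x] x by (simp add: mult_pos_neg)
      then have "0 < x (k x) * - w i" using k[OF x] by linarith
      then show ?thesis using k[OF x] by (simp only: divide_less_eq_1) blast
    qed
    then show ?thesis using that by (auto simp: D_def)
  qed
  have t1: "t < 1" unfolding t_def using D1 finD by simp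
  have tD: "r \<le> t" if "r \<in> D" for r unfolding t_def by (rule Max_ge[OF finD(1) that])
  have t0: "0 < t" using tD[of "1 / 2"] by (simp add: D_def)
  define a where "a = (\<lambda>j. if j = i then 1 / - w i else if 0 < w j then t / w j else 0)"
  have a0: "0 \<le> a j" for j using i t0 by (auto simp: a_def)
  have "half x a" if x: "x \<in> M" for x
    unfolding half_iff_neg
  proof (intro allI impI)
    fix j assume neg: "x j * a j < 0"
    then have xj: "x j < 0" using a0[of j] by (simp add: mult_less_0_iff)
    have "j = i"
    proof (rule ccontr)
      assume "j \<noteq> i"
      then have "0 < w j" using neg by (auto simp: a_def split: if_splits)
      then show False using conf[OF x, of j] xj by (auto simp: conform_def zero_le_mult_iff)
    qed
    then have xi: "x i < 0" using xj by simp
    have kx: "0 < w (k x)" "w (k x) * - x i < x (k x) * - w i" using k[OF x xi] by auto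
    have "0 < w (k x) * - x i" using kx xi by (simp add: mult_pos_neg)
    then have p: "0 < x (k x) * - w i" using kx by linarith
    have "(w (k x) * - x i) / (x (k x) * - w i) \<le> t" by (rule tD) (use x xi in \<open>auto simp: D_def\<close>)
    then have "w (k x) * - x i \<le> t * (x (k x) * - w i)" using p by (simp only: divide_le_eq)
    moreover have "k x \<noteq> i" using kx i by auto
    ultimately have "- (x i * a i) \<le> x (k x) * a (k x)"
      using kx(1) i by (simp add: a_def field_simps)
    then show "\<exists>l. - (x j * a j) \<le> x l * a l" using \<open>j = i\<close> by blast
  qed
  moreover have "\<not> half w a"
  proof
    assume "half w a"
    moreover have "w i * a i < 0" using i by (simp add: a_def)
    ultimately obtain j where "- (w i * a i) \<le> w j * a j" unfolding half_iff_neg by blast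
    then show False using i t1 by (auto simp: a_def split: if_splits)
  qed
  ultimately show ?thesis using a0 by blast
qed

text \<open>
  The induction on \<open>J\<close> is tropical Fourier--Motzkin elimination: outside \<open>J\<close> the generators already
  agree in sign with \<open>w\<close>.
\<close>

lemma separation_of_upward_closed:
  fixes w :: "'i::finite \<Rightarrow> real"
  assumes C: "tc_cone C" and E: "\<And>j. unitv j \<in> C" and w: "w \<notin> C"
    and J: "finite J" and M: "finite M" "M \<subseteq> C" "\<And>k. k \<in> J \<Longrightarrow> unitv k \<in> M"
    and conf: "\<And>x k. x \<in> M \<Longrightarrow> k \<notin> J \<Longrightarrow> conform (x k) (w k)"
  shows "\<exists>a. (\<forall>i. 0 \<le> a i) \<and> (\<forall>x\<in>M. half x a) \<and> \<not> half w a"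
  using J M conf
proof (induction J arbitrary: M rule: finite_induct)
  case empty
  show ?case by (rule conform_solution[OF C E w empty.prems(1,2)]) (use empty.prems(4) in simp)
next
  case (insert d J)
  \<comment> \<open>In contrast to ordinary elimination, rows conforming to \<open>w\<close> at
    \<open>d\<close> are kept with their entry there; they also take part in the pairs.\<close>
  define N where "N = {x\<in>M. conform (x d) (w d)} \<union>
    (\<lambda>(x, y). eliminate d x y) ` {(x, y) \<in> M \<times> M. 0 < x d \<and> y d < 0}"
  have "\<exists>a. (\<forall>i. 0 \<le> a i) \<and> (\<forall>x\<in>N. half x a) \<and> \<not> half w a"
  proof (rule insert.IH)
    have "finite {(x, y) \<in> M \<times> M. 0 < x d \<and> y d < 0}"
      by (rule finite_subset[of _ "M \<times> M"]) (use insert.prems(1) in auto)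
    then show "finite N" using insert.prems(1) by (simp add: N_def)
    show "N \<subseteq> C" using insert.prems(2) by (auto simp: N_def intro!: eliminate_in_cone[OF C E])
    show "unitv k \<in> N" if "k \<in> J" for k
      using that insert.prems(3)[of k] insert.hyps by (auto simp: N_def conform_def unitv_def)
    show "conform (x k) (w k)" if x: "x \<in> N" and k: "k \<notin> J" for x k
    proof (cases "k = d")
      case True
      then show ?thesis using x by (auto simp: N_def conform_def eliminate_def)
    next
      case False
      have scale: "conform (r / s) (w k)" if "conform r (w k)" "0 < s" for r s
        using that by (auto simp: conform_def)
      have c: "conform (x k) (w k)" if "x \<in> M" for x
        using insert.prems(4)[OF that, of k] k False by blast
      have "conform (eliminate d y z k) (w k)" if "y \<in> M" "z \<in> M" "0 < y d" "z d < 0" for y z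
      proof -
        have "conform (y k / y d) (w k)" by (rule scale[OF c[OF that(1)] that(3)])
        moreover have "conform (z k / - z d) (w k)" by (rule scale[OF c[OF that(2)]]) (use that(4) in simp)
        ultimately have "conform (y k / y d) (w k)" "conform (z k / - z d) (w k)" .
        then show ?thesis using tmax_cases[of "y k / y d" "z k / - z d"] False
          by (auto simp: eliminate_def)
      qed
      then show ?thesis using x c by (auto simp: N_def)
    qed
  qed
  then obtain a where a: "\<And>i. 0 \<le> a i" "\<And>x. x \<in> N \<Longrightarrow> half x a" "\<not> half w a" by blast
  show ?case
    by (rule extend_eliminated_solution[OF insert.prems(1) _ a(1) _ _ a(3)])
      (use insert.prems(3) a(2) in \<open>auto simp: N_def\<close>)
qed

subsection \<open>Separation and finite generation\<close>

definition sign_vectors :: "('i \<Rightarrow> real) set" where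
  "sign_vectors = {s. \<forall>i. s i = 1 \<or> s i = - 1}"

lemma sign_vectors_cases: "s \<in> sign_vectors \<Longrightarrow> s i = 1 \<or> s i = - 1"
  by (simp add: sign_vectors_def)

lemma sign_vectors_square: "s \<in> sign_vectors \<Longrightarrow> s i * (s i * r) = r"
  using sign_vectors_cases[of s i] by auto

lemma finite_sign_vectors: "finite (sign_vectors :: ('i::finite \<Rightarrow> real) set)"
proof -
  have "sign_vectors \<subseteq> (UNIV :: 'i set) \<rightarrow>\<^sub>E {1, - 1 :: real}"
    by (auto simp: sign_vectors_def PiE_def extensional_def)
  then show ?thesis by (rule finite_subset) (auto intro: finite_PiE)
qed

text \<open>Iterates \<open>unitv_resolution\<close>: a coordinate leaves \<open>J\<close> by
  resolving its two signs against each other.\<close>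

lemma sign_case_distinction:
  assumes "finite J" and "\<And>s. s \<in> sign_vectors \<Longrightarrow> w \<in> tc_cone hull (M \<union> (\<lambda>j i. s j * unitv j i) ` J)"
  shows "w \<in> tc_cone hull M"
  using assms
proof (induction J rule: finite_induct)
  case empty
  have "(\<lambda>_. 1) \<in> sign_vectors" by (simp add: sign_vectors_def)
  then show ?case using empty by fastforce
next
  case (insert j J)
  show ?case
  proof (rule insert.IH)
    fix s :: "'a \<Rightarrow> real" assume s: "s \<in> sign_vectors"
    let ?N = "M \<union> (\<lambda>j i. s j * unitv j i) ` J"
    have *: "w \<in> tc_cone hull (insert (\<lambda>i. e * unitv j i) (tc_cone hull ?N))" if e: "e = 1 \<or> e = - 1" for e :: real
    proof -
      have "s(j := e) \<in> sign_vectors" using s e by (auto simp: sign_vectors_def)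
      then have "w \<in> tc_cone hull (M \<union> (\<lambda>k i. (s(j := e)) k * unitv k i) ` insert j J)"
        by (rule insert.prems)
      also have "(\<lambda>k i. (s(j := e)) k * unitv k i) ` insert j J =
          insert (\<lambda>i. e * unitv j i) ((\<lambda>k i. s k * unitv k i) ` J)"
        using insert.hyps by (auto intro!: image_cong)
      also have "tc_cone hull (M \<union> \<dots>) \<subseteq> tc_cone hull (insert (\<lambda>i. e * unitv j i) (tc_cone hull ?N))"
        by (rule hull_mono) (use hull_subset[of ?N tc_cone] in blast)
      finally show ?thesis .
    qed
    show "w \<in> tc_cone hull ?N"
      by (rule unitv_resolution[OF tc_cone_hull, of w j]) (use *[of 1] *[of "- 1"] in simp_all)
  qed
qed

text \<open>For each choice of signs, a reflection turns the adjoined vectors into the unit vectors,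
  and the upward closed case applies. Its dual vector, reflected back, would be valid on
  \<open>M\<close> and violated by \<open>w\<close>.\<close>

theorem tc_cone_separation:
  fixes w :: "'i::finite \<Rightarrow> real"
  assumes fin: "finite M" and w: "\<And>a. (\<And>x. x \<in> M \<Longrightarrow> half x a) \<Longrightarrow> half w a"
  shows "w \<in> tc_cone hull M"
proof (rule sign_case_distinction[of UNIV])
  fix s :: "'i \<Rightarrow> real" assume s: "s \<in> sign_vectors"
  let ?E = "(\<lambda>j i. s j * unitv j i) ` UNIV"
  let ?r = "\<lambda>x i. s i * x i"
  define C where "C = {x. ?r x \<in> tc_cone hull (M \<union> ?E)}"
  have s0: "s i \<noteq> 0" for i using sign_vectors_cases[OF s, of i] by auto
  have C: "tc_cone C" unfolding C_def by (rule tc_cone_reflect[OF tc_cone_hull s0])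
  have gen: "?r x \<in> C" if "x \<in> M \<union> ?E" for x
    using that hull_inc[of x "M \<union> ?E" tc_cone] by (simp add: C_def sign_vectors_square[OF s])
  have e: "unitv j = ?r (\<lambda>i. s j * unitv j i)" for j
    using sign_vectors_square[OF s, of j 1] by (auto simp: fun_eq_iff unitv_def)
  have "?r w \<in> C"
  proof (rule ccontr)
    assume n: "?r w \<notin> C"
    have "\<exists>a. (\<forall>i. 0 \<le> a i) \<and> (\<forall>x\<in>?r ` (M \<union> ?E). half x a) \<and> \<not> half (?r w) a"
    proof (rule separation_of_upward_closed[OF C _ n, where J = UNIV])
      show "unitv j \<in> C" for j
      proof -
        have "?r (\<lambda>i. s j * unitv j i) \<in> C" by (rule gen) blast
        then show ?thesis by (simp only: e[symmetric])
      qed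
      show "unitv k \<in> ?r ` (M \<union> ?E)" for k
      proof -
        have "?r (\<lambda>i. s k * unitv k i) \<in> ?r ` (M \<union> ?E)" by (rule imageI) blast
        then show ?thesis by (simp only: e[symmetric])
      qed
    qed (use fin gen in auto)
    then show False using w by (auto simp: half_reflect)
  qed
  then show "w \<in> tc_cone hull (M \<union> ?E)" by (simp add: C_def sign_vectors_square[OF s])
qed simp

section \<open>Tropical double description\<close>

definition max_abs_term :: "('i::finite \<Rightarrow> real) \<Rightarrow> ('i \<Rightarrow> real) \<Rightarrow> real" where
  "max_abs_term b g = Max (range (\<lambda>j. \<bar>b j * g j\<bar>))"

lemma max_abs_term_ge: "\<bar>b j * g j\<bar> \<le> max_abs_term b g"
  unfolding max_abs_term_def by (rule Max_ge) auto

lemma max_abs_term_attained: "\<exists>k. max_abs_term b g = \<bar>b k * g k\<bar>"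
proof -
  have "Max (range (\<lambda>j. \<bar>b j * g j\<bar>)) \<in> range (\<lambda>j. \<bar>b j * g j\<bar>)" by (rule Max_in) auto
  then show ?thesis unfolding max_abs_term_def by (rule rangeE) blast
qed

lemma half_iff_max_abs_term: "half b g \<longleftrightarrow> (\<exists>k. max_abs_term b g \<le> b k * g k)"
  unfolding half_def using max_abs_term_ge max_abs_term_attained by (metis order_trans)

text \<open>
  Tropical double description.  The scalar \<open>l\<close> may depend on the coordinate \<open>i\<close>: the
  generators needed for different coordinates are composed afterwards.
\<close>

lemma nonneg_generators:
  fixes A :: "('i::finite \<Rightarrow> real) set"
  assumes "finite A"
  shows "\<exists>G. finite G \<and> (\<forall>g\<in>G. (\<forall>i. 0 \<le> g i) \<and> (\<forall>a\<in>A. half a g)) \<and>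
    (\<forall>x. (\<forall>i. 0 \<le> x i) \<longrightarrow> (\<forall>a\<in>A. half a x) \<longrightarrow>
      (\<forall>i. 0 < x i \<longrightarrow> (\<exists>g\<in>G. \<exists>l\<ge>0. (\<forall>k. l * g k \<le> x k) \<and> l * g i = x i)))"
  using assms
proof induction
  case empty
  have "\<exists>g\<in>range unitv. \<exists>l\<ge>0. (\<forall>k. l * g k \<le> x k) \<and> l * g i = x i"
    if "\<forall>i. 0 \<le> x i" for x :: "'i \<Rightarrow> real" and i
    using that by (intro bexI[of _ "unitv i"] exI[of _ "x i"]) (auto simp: unitv_def)
  then show ?case by (intro exI[of _ "range unitv"]) (auto simp: unitv_def)
next
  case (insert b A)
  from insert.IH
  obtain G where fin: "finite G" and nnA: "\<forall>g\<in>G. (\<forall>i. 0 \<le> g i) \<and> (\<forall>a\<in>A. half a g)"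
    and genA: "\<forall>x. (\<forall>i. 0 \<le> x i) \<longrightarrow> (\<forall>a\<in>A. half a x) \<longrightarrow>
      (\<forall>i. 0 < x i \<longrightarrow> (\<exists>g\<in>G. \<exists>l\<ge>0. (\<forall>k. l * g k \<le> x k) \<and> l * g i = x i))"
    by (elim exE conjE) (rule that)
  have nn: "0 \<le> g i" if "g \<in> G" for g i using nnA that by blast
  have hA: "half a g" if "g \<in> G" "a \<in> A" for g a using nnA that by blast
  have gen: "\<exists>g\<in>G. \<exists>l\<ge>0. (\<forall>k. l * g k \<le> x k) \<and> l * g i = x i"
    if "\<And>i. 0 \<le> x i" "\<And>a. a \<in> A \<Longrightarrow> half a x" "0 < x i" for x i
    by (rule genA[rule_format]) (use that in blast)+
  \<comment> \<open>The factors equalize the maximal absolute terms of \<open>g\<close> and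
    \<open>h\<close> with respect to \<open>b\<close>, so that the positive maximum of
    \<open>g\<close> makes up for the violation by \<open>h\<close>.\<close>
  define comb where
    "comb = (\<lambda>(g, h) i. max (max_abs_term b h * g i) (max_abs_term b g * (h i :: real)))"
  define H where "H = {g \<in> G. half b g} \<union> comb ` (G \<times> G \<inter> {(g, h). half b g \<and> \<not> half b h})"
  have m0: "0 \<le> max_abs_term b g" for g using max_abs_term_ge[of b _ g] by (meson abs_ge_zero order_trans)
  have combA: "half a (comb (g, h))" if "g \<in> G" "h \<in> G" "a \<in> A" for a g h
  proof -
    have "comb (g, h) = lsum (\<lambda>i. max_abs_term b h * g i) (\<lambda>i. max_abs_term b g * h i)"
      using m0 nn that by (auto simp: comb_def lsum_def fun_eq_iff abs_mult)
    then show ?thesis using tc_cone_lsum[OF half_tc_cone] tc_cone_scale[OF half_tc_cone] hA m0 that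
      by (metis mem_Collect_eq)
  qed
  have combb: "half b (comb (g, h))" if gh: "half b g" "\<not> half b h" "g \<in> G" "h \<in> G" for g h
  proof -
    obtain m where m: "max_abs_term b g \<le> b m * g m" using gh half_iff_max_abs_term by blast
    have bm: "0 \<le> b m \<or> (max_abs_term b g = 0 \<and> g m = 0)" using m m0[of g] nn[OF gh(3), of m]
      by (smt (verit) mult_neg_pos mult_eq_0_iff)
    have "\<bar>b j * comb (g, h) j\<bar> \<le> b m * comb (g, h) m" for j
    proof -
      have "comb (g, h) j = max_abs_term b h * g j \<or> comb (g, h) j = max_abs_term b g * h j"
        by (auto simp: comb_def max_def)
      moreover have "\<bar>b j * (max_abs_term b h * g j)\<bar> \<le> max_abs_term b g * max_abs_term b h"
        using mult_right_mono[OF max_abs_term_ge[of b j g] m0[of h]] m0[of h] by (simp add: abs_mult ac_simps)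
      moreover have "\<bar>b j * (max_abs_term b g * h j)\<bar> \<le> max_abs_term b g * max_abs_term b h"
        using mult_left_mono[OF max_abs_term_ge[of b j h] m0[of g]] m0[of g] by (simp add: abs_mult ac_simps)
      ultimately have "\<bar>b j * comb (g, h) j\<bar> \<le> max_abs_term b g * max_abs_term b h" by auto
      also have "\<dots> \<le> b m * comb (g, h) m"
      proof (cases "max_abs_term b g = 0 \<and> g m = 0")
        case True
        then show ?thesis by (simp add: comb_def)
      next
        case False
        have "max_abs_term b g * max_abs_term b h \<le> (b m * g m) * max_abs_term b h"
          by (rule mult_right_mono[OF m m0])
        also have "\<dots> = b m * (max_abs_term b h * g m)" by simp
        also have "\<dots> \<le> b m * comb (g, h) m" using bm False by (auto simp: comb_def intro: mult_left_mono)
        finally show ?thesis .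
      qed
      finally show ?thesis .
    qed
    then show ?thesis unfolding half_def by blast
  qed
  have "\<exists>g\<in>H. \<exists>l\<ge>0. (\<forall>k. l * g k \<le> x k) \<and> l * g i = x i"
    if x: "\<And>i. 0 \<le> x i" "\<And>a. a \<in> insert b A \<Longrightarrow> half a x" "0 < x i" for x i
  proof -
    obtain h l where h: "h \<in> G" "0 \<le> l" "\<And>k. l * h k \<le> x k" "l * h i = x i"
      using gen[of x i] x by auto
    show ?thesis
    proof (cases "half b h")
      case True
      then show ?thesis using h by (auto simp: H_def)
    next
      case nh: False
      have lp: "0 < l" using h(2,4) x(3) by (cases "l = 0") auto
      obtain k where k: "max_abs_term b h = \<bar>b k * h k\<bar>" using max_abs_term_attained by blast
      have mh: "0 < max_abs_term b h"
        using nh m0[of h] by (metis half_iff_max_abs_term k order_le_less abs_eq_0 order_refl)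
      obtain m where m: "\<And>j. \<bar>b j * x j\<bar> \<le> b m * x m" using x(2)[of b] unfolding half_def by auto
      have "l * max_abs_term b h \<le> \<bar>b k\<bar> * x k"
        using mult_left_mono[OF h(3)[of k] abs_ge_zero[of "b k"]] nn[OF h(1), of k] k
        by (simp add: abs_mult ac_simps)
      also have "\<dots> \<le> b m * x m" using m[of k] x(1)[of k] by (simp add: abs_mult)
      finally have lm: "l * max_abs_term b h \<le> b m * x m" .
      then have "0 < b m * x m" using mult_pos_pos[OF lp mh] by linarith
      then have bx: "0 < x m" "0 < b m" using x(1)[of m] by (auto simp: zero_less_mult_iff)
      \<comment> \<open>Since \<open>x\<close> satisfies the new inequality, it has a positive
        dominating term \<open>m\<close>. The generator reaching \<open>x m\<close> inherits this
        term as its own maximum, hence is a partner for \<open>h\<close>.\<close>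
      obtain g u where g: "g \<in> G" "0 \<le> u" "\<And>k. u * g k \<le> x k" "u * g m = x m"
        using gen[of x m] x bx(1) by auto
      have up: "0 < u" using g(2,4) bx(1) by (cases "u = 0") auto
      have le: "\<bar>b j * g j\<bar> \<le> b m * g m" for j
      proof -
        have "u * \<bar>b j * g j\<bar> = \<bar>b j\<bar> * (u * g j)" using nn[OF g(1)] by (simp add: abs_mult)
        also have "\<dots> \<le> \<bar>b j\<bar> * x j" by (rule mult_left_mono[OF g(3)]) simp
        also have "\<dots> \<le> b m * x m" using m[of j] x(1)[of j] by (simp add: abs_mult)
        also have "\<dots> = u * (b m * g m)" using g(4) by (simp add: ac_simps)
        finally show ?thesis using up by simp
      qed
      have hg: "half b g" using le unfolding half_def by blast
      have mg: "max_abs_term b g = b m * g m"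
        using max_abs_term_attained[of b g] le max_abs_term_ge[of b m g] by (metis abs_ge_self antisym order_trans)
      have gm: "0 < g m" using g(4) bx(1) up by (metis zero_less_mult_pos)
      then have mgp: "0 < max_abs_term b g" using mg bx by simp
      \<comment> \<open>The factor turns the part of the combination that comes from
        \<open>h\<close> into exactly \<open>l * h\<close>.\<close>
      let ?c = "comb (g, h)" and ?v = "l / max_abs_term b g"
      have v: "0 \<le> ?v" using h(2) mgp by simp
      have c: "?v * ?c j = max (?v * max_abs_term b h * g j) (l * h j)" for j
        using v mgp by (simp add: comb_def max_mult_distrib_left mult.assoc)
      have vu: "?v * max_abs_term b h \<le> u"
      proof -
        have "u * max_abs_term b g = b m * x m" unfolding mg g(4)[symmetric] by (rule mult.left_commute)
        then have "l * max_abs_term b h \<le> u * max_abs_term b g" using lm by simp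
        then show ?thesis using mgp by (simp add: divide_simps)
      qed
      have "?v * max_abs_term b h * g j \<le> x j" for j
        using mult_right_mono[OF vu nn[OF g(1), of j]] g(3)[of j] by linarith
      then have "\<forall>j. ?v * ?c j \<le> x j" "?v * ?c i = x i" using c h(3,4) by (auto simp: max_def)
      moreover have "?c \<in> H" using g(1) h(1) hg nh by (auto simp: H_def)
      ultimately show ?thesis using v by blast
    qed
  qed
  moreover have "finite H" using fin by (simp add: H_def)
  moreover have "\<forall>g\<in>H. (\<forall>i. 0 \<le> g i) \<and> (\<forall>a\<in>insert b A. half a g)"
    using nn hA combA combb m0 by (auto simp: H_def comb_def le_max_iff_disj)
  ultimately show ?case by (intro exI[of _ H]) blast
qed

text \<open>Each orthant is reflected to the nonnegative one. Within an orthant the left sum is the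
  maximum of absolute values, so vectors lying below \<open>x\<close> and reaching it in one
  coordinate each compose to \<open>x\<close>.\<close>

theorem halfspace_intersection_finitely_generated:
  fixes A :: "('i::finite \<Rightarrow> real) set"
  assumes "finite A"
  shows "\<exists>G. finite G \<and> {x. \<forall>a\<in>A. half a x} = tc_cone hull G"
proof -
  let ?r = "\<lambda>s x i. s i * x i :: real"
  have "\<exists>G. finite G \<and> (\<forall>g\<in>G. \<forall>a\<in>A. half a g) \<and>
      (\<forall>x. (\<forall>i. 0 \<le> s i * x i) \<longrightarrow> (\<forall>a\<in>A. half a x) \<longrightarrow> x \<in> tc_cone hull G)" if s: "s \<in> sign_vectors" for s
  proof -
    obtain G where fin: "finite G" and nn: "\<And>g i. g \<in> G \<Longrightarrow> 0 \<le> g i"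
      and hA: "\<And>g a. g \<in> G \<Longrightarrow> a \<in> A \<Longrightarrow> half (?r s a) g"
      and gen: "\<And>x i. (\<And>i. 0 \<le> x i) \<Longrightarrow> (\<And>a. a \<in> A \<Longrightarrow> half (?r s a) x) \<Longrightarrow> 0 < x i \<Longrightarrow>
        \<exists>g\<in>G. \<exists>l\<ge>0. (\<forall>k. l * g k \<le> x k) \<and> l * g i = x i"
      using nonneg_generators[of "?r s ` A"] assms by (auto simp: ball_simps)
    let ?G = "?r s ` G"
    have "x \<in> tc_cone hull ?G" if x: "\<And>i. 0 \<le> s i * x i" "\<And>a. a \<in> A \<Longrightarrow> half a x" for x
    proof -
      have s2: "s i * (s i * t) = t" for i t by (rule sign_vectors_square[OF s])
      have abs: "\<bar>s i\<bar> = 1" for i using sign_vectors_cases[OF s, of i] by auto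
      have "\<exists>y\<in>tc_cone hull ?G. (\<forall>i. 0 \<le> s i * y i \<and> s i * y i \<le> s i * x i) \<and> (\<forall>i\<in>S. y i = x i)" if "finite S" for S
        using that
      proof induction
        case empty
        show ?case using tc_cone_zero[OF tc_cone_hull] x(1) by (intro bexI[of _ "\<lambda>_. 0"]) auto
      next
        case (insert j S)
        then obtain y where y: "y \<in> tc_cone hull ?G" "\<And>i. 0 \<le> s i * y i" "\<And>i. s i * y i \<le> s i * x i"
          "\<And>i. i \<in> S \<Longrightarrow> y i = x i" by blast
        have "\<exists>g\<in>tc_cone hull ?G. (\<forall>i. 0 \<le> s i * g i) \<and> (\<forall>i. s i * g i \<le> s i * x i) \<and> s j * g j = s j * x j"
        proof (cases "s j * x j = 0")
          case True
          then show ?thesis using tc_cone_zero[OF tc_cone_hull] x(1) by (intro bexI[of _ "\<lambda>_. 0"]) auto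
        next
          case False
          then have "0 < s j * x j" using x(1)[of j] by linarith
          then obtain g l where g: "g \<in> G" "0 \<le> l" "\<And>k. l * g k \<le> s k * x k" "l * g j = s j * x j"
            using gen[of "?r s x" j] x by (auto simp: half_reflect s2)
          have "(\<lambda>i. l * ?r s g i) \<in> tc_cone hull ?G"
            by (rule tc_cone_scale[OF tc_cone_hull _ g(2)]) (use g(1) in \<open>auto intro: hull_inc\<close>)
          moreover have eq: "s i * (l * ?r s g i) = l * g i" for i using s2[of i "l * g i"] by (simp add: ac_simps)
          have "0 \<le> s i * (l * ?r s g i)" "s i * (l * ?r s g i) \<le> s i * x i" "s j * (l * ?r s g j) = s j * x j" for i
            unfolding eq using g nn[OF g(1)] by auto
          ultimately show ?thesis by (intro bexI[of _ "\<lambda>i. l * ?r s g i"] conjI allI)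
        qed
        then obtain g where g: "g \<in> tc_cone hull ?G" "\<And>i. 0 \<le> s i * g i" "\<And>i. s i * g i \<le> s i * x i"
          "s j * g j = s j * x j" by blast
        have pos: "\<bar>t\<bar> = s i * t" if "0 \<le> s i * t" for t i
          using that abs[of i] by (metis abs_mult abs_of_nonneg mult_1)
        have ls: "s i * lsum y g i = max (s i * y i) (s i * g i)" for i
          using pos[OF y(2)[of i]] pos[OF g(2)[of i]] by (auto simp: lsum_def)
        have inj: "u = v" if "s i * u = s i * v" for i u v using that s2 by metis
        have "lsum y g i = x i" if "i \<in> insert j S" for i
        proof (rule inj)
          show "s i * lsum y g i = s i * x i"
            using that y(3)[of i] y(4)[of i] g(3)[of i] g(4) unfolding ls by (auto simp: max_def)
        qed
        moreover have "0 \<le> s i * lsum y g i \<and> s i * lsum y g i \<le> s i * x i" for i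
          unfolding ls using y(2,3)[of i] g(3)[of i] by (auto simp: le_max_iff_disj)
        ultimately show ?case using tc_cone_lsum[OF tc_cone_hull y(1) g(1)] by blast
      qed
      from this[of UNIV] show ?thesis by (metis UNIV_I ext finite_class.finite_UNIV)
    qed
    moreover have "\<forall>g\<in>?G. \<forall>a\<in>A. half a g" using hA by (auto simp: half_reflect)
    ultimately show ?thesis using fin by (intro exI[of _ ?G]) auto
  qed
  then obtain G where G: "\<And>s. s \<in> sign_vectors \<Longrightarrow> finite (G s)"
    "\<And>s g a. s \<in> sign_vectors \<Longrightarrow> g \<in> G s \<Longrightarrow> a \<in> A \<Longrightarrow> half a g"
    "\<And>s x. s \<in> sign_vectors \<Longrightarrow> (\<And>i. 0 \<le> s i * x i) \<Longrightarrow> (\<And>a. a \<in> A \<Longrightarrow> half a x) \<Longrightarrow> x \<in> tc_cone hull G s"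
    by metis
  let ?G = "\<Union>s\<in>sign_vectors. G s"
  have "{x. \<forall>a\<in>A. half a x} = tc_cone hull ?G"
  proof
    show "{x. \<forall>a\<in>A. half a x} \<subseteq> tc_cone hull ?G"
    proof clarify
      fix x assume x: "\<forall>a\<in>A. half a x"
      let ?s = "\<lambda>i. if 0 \<le> x i then 1 else - 1 :: real"
      have s: "?s \<in> sign_vectors" by (auto simp: sign_vectors_def)
      have "x \<in> tc_cone hull G ?s" by (rule G(3)[OF s]) (use x in auto)
      then show "x \<in> tc_cone hull ?G" using hull_mono[of "G ?s" ?G] s by blast
    qed
    have "tc_cone (\<Inter>a\<in>A. {x. half a x})" by (rule tc_cone_Inter) (auto simp: half_tc_cone)
    also have "(\<Inter>a\<in>A. {x. half a x}) = {x. \<forall>a\<in>A. half a x}" by blast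
    finally have "tc_cone {x. \<forall>a\<in>A. half a x}" .
    then show "tc_cone hull ?G \<subseteq> {x. \<forall>a\<in>A. half a x}"
      by (rule hull_minimal[rotated]) (use G(2) in blast)
  qed
  then show ?thesis using G(1) finite_sign_vectors by (intro exI[of _ ?G]) auto
qed

text \<open>Polarity: by symmetry of \<open>half\<close>, the vectors valid on \<open>M\<close> are
  an intersection of finitely many halfspaces and have finitely many generators \<open>A\<close>. A
  point satisfying these satisfies every valid vector, so separation puts it into the hull.\<close>

theorem tc_cone_hull_finite_halfspaces:
  fixes M :: "('i::finite \<Rightarrow> real) set"
  assumes fin: "finite M"
  shows "\<exists>A. finite A \<and> tc_cone hull M = {x. \<forall>a\<in>A. half a x}"
proof -
  obtain A where A: "finite A" "{a. \<forall>x\<in>M. half x a} = tc_cone hull A"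
    using halfspace_intersection_finitely_generated[OF fin] by blast
  have "tc_cone hull M = {x. \<forall>a\<in>A. half a x}"
  proof
    have "half a x" if "a \<in> A" "x \<in> M" for a x
      using that A(2) hull_subset[of A tc_cone] half_commute by blast
    moreover have "tc_cone (\<Inter>a\<in>A. {x. half a x})" by (rule tc_cone_Inter) (auto simp: half_tc_cone)
    ultimately have "tc_cone hull M \<subseteq> (\<Inter>a\<in>A. {x. half a x})" by (intro hull_minimal) auto
    then show "tc_cone hull M \<subseteq> {x. \<forall>a\<in>A. half a x}" by blast
    show "{x. \<forall>a\<in>A. half a x} \<subseteq> tc_cone hull M"
    proof clarify
      fix w assume w: "\<forall>a\<in>A. half a w"
      have "tc_cone hull A \<subseteq> {a. half w a}"
      proof (rule hull_minimal)
        show "A \<subseteq> {a. half w a}" using w half_commute by blast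
      qed (rule half_tc_cone)
      then show "w \<in> tc_cone hull M" using A(2) by (intro tc_cone_separation[OF fin]) auto
    qed
  qed
  then show ?thesis using A(1) by blast
qed

section \<open>Signed tropical numbers as real numbers\<close>

text \<open>On signed numbers this is a multiplicative bijection onto the reals; the value at balanced numbers is junk.\<close>

primrec to_real :: "symtrop \<Rightarrow> real" where
  "to_real TZero = 0"
| "to_real (Pos r) = exp r"
| "to_real (Neg r) = - exp r"
| "to_real (Bal r) = 0"

definition of_real_trop :: "real \<Rightarrow> symtrop" where
  "of_real_trop t = (if t = 0 then TZero else if 0 < t then Pos (ln t) else Neg (ln (- t)))"

lemma tsigned_cases:
  assumes "x \<in> tsigned"
  obtains "x = TZero" | r where "x = Pos r" | r where "x = Neg r"
  using assms by (auto simp: tsigned_def tpos_def tneg_def zero_symtrop_def)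

lemma of_real_trop_tsigned [simp]: "of_real_trop t \<in> tsigned"
  by (auto simp: of_real_trop_def tsigned_def tpos_def tneg_def zero_symtrop_def)

lemma to_real_of_real_trop [simp]: "to_real (of_real_trop t) = t"
  by (auto simp: of_real_trop_def)

lemma of_real_trop_to_real [simp]: "x \<in> tsigned \<Longrightarrow> of_real_trop (to_real x) = x"
  by (erule tsigned_cases) (auto simp: of_real_trop_def)

lemma to_real_mult [simp]: "to_real (x * y) = to_real x * to_real y"
  by (cases x; cases y) (auto simp: times_symtrop_def exp_add)

lemma tsigned_mult [simp]: "x \<in> tsigned \<Longrightarrow> y \<in> tsigned \<Longrightarrow> x * y \<in> tsigned"
  by (erule tsigned_cases; erule tsigned_cases)
    (auto simp: times_symtrop_def tsigned_def tpos_def tneg_def zero_symtrop_def)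

lemma to_real_zero [simp]: "to_real 0 = 0"
  by (simp add: zero_symtrop_def)

definition to_vec :: "symtrop ^ 'd \<Rightarrow> 'd \<Rightarrow> real" where
  "to_vec x = (\<lambda>i. to_real (x $ i))"

definition of_vec :: "('d \<Rightarrow> real) \<Rightarrow> symtrop ^ 'd" where
  "of_vec v = (\<chi> i. of_real_trop (v i))"

lemma to_vec_of_vec [simp]: "to_vec (of_vec v) = v"
  by (simp add: to_vec_def of_vec_def)

lemma of_vec_to_vec [simp]: "x \<in> signed_vecs \<Longrightarrow> of_vec (to_vec x) = x"
  by (simp add: to_vec_def of_vec_def signed_vecs_def vec_eq_iff)

lemma of_vec_signed [simp]: "of_vec v \<in> signed_vecs"
  by (simp add: of_vec_def signed_vecs_def)

lemma of_vec_eq_0_iff: "of_vec v = 0 \<longleftrightarrow> v = (\<lambda>_. 0)"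
proof
  assume "of_vec v = 0"
  then have "to_vec (of_vec v) = to_vec 0" by simp
  then show "v = (\<lambda>_. 0)" by (simp add: to_vec_def fun_eq_iff del: to_vec_of_vec) (simp add: of_vec_def)
qed (simp add: of_vec_def of_real_trop_def vec_eq_iff zero_symtrop_def)

text \<open>The sum of signed numbers whose largest positive and negative norms are \<open>ln p\<close> and \<open>ln n\<close>
  (\<open>0\<close> stands for the absence of such a number).\<close>

definition trop_of_extremes :: "real \<Rightarrow> real \<Rightarrow> symtrop" where
  "trop_of_extremes p n =
     (if n < p then Pos (ln p) else if p < n then Neg (ln n) else if p = 0 then TZero else Bal (ln p))"

lemma trop_of_extremes_plus:
  assumes "0 \<le> p" "0 \<le> n" "0 \<le> q" "0 \<le> m"
  shows "trop_of_extremes p n + trop_of_extremes q m = trop_of_extremes (max p q) (max n m)"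
  using assms
  by (cases p n rule: linorder_cases; cases q m rule: linorder_cases;
      cases p q rule: linorder_cases; cases n m rule: linorder_cases)
    (auto simp: trop_of_extremes_def plus_symtrop_def max_def)

lemma trop_of_extremes_nonneg_iff:
  "trop_of_extremes p n \<in> tpos \<union> tbalanced \<longleftrightarrow> n \<le> p"
  by (auto simp: trop_of_extremes_def tpos_def tbalanced_def zero_symtrop_def)

lemma tsigned_trop_of_extremes:
  "x \<in> tsigned \<Longrightarrow> x = trop_of_extremes (max 0 (to_real x)) (max 0 (- to_real x))"
  by (erule tsigned_cases) (auto simp: trop_of_extremes_def max_def not_le)

lemma sum_trop_of_extremes:
  assumes "finite A" "\<And>i. i \<in> A \<Longrightarrow> f i \<in> tsigned"
  shows "sum f A = trop_of_extremes (Max (insert 0 ((\<lambda>i. to_real (f i)) ` A)))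
    (Max (insert 0 ((\<lambda>i. - to_real (f i)) ` A)))"
  using assms
proof (induction A rule: finite_induct)
  case empty
  then show ?case by (simp add: trop_of_extremes_def zero_symtrop_def)
next
  case (insert k A)
  let ?P = "\<lambda>g. Max (insert 0 (g ` A)) :: real"
  have P0: "0 \<le> ?P g" for g by (rule Max_ge) (use insert.hyps in auto)
  have ins: "Max (insert 0 (g ` insert k A)) = max (max 0 (g k)) (?P g)" for g :: "_ \<Rightarrow> real"
  proof -
    have "insert 0 (g ` insert k A) = insert (g k) (insert 0 (g ` A))" by auto
    then have "Max (insert 0 (g ` insert k A)) = max (g k) (?P g)" using insert.hyps by simp
    then show ?thesis using P0[of g] by (auto simp: max_def)
  qed
  have "sum f (insert k A) = f k + sum f A" using insert.hyps by simp
  also have "\<dots> = trop_of_extremes (max 0 (to_real (f k))) (max 0 (- to_real (f k))) +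
      trop_of_extremes (?P (\<lambda>i. to_real (f i))) (?P (\<lambda>i. - to_real (f i)))"
    using insert tsigned_trop_of_extremes[of "f k"] by simp
  also have "\<dots> = trop_of_extremes (Max (insert 0 ((\<lambda>i. to_real (f i)) ` insert k A)))
      (Max (insert 0 ((\<lambda>i. - to_real (f i)) ` insert k A)))"
    unfolding ins by (rule trop_of_extremes_plus) (use P0 in auto)
  finally show ?case .
qed

text \<open>Here tropical sums turn into the relation \<open>half\<close>: what counts is whether
  the largest positive norm reaches the largest negative one.\<close>

lemma sum_nonneg_or_balanced_iff:
  fixes f :: "'i::finite \<Rightarrow> symtrop"
  assumes f: "\<And>i. f i \<in> tsigned"
  shows "sum f UNIV \<in> tpos \<union> tbalanced \<longleftrightarrow> (\<exists>i. \<forall>j. \<bar>to_real (f j)\<bar> \<le> to_real (f i))"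
proof -
  let ?P = "insert 0 (range (\<lambda>i. to_real (f i)))" and ?N = "insert 0 (range (\<lambda>i. - to_real (f i)))"
  have mp: "to_real (f i) \<le> Max ?P" and mn: "- to_real (f i) \<le> Max ?N" for i
    by (rule Max_ge; simp)+
  have "sum f UNIV \<in> tpos \<union> tbalanced \<longleftrightarrow> Max ?N \<le> Max ?P"
    unfolding sum_trop_of_extremes[OF finite f] trop_of_extremes_nonneg_iff ..
  also have "\<dots> \<longleftrightarrow> (\<exists>i. \<forall>j. \<bar>to_real (f j)\<bar> \<le> to_real (f i))"
  proof
    assume le: "Max ?N \<le> Max ?P"
    then have b: "\<bar>to_real (f j)\<bar> \<le> Max ?P" for j using mp[of j] mn[of j] by linarith
    have "Max ?P \<in> ?P" by (rule Max_in) auto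
    then consider "Max ?P = 0" | i where "Max ?P = to_real (f i)" by blast
    then show "\<exists>i. \<forall>j. \<bar>to_real (f j)\<bar> \<le> to_real (f i)"
    proof cases
      case 1
      then have "to_real (f j) = 0" for j using b[of j] by linarith
      then show ?thesis by simp
    next
      case 2
      then show ?thesis using b by metis
    qed
  next
    assume "\<exists>i. \<forall>j. \<bar>to_real (f j)\<bar> \<le> to_real (f i)"
    then obtain i where i: "\<And>j. \<bar>to_real (f j)\<bar> \<le> to_real (f i)" by blast
    have "\<forall>r\<in>?N. r \<le> to_real (f i)" using i i[of i] by (auto simp: abs_le_iff)
    then have "Max ?N \<le> to_real (f i)" by simp
    then show "Max ?N \<le> Max ?P" using mp[of i] by linarith
  qed
  finally show ?thesis .
qed

text \<open>The extra coordinate \<open>None\<close> carries the constant term of an affine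
  halfspace; points get the entry 1 there.\<close>

definition homogenize :: "real \<Rightarrow> ('d \<Rightarrow> real) \<Rightarrow> 'd option \<Rightarrow> real" where
  "homogenize t v = case_option t v"

lemma homogenize_simps [simp]: "homogenize t v None = t" "homogenize t v (Some i) = v i"
  by (simp_all add: homogenize_def)

section \<open>Closed halfspaces and TC-convex hulls in the real model\<close>

lemma closed_halfspace_iff:
  fixes x :: "symtrop ^ 'd::finite"
  assumes a: "a0 \<in> tsigned" "a \<in> signed_vecs" and x: "x \<in> signed_vecs"
  shows "x \<in> closed_halfspace a0 a \<longleftrightarrow> half (homogenize (to_real a0) (to_vec a)) (homogenize 1 (to_vec x))"
proof -
  let ?f = "case_option a0 (\<lambda>i. a $ i * x $ i)"
  have f: "?f p \<in> tsigned" for p using a x by (cases p) (auto simp: signed_vecs_def)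
  have h: "to_real (?f p) = homogenize (to_real a0) (to_vec a) p * homogenize 1 (to_vec x) p" for p
    by (cases p) (auto simp: to_vec_def)
  have "a0 + (\<Sum>i\<in>UNIV. a $ i * x $ i) = sum ?f UNIV"
    by (simp add: UNIV_option_conv sum.reindex)
  then show ?thesis
    using x sum_nonneg_or_balanced_iff[of ?f, OF f] by (simp add: closed_halfspace_def half_def h)
qed

lemma half_homogenize:
  fixes a x :: "'d::finite \<Rightarrow> real"
  shows "half (homogenize 0 a) (homogenize t x) \<longleftrightarrow> half a x"
  unfolding half_iff_neg by (auto simp: split_option_all split_option_ex)

lemma closed_linear_halfspace_iff:
  fixes x :: "symtrop ^ 'd::finite"
  assumes "a \<in> signed_vecs" "x \<in> signed_vecs"
  shows "x \<in> closed_halfspace 0 a \<longleftrightarrow> half (to_vec a) (to_vec x)"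
  using closed_halfspace_iff[of 0 a x] assms by (simp add: half_homogenize tsigned_def)

text \<open>In homogeneous coordinates the scaled points have the entries \<open>l\<close> and
  \<open>m\<close> at \<open>None\<close>, and \<open>max l m = 1\<close> gives their sum the entry
  1 again. Each halfspace containing \<open>x\<close> and \<open>y\<close> thus becomes a cone
  containing the sum. Two nonnegative weights do not cancel unless both vanish, so the fill rule
  remains available at an ordinary coordinate.\<close>

lemma conv_TC2_lsum:
  fixes x y :: "symtrop ^ 'd::finite"
  assumes "x \<in> signed_vecs" "y \<in> signed_vecs" and lm: "0 \<le> l" "0 \<le> m" "max l m = 1"
  shows "of_vec (lsum (\<lambda>i. l * to_vec x i) (\<lambda>i. m * to_vec y i)) \<in> conv_TC2 x y"
    and "l * to_vec x k = - (m * to_vec y k) \<Longrightarrow>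
      (\<And>i. i \<noteq> k \<Longrightarrow> l * to_vec x i = - (m * to_vec y i) \<Longrightarrow> l * to_vec x i = 0) \<Longrightarrow>
      \<bar>r\<bar> \<le> \<bar>l * to_vec x k\<bar> \<Longrightarrow>
      of_vec ((lsum (\<lambda>i. l * to_vec x i) (\<lambda>i. m * to_vec y i))(k := r)) \<in> conv_TC2 x y"
proof -
  let ?z = "lsum (\<lambda>i. l * to_vec x i) (\<lambda>i. m * to_vec y i)"
  let ?x = "\<lambda>i. l * homogenize 1 (to_vec x) i" and ?y = "\<lambda>i. m * homogenize 1 (to_vec y) i"
  have eq: "homogenize 1 ?z = lsum ?x ?y"
  proof
    fix p show "homogenize 1 ?z p = lsum ?x ?y p"
      using lm by (cases p) (auto simp: lsum_def max_def split: if_splits)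
  qed
  have H: "tc_cone {v. half (homogenize (to_real a0) (to_vec a)) v}" for a0 and a :: "symtrop ^ 'd"
    by (rule half_tc_cone)
  have "of_vec ?z \<in> closed_halfspace a0 a"
    if "a0 \<in> tsigned" "a \<in> signed_vecs" "x \<in> closed_halfspace a0 a" "y \<in> closed_halfspace a0 a" for a0 a
    using that assms tc_cone_lsum[OF H tc_cone_scale[OF H _ lm(1)] tc_cone_scale[OF H _ lm(2)]]
    by (simp add: closed_halfspace_iff eq)
  then show "of_vec ?z \<in> conv_TC2 x y"
    by (auto simp: conv_TC2_def signed_Inter_def is_closed_halfspace_def)
  assume k: "l * to_vec x k = - (m * to_vec y k)"
    "\<And>i. i \<noteq> k \<Longrightarrow> l * to_vec x i = - (m * to_vec y i) \<Longrightarrow> l * to_vec x i = 0"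
    "\<bar>r\<bar> \<le> \<bar>l * to_vec x k\<bar>"
  have eq': "homogenize 1 (?z(k := r)) = (lsum ?x ?y)(Some k := r)"
  proof
    fix p show "homogenize 1 (?z(k := r)) p = ((lsum ?x ?y)(Some k := r)) p"
      using eq[THEN fun_cong, of p] by (cases p) auto
  qed
  have nc: "?x i = 0" if "i \<noteq> Some k" "?x i = - ?y i" for i
    using that k(2) lm by (cases i) auto
  have "of_vec (?z(k := r)) \<in> closed_halfspace a0 a"
    if a: "a0 \<in> tsigned" "a \<in> signed_vecs" and xy: "x \<in> closed_halfspace a0 a" "y \<in> closed_halfspace a0 a" for a0 a
  proof -
    have "(lsum ?x ?y)(Some k := r) \<in> {v. half (homogenize (to_real a0) (to_vec a)) v}"
    proof (rule tc_cone_fill[OF H tc_cone_scale[OF H _ lm(1)] tc_cone_scale[OF H _ lm(2)]])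
      show "?x i = 0" if "i \<noteq> Some k" "?x i = - ?y i" for i using nc[OF that] .
    qed (use a xy assms k in \<open>auto simp: closed_halfspace_iff\<close>)
    then show ?thesis using a by (simp add: closed_halfspace_iff eq' del: fun_upd_apply)
  qed
  then show "of_vec (?z(k := r)) \<in> conv_TC2 x y"
    by (auto simp: conv_TC2_def signed_Inter_def is_closed_halfspace_def)
qed

lemma TC_convex_conv_TC: "TC_convex (conv_TC M)"
  unfolding TC_convex_def
proof (intro conjI ballI)
  show "conv_TC M \<subseteq> signed_vecs" by (auto simp: conv_TC_def signed_Inter_def)
  fix x y assume "x \<in> conv_TC M" "y \<in> conv_TC M"
  then have "conv_TC2 x y \<subseteq> S" if "TC_convex S" "M \<subseteq> S" for S
    using that unfolding conv_TC_def signed_Inter_def TC_convex_def by blast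
  then show "conv_TC2 x y \<subseteq> conv_TC M"
    unfolding conv_TC_def by (auto simp: signed_Inter_def conv_TC2_def)
qed

lemma conv_TC_superset: "M \<subseteq> signed_vecs \<Longrightarrow> M \<subseteq> conv_TC M"
  by (auto simp: conv_TC_def signed_Inter_def)

lemma of_vec_scale:
  assumes "x \<in> signed_vecs"
  shows "of_vec (\<lambda>i. t * to_vec x i) = of_real_trop t *s x"
proof -
  have "of_real_trop (t * to_real (x $ i)) = of_real_trop t * x $ i" for i
    using assms of_real_trop_to_real[of "of_real_trop t * x $ i"] by (simp add: signed_vecs_def)
  then show ?thesis by (simp add: of_vec_def to_vec_def vec_eq_iff)
qed

lemma cone_TC_iff:
  assumes M: "M \<subseteq> signed_vecs"
  shows "of_vec v \<in> cone_TC M \<longleftrightarrow> (\<exists>l\<ge>0. \<exists>x\<in>conv_TC M. v = (\<lambda>i. l * to_vec x i))"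
proof
  assume "of_vec v \<in> cone_TC M"
  then obtain l x where lx: "of_vec v = l *s x" "l \<in> tnonneg" "x \<in> conv_TC M"
    by (auto simp: cone_TC_def)
  have "v = to_vec (l *s x)" using lx(1) by (metis to_vec_of_vec)
  then have "v = (\<lambda>i. to_real l * to_vec x i)" by (simp add: to_vec_def)
  moreover have "0 \<le> to_real l" using lx(2) by (auto simp: tnonneg_def tpos_def)
  ultimately show "\<exists>l\<ge>0. \<exists>x\<in>conv_TC M. v = (\<lambda>i. l * to_vec x i)" using lx(3) by blast
next
  assume "\<exists>l\<ge>0. \<exists>x\<in>conv_TC M. v = (\<lambda>i. l * to_vec x i)"
  then obtain l x where lx: "0 \<le> l" "x \<in> conv_TC M" "v = (\<lambda>i. l * to_vec x i)" by blast
  have "x \<in> signed_vecs" using lx(2) TC_convex_conv_TC by (auto simp: TC_convex_def)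
  then have "of_vec v = of_real_trop l *s x" using lx(3) of_vec_scale by blast
  moreover have "of_real_trop l \<in> tnonneg"
    using lx(1) by (auto simp: of_real_trop_def tnonneg_def tpos_def zero_symtrop_def)
  ultimately show "of_vec v \<in> cone_TC M" using lx(2) by (auto simp: cone_TC_def)
qed

lemma lsum_scale: "0 < t \<Longrightarrow> lsum (\<lambda>i. t * x i) (\<lambda>i. t * y i) = (\<lambda>i. t * lsum x y i)"
  by (auto simp: lsum_def fun_eq_iff abs_mult)

text \<open>Dividing by the larger scalar \<open>t = max l m\<close> turns two multiples into the
  weights of a tropical convex combination, and the result is scaled back by \<open>t\<close>. A
  point of \<open>M\<close> supplies the zero vector.\<close>

lemma tc_cone_cone_TC:
  fixes M :: "(symtrop ^ 'd::finite) set"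
  assumes M: "M \<subseteq> signed_vecs" "M \<noteq> {}"
  shows "tc_cone {v. of_vec v \<in> cone_TC M}"
proof -
  let ?K = "{v. \<exists>l\<ge>0. \<exists>x\<in>conv_TC M. v = (\<lambda>i. l * to_vec x i)}"
  have KI: "(\<lambda>i. l * v i) \<in> ?K" if "0 \<le> l" "of_vec v \<in> conv_TC M" for l v
    using that by (auto intro!: exI[of _ l] bexI[of _ "of_vec v"])
  have sv: "x \<in> signed_vecs" if "x \<in> conv_TC M" for x
    using that TC_convex_conv_TC[of M] by (auto simp: TC_convex_def)
  have zero: "(\<lambda>_. 0) \<in> ?K"
  proof -
    obtain x where "x \<in> conv_TC M" using conv_TC_superset[OF M(1)] M(2) by blast
    then show ?thesis using KI[of 0 "to_vec x"] sv by simp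
  qed
  have pair: "lsum v w \<in> ?K \<and> (v k = - w k \<and> (\<forall>i. i \<noteq> k \<longrightarrow> v i = - w i \<longrightarrow> v i = 0) \<and>
      \<bar>r\<bar> \<le> \<bar>v k\<bar> \<longrightarrow> (lsum v w)(k := r) \<in> ?K)"
    if v: "v = (\<lambda>i. l * to_vec x i)" "0 \<le> l" "x \<in> conv_TC M"
      and w: "w = (\<lambda>i. m * to_vec y i)" "0 \<le> m" "y \<in> conv_TC M" for v w k r l m x y
  proof (cases "l = 0 \<and> m = 0")
    case True
    then have vw: "v = (\<lambda>_. 0)" "w = (\<lambda>_. 0)" using v(1) w(1) by auto
    have "lsum v w = (\<lambda>_. 0)" using vw by (simp add: lsum_def)
    then have "lsum v w \<in> ?K" using zero by (simp only:)
    moreover have "(lsum v w)(k := r) \<in> ?K" if "\<bar>r\<bar> \<le> \<bar>v k\<bar>"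
    proof -
      have "(lsum v w)(k := r) = (\<lambda>_. 0)" using that vw by (auto simp: lsum_def)
      then show ?thesis using zero by (simp only:)
    qed
    ultimately show ?thesis by blast
  next
    case False
    define t where "t = max l m"
    have t: "0 < t" using False v(2) w(2) by (auto simp: t_def max_def)
    have nrm: "0 \<le> l / t" "0 \<le> m / t" "max (l / t) (m / t) = 1"
      using t v(2) w(2) by (auto simp: t_def max_def divide_simps)
    let ?v = "\<lambda>i. l / t * to_vec x i" and ?w = "\<lambda>i. m / t * to_vec y i"
    have vt: "v = (\<lambda>i. t * ?v i)" "w = (\<lambda>i. t * ?w i)" using t v(1) w(1) by auto
    have ls: "lsum v w = (\<lambda>i. t * lsum ?v ?w i)"
      unfolding vt by (rule lsum_scale[OF t])
    have sub: "conv_TC2 x y \<subseteq> conv_TC M"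
      using v(3) w(3) TC_convex_conv_TC[of M] unfolding TC_convex_def by blast
    note op = conv_TC2_lsum[OF sv[OF v(3)] sv[OF w(3)] nrm]
    have "lsum v w \<in> ?K" unfolding ls using KI[of t] t op(1) sub by auto
    moreover have "(lsum v w)(k := r) \<in> ?K"
      if k: "v k = - w k" "\<forall>i. i \<noteq> k \<longrightarrow> v i = - w i \<longrightarrow> v i = 0" "\<bar>r\<bar> \<le> \<bar>v k\<bar>"
    proof -
      have "of_vec ((lsum ?v ?w)(k := r / t)) \<in> conv_TC2 x y"
      proof (rule op(2))
        have eqi: "v i = - w i \<longleftrightarrow> ?v i = - ?w i" "v i = 0 \<longleftrightarrow> ?v i = 0" for i
          using t unfolding vt[THEN fun_cong, of i] by (metis minus_mult_right mult_cancel_left order_less_irrefl) simp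
        show "?v k = - ?w k" using k(1) eqi by blast
        show "?v i = 0" if "i \<noteq> k" "?v i = - ?w i" for i using that k(2) eqi by blast
        have "\<bar>r\<bar> \<le> t * \<bar>?v k\<bar>" using k(3) t unfolding vt[THEN fun_cong, of k] by (simp add: abs_mult)
        then show "\<bar>r / t\<bar> \<le> \<bar>?v k\<bar>" using t by (simp only: abs_divide) (simp add: pos_divide_le_eq mult.commute)
      qed
      then have "of_vec ((lsum ?v ?w)(k := r / t)) \<in> conv_TC M" using sub by (rule subsetD[rotated])
      then have "(\<lambda>i. t * ((lsum ?v ?w)(k := r / t)) i) \<in> ?K" by (rule KI[OF less_imp_le[OF t]])
      moreover have "(\<lambda>i. t * ((lsum ?v ?w)(k := r / t)) i) = (lsum v w)(k := r)"
        unfolding ls using t by (auto simp: fun_eq_iff)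
      ultimately show ?thesis by simp
    qed
    ultimately show ?thesis by blast
  qed
  have "tc_cone ?K"
  proof (rule tc_coneI)
    show "(\<lambda>i. t * v i) \<in> ?K" if v: "v \<in> ?K" and t: "0 \<le> t" for v and t :: real
    proof -
      obtain l x where lx: "0 \<le> l" "x \<in> conv_TC M" "v = (\<lambda>i. l * to_vec x i)" using v by blast
      then have "(\<lambda>i. t * l * to_vec x i) \<in> ?K" by (intro KI) (use t sv in auto)
      then show ?thesis unfolding lx(3) by (simp only: mult.assoc)
    qed
    show "lsum v w \<in> ?K" if vK: "v \<in> ?K" and wK: "w \<in> ?K" for v w
    proof -
      obtain l x where v: "v = (\<lambda>i. l * to_vec x i)" "0 \<le> l" "x \<in> conv_TC M" using vK by blast
      obtain m y where w: "w = (\<lambda>i. m * to_vec y i)" "0 \<le> m" "y \<in> conv_TC M" using wK by blast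
      show ?thesis by (rule pair[OF v w, THEN conjunct1])
    qed
    show "(lsum v w)(k := r) \<in> ?K"
      if vK: "v \<in> ?K" and wK: "w \<in> ?K"
        and k: "v k = - w k" "\<And>i. i \<noteq> k \<Longrightarrow> v i = - w i \<Longrightarrow> v i = 0" "\<bar>r\<bar> \<le> \<bar>v k\<bar>" for v w k r
    proof -
      obtain l x where v: "v = (\<lambda>i. l * to_vec x i)" "0 \<le> l" "x \<in> conv_TC M" using vK by blast
      obtain m y where w: "w = (\<lambda>i. m * to_vec y i)" "0 \<le> m" "y \<in> conv_TC M" using wK by blast
      show ?thesis by (rule pair[OF v w, THEN conjunct2, THEN mp]) (use k in simp)
    qed
  qed (rule zero)
  then show ?thesis by (simp add: cone_TC_iff[OF M(1)])
qed

text \<open>For \<open>a = 0\<close> the set is all of \<open>signed_vecs\<close>, while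
  \<open>is_closed_halfspace\<close> asks for a nonzero normal vector; hence the case split.\<close>

lemma TC_convex_halfspace:
  fixes a :: "'d::finite \<Rightarrow> real"
  shows "TC_convex {x \<in> signed_vecs. half a (to_vec x)}"
proof (cases "a = (\<lambda>_. 0)")
  case True
  then show ?thesis by (auto simp: TC_convex_def conv_TC2_def signed_Inter_def half_def)
next
  case False
  let ?H = "closed_halfspace 0 (of_vec a)"
  have "is_closed_halfspace ?H"
  proof -
    have "of_vec a \<noteq> 0" using False by (simp add: of_vec_eq_0_iff)
    moreover have "0 \<in> tsigned" by (simp add: tsigned_def)
    ultimately show ?thesis unfolding is_closed_halfspace_def using of_vec_signed[of a] by blast
  qed
  moreover have "?H = {x \<in> signed_vecs. half a (to_vec x)}"
    using closed_linear_halfspace_iff[OF of_vec_signed, of _ a] by (auto simp: closed_halfspace_def)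
  ultimately show ?thesis by (auto simp: TC_convex_def conv_TC2_def signed_Inter_def)
qed

section \<open>Linear systems over ordered fields\<close>

text \<open>
  Fourier--Motzkin elimination with rows indexed by \<open>R\<close> and variables by \<open>E\<close>; the multipliers in
  \<open>Y\<close> do not depend on the right-hand side.
\<close>

lemma uniform_Farkas_on:
  fixes C :: "'r \<Rightarrow> 'd::finite \<Rightarrow> 'k::linordered_field"
  assumes R: "finite R" and E: "finite E"
  shows "\<exists>Y. finite Y \<and> (\<forall>y\<in>Y. (\<forall>r\<in>R. 0 \<le> y r) \<and> (\<forall>j\<in>E. (\<Sum>r\<in>R. y r * C r j) = 0)) \<and>
    (\<forall>\<beta> x. (\<forall>y\<in>Y. (\<Sum>r\<in>R. y r * \<beta> r) \<le> (\<Sum>r\<in>R. y r * (\<Sum>j\<in>UNIV. C r j * x j))) \<longrightarrow>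
      (\<exists>z. (\<forall>j. j \<notin> E \<longrightarrow> z j = x j) \<and> (\<forall>r\<in>R. \<beta> r \<le> (\<Sum>j\<in>UNIV. C r j * z j))))"
  using E
proof (induction E rule: finite_induct)
  case empty
  let ?Y = "(\<lambda>q r. if r = q then 1 else 0 :: 'k) ` R"
  have s: "(\<Sum>r\<in>R. (if r = q then 1 else 0) * f r) = f q" if "q \<in> R" for q and f :: "'r \<Rightarrow> 'k"
  proof -
    have "(\<Sum>r\<in>R. (if r = q then 1 else 0) * f r) = (\<Sum>r\<in>R. if r = q then f r else 0)"
      by (rule sum.cong) auto
    then show ?thesis using that R by simp
  qed
  show ?case
    by (intro exI[of _ ?Y] conjI allI impI exI) (use R s in auto)
next
  case (insert d E)
  from insert.IH
  obtain Y where Y: "finite Y" and nnel: "\<forall>y\<in>Y. (\<forall>r\<in>R. 0 \<le> y r) \<and> (\<forall>j\<in>E. (\<Sum>r\<in>R. y r * C r j) = 0)"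
    and sol: "\<forall>\<beta> x. (\<forall>y\<in>Y. (\<Sum>r\<in>R. y r * \<beta> r) \<le> (\<Sum>r\<in>R. y r * (\<Sum>j\<in>UNIV. C r j * x j))) \<longrightarrow>
      (\<exists>z. (\<forall>j. j \<notin> E \<longrightarrow> z j = x j) \<and> (\<forall>r\<in>R. \<beta> r \<le> (\<Sum>j\<in>UNIV. C r j * z j)))"
    by (elim exE conjE) (rule that)
  have nn: "0 \<le> y r" if "y \<in> Y" "r \<in> R" for y r using nnel that by blast
  have el: "(\<Sum>r\<in>R. y r * C r j) = 0" if "y \<in> Y" "j \<in> E" for y j using nnel that by blast
  \<comment> \<open>\<open>c y\<close> is the coefficient of the variable to be eliminated in the
    row combination \<open>y\<close>.\<close>
  define c where "c y = (\<Sum>r\<in>R. y r * C r d)" for y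
  define comb where "comb = (\<lambda>(y, y') r. - c y' * y r + c y * (y' r :: 'k))"
  define Z where "Z = {y \<in> Y. c y = 0} \<union> comb ` {(y, y') \<in> Y \<times> Y. 0 < c y \<and> c y' < 0}"
  have sum_comb: "(\<Sum>r\<in>R. comb (y, y') r * f r) = - c y' * (\<Sum>r\<in>R. y r * f r) + c y * (\<Sum>r\<in>R. y' r * f r)"
    for y y' f
    by (simp add: comb_def sum.distrib sum_distrib_left algebra_simps sum_subtractf sum_negf)
  have "finite {(y, y') \<in> Y \<times> Y. 0 < c y \<and> c y' < 0}"
    by (rule finite_subset[of _ "Y \<times> Y"]) (use Y in auto)
  then have "finite Z" using Y by (simp add: Z_def)
  moreover have "\<forall>y\<in>Z. (\<forall>r\<in>R. 0 \<le> y r) \<and> (\<forall>j\<in>insert d E. (\<Sum>r\<in>R. y r * C r j) = 0)"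
  proof
    fix y assume "y \<in> Z"
    then consider "y \<in> Y" "c y = 0" | u v where "y = comb (u, v)" "u \<in> Y" "v \<in> Y" "0 < c u" "c v < 0"
      by (auto simp: Z_def)
    then show "(\<forall>r\<in>R. 0 \<le> y r) \<and> (\<forall>j\<in>insert d E. (\<Sum>r\<in>R. y r * C r j) = 0)"
    proof cases
      case 1
      then show ?thesis using nn el by (auto simp: c_def)
    next
      case 2
      have "0 \<le> y r" if "r \<in> R" for r
      proof -
        have "0 \<le> - c v * u r" by (rule mult_nonneg_nonneg) (use 2 nn that in auto)
        moreover have "0 \<le> c u * v r" by (rule mult_nonneg_nonneg) (use 2 nn that in auto)
        ultimately show ?thesis unfolding 2(1) comb_def by simp
      qed
      moreover have "(\<Sum>r\<in>R. y r * C r j) = 0" if "j \<in> insert d E" for j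
        unfolding 2(1) sum_comb using that el 2 by (auto simp: c_def)
      ultimately show ?thesis by blast
    qed
  qed
  moreover have "\<exists>z. (\<forall>j. j \<notin> insert d E \<longrightarrow> z j = x j) \<and> (\<forall>r\<in>R. \<beta> r \<le> (\<Sum>j\<in>UNIV. C r j * z j))"
    if h: "\<And>y. y \<in> Z \<Longrightarrow> (\<Sum>r\<in>R. y r * \<beta> r) \<le> (\<Sum>r\<in>R. y r * (\<Sum>j\<in>UNIV. C r j * x j))" for \<beta> x
  proof -
    define b where "b y = (\<Sum>r\<in>R. y r * \<beta> r) - (\<Sum>r\<in>R. y r * (\<Sum>j\<in>UNIV. C r j * x j))" for y
    have hz: "b y \<le> 0" if "y \<in> Y" "c y = 0" for y using h[of y] that by (simp add: b_def Z_def)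
    have hc: "- c y' * b y + c y * b y' \<le> 0" if "y \<in> Y" "y' \<in> Y" "0 < c y" "c y' < 0" for y y'
    proof -
      have "comb (y, y') \<in> Z" using that by (auto simp: Z_def)
      from h[OF this] show ?thesis unfolding sum_comb b_def by (simp add: algebra_simps)
    qed
    \<comment> \<open>\<open>t\<close> is the shift of variable \<open>d\<close>; the combined
      multipliers in \<open>Z\<close> ensure that each lower bound for it lies below each upper
      bound.\<close>
    have "\<exists>t. \<forall>y\<in>Y. b y \<le> c y * t"
    proof -
      let ?L = "(\<lambda>y. b y / c y) ` {y\<in>Y. 0 < c y}" and ?U = "(\<lambda>y. b y / c y) ` {y\<in>Y. c y < 0}"
      have LU: "l \<le> u" if l: "l \<in> ?L" and u: "u \<in> ?U" for l u
      proof -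
        obtain y where y: "y \<in> Y" "0 < c y" "l = b y / c y" using l by blast
        obtain y' where y': "y' \<in> Y" "c y' < 0" "u = b y' / c y'" using u by blast
        have "c y * b y' \<le> c y' * b y" using hc[OF y(1) y'(1) y(2) y'(2)] by simp
        then show ?thesis using y(2) y'(2) unfolding y(3) y'(3)
          by (simp add: divide_le_eq le_divide_eq mult.commute)
      qed
      have "\<exists>t. (\<forall>l\<in>?L. l \<le> t) \<and> (\<forall>u\<in>?U. t \<le> u)"
      proof (cases "?L = {}")
        case True
        show ?thesis
        proof (cases "?U = {}")
          case False
          then have "\<forall>u\<in>?U. Min ?U \<le> u" using Y by simp
          then show ?thesis using True by blast
        qed (use True in blast)
      next
        case False
        have "\<forall>l\<in>?L. l \<le> Max ?L" using Y by simp
        moreover have "Max ?L \<in> ?L" by (rule Max_in) (use Y False in auto)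
        ultimately show ?thesis using LU by blast
      qed
      then obtain t where t: "\<forall>l\<in>?L. l \<le> t" "\<forall>u\<in>?U. t \<le> u" by blast
      have "b y \<le> c y * t" if y: "y \<in> Y" for y
      proof (cases "c y" "0 :: 'k" rule: linorder_cases)
        case less
        then have "t \<le> b y / c y" using t(2) y by blast
        then show ?thesis using less by (simp add: le_divide_eq mult.commute)
      next
        case equal
        then show ?thesis using hz[OF y] by simp
      next
        case greater
        then have "b y / c y \<le> t" using t(1) y by blast
        then show ?thesis using greater by (simp add: divide_le_eq mult.commute)
      qed
      then show ?thesis by blast
    qed
    then obtain t where t: "\<And>y. y \<in> Y \<Longrightarrow> b y \<le> c y * t" by blast
    define x' where "x' = x(d := x d + t)"
    have xs: "(\<Sum>j\<in>UNIV. C r j * x' j) = (\<Sum>j\<in>UNIV. C r j * x j) + C r d * t" for r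
    proof -
      have "(\<Sum>j\<in>UNIV. C r j * x' j) = (\<Sum>j\<in>UNIV. C r j * x j + (if j = d then C r d * t else 0))"
        by (rule sum.cong) (auto simp: x'_def algebra_simps)
      then show ?thesis by (simp add: sum.distrib)
    qed
    have "(\<Sum>r\<in>R. y r * \<beta> r) \<le> (\<Sum>r\<in>R. y r * (\<Sum>j\<in>UNIV. C r j * x' j))" if "y \<in> Y" for y
    proof -
      have "(\<Sum>r\<in>R. y r * (\<Sum>j\<in>UNIV. C r j * x' j)) = (\<Sum>r\<in>R. y r * (\<Sum>j\<in>UNIV. C r j * x j)) + c y * t"
        unfolding xs c_def by (simp add: distrib_left sum.distrib sum_distrib_right mult.assoc)
      then show ?thesis using t[OF that] by (simp add: b_def algebra_simps)
    qed
    then have "\<exists>z. (\<forall>j. j \<notin> E \<longrightarrow> z j = x' j) \<and> (\<forall>r\<in>R. \<beta> r \<le> (\<Sum>j\<in>UNIV. C r j * z j))"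
      by (intro sol[rule_format]) blast
    then obtain z where "\<forall>j. j \<notin> E \<longrightarrow> z j = x' j" "\<forall>r\<in>R. \<beta> r \<le> (\<Sum>j\<in>UNIV. C r j * z j)"
      by blast
    then show ?thesis by (intro exI[of _ z]) (auto simp: x'_def)
  qed
  ultimately show ?case by (intro exI[of _ Z]) blast
qed

theorem uniform_Farkas:
  fixes C :: "'r \<Rightarrow> 'd::finite \<Rightarrow> 'k::linordered_field"
  assumes "finite R"
  obtains Y where "finite Y" "\<And>y r. y \<in> Y \<Longrightarrow> r \<in> R \<Longrightarrow> 0 \<le> y r"
    "\<And>y j. y \<in> Y \<Longrightarrow> (\<Sum>r\<in>R. y r * C r j) = 0"
    "\<And>\<beta>. (\<And>y. y \<in> Y \<Longrightarrow> (\<Sum>r\<in>R. y r * \<beta> r) \<le> 0) \<Longrightarrow> \<exists>z. \<forall>r\<in>R. \<beta> r \<le> (\<Sum>j\<in>UNIV. C r j * z j)"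
proof -
  from uniform_Farkas_on[OF assms finite_class.finite_UNIV, of C]
  obtain Y where Y: "finite Y" "\<forall>y\<in>Y. (\<forall>r\<in>R. 0 \<le> y r) \<and> (\<forall>j\<in>UNIV. (\<Sum>r\<in>R. y r * C r j) = 0)"
    "\<forall>\<beta> x. (\<forall>y\<in>Y. (\<Sum>r\<in>R. y r * \<beta> r) \<le> (\<Sum>r\<in>R. y r * (\<Sum>j\<in>UNIV. C r j * x j))) \<longrightarrow>
      (\<exists>z. (\<forall>j. j \<notin> UNIV \<longrightarrow> z j = x j) \<and> (\<forall>r\<in>R. \<beta> r \<le> (\<Sum>j\<in>UNIV. C r j * z j)))"
    by (elim exE conjE) (rule that)
  show thesis
  proof (rule that[of Y])
    show "\<exists>z. \<forall>r\<in>R. \<beta> r \<le> (\<Sum>j\<in>UNIV. C r j * z j)" if "\<And>y. y \<in> Y \<Longrightarrow> (\<Sum>r\<in>R. y r * \<beta> r) \<le> 0" for \<beta>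
      using Y(3)[rule_format, of \<beta> "\<lambda>_. 0"] that by auto
  qed (use Y in auto)
qed

section \<open>Signed valuations\<close>

lemma sval_tsigned: "sval f \<in> tsigned"
  by (simp add: sval_def tsigned_def tpos_def tneg_def)

lemma lead_exp_mult:
  assumes "f \<noteq> 0" "g \<noteq> 0"
  shows "lead_exp (f * g) = lead_exp f + lead_exp g"
proof (rule lead_exp_eqI)
  have le: "\<And>x. pcoeff f x \<noteq> 0 \<Longrightarrow> x \<le> lead_exp f" "\<And>x. pcoeff g x \<noteq> 0 \<Longrightarrow> x \<le> lead_exp g"
    using lead_exp(2)[OF assms(1)] lead_exp(2)[OF assms(2)] by (meson not_less)+
  have "pcoeff (f * g) (lead_exp f + lead_exp g) =
      (\<Sum>x\<in>{lead_exp f}. pcoeff f x * pcoeff g (lead_exp f + lead_exp g - x))"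
    by (rule pcoeff_times_eq) (use le in force)+
  then show "pcoeff (f * g) (lead_exp f + lead_exp g) \<noteq> 0"
    using lead_exp(1)[OF assms(1)] lead_exp(1)[OF assms(2)] by simp
  show "\<And>c. lead_exp f + lead_exp g < c \<Longrightarrow> pcoeff (f * g) c = 0"
    using pcoeff_times_bound[OF le] by (meson not_less)
qed

definition rval :: "puiseux \<Rightarrow> real" where
  "rval f = to_real (sval f)"

lemma rval_eq:
  "rval f = (if f = 0 then 0 else if 0 < f then exp (lead_exp f) else - exp (lead_exp f))"
  by (simp add: rval_def sval_def)

lemma rval_zero [simp]: "rval 0 = 0"
  by (simp add: rval_eq)

lemma rval_pos: "0 < f \<Longrightarrow> rval f = exp (lead_exp f)"
  by (simp add: rval_eq)

lemma lead_exp_uminus: "lead_exp (- f) = lead_exp f"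
  by (simp add: lead_exp_def)

lemma rval_uminus [simp]: "rval (- f) = - rval f"
  by (cases f "0 :: puiseux" rule: linorder_cases) (auto simp: rval_eq lead_exp_uminus)

lemma rval_mult [simp]: "rval (f * g) = rval f * rval g"
proof -
  have p: "rval (f * g) = rval f * rval g" if "0 < f" "0 < g" for f g
    using that lead_exp_mult[of f g] by (simp add: rval_pos exp_add)
  have q: "rval (f * g) = rval f * rval g" if "0 < f" for f g
    using p[OF that] p[OF that, of "- g"] by (cases g "0 :: puiseux" rule: linorder_cases) auto
  show ?thesis
    using q[of f g] q[of "- f" g] by (cases f "0 :: puiseux" rule: linorder_cases) auto
qed

lemma rval_pos_iff [simp]: "0 < rval f \<longleftrightarrow> 0 < f"
  by (auto simp: rval_eq)

lemma rval_eq_0_iff [simp]: "rval f = 0 \<longleftrightarrow> f = 0"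
  by (auto simp: rval_eq)

lemma rval_neg_iff [simp]: "rval f < 0 \<longleftrightarrow> f < 0"
  using rval_pos_iff[of "- f"] by simp

lemma rval_nonneg_iff [simp]: "0 \<le> rval f \<longleftrightarrow> 0 \<le> f"
  by (metis not_le rval_neg_iff)

lemma rval_nonpos_iff [simp]: "rval f \<le> 0 \<longleftrightarrow> f \<le> 0"
  by (metis not_le rval_pos_iff)

lemma rval_abs: "rval \<bar>f\<bar> = \<bar>rval f\<bar>"
  by (auto simp: abs_if)

lemma pcoeff_of_nat_mult: "pcoeff (of_nat n * f) a = real n * pcoeff f a"
  by (induction n) (auto simp: algebra_simps)

text \<open>An integer factor can make up for leading coefficients, but never for leading exponents.
  The later estimates use this comparison instead of coefficients.\<close>

lemma rval_le_iff:
  assumes f: "0 \<le> f" and g: "0 \<le> g"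
  shows "rval f \<le> rval g \<longleftrightarrow> (\<exists>n. f \<le> of_nat n * g)"
proof (cases "f = 0 \<or> g = 0")
  case True
  then show ?thesis using f g by (auto intro: exI[of _ 0])
next
  case False
  then have p: "0 < f" "0 < g" using f g by auto
  then have c: "0 < pcoeff f (lead_exp f)" "0 < pcoeff g (lead_exp g)" and nz: "f \<noteq> 0" "g \<noteq> 0"
    by (auto simp: puiseux_zero_less_iff)
  note z = lead_exp(2)[OF nz(1)] lead_exp(2)[OF nz(2)]
  have "(\<exists>n. f \<le> of_nat n * g) \<longleftrightarrow> lead_exp f \<le> lead_exp g"
  proof
    assume le: "lead_exp f \<le> lead_exp g"
    obtain n where n: "pcoeff f (lead_exp g) < real n * pcoeff g (lead_exp g)"
      using ex_less_of_nat_mult[OF c(2)] by blast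
    have "puiseux_pos (of_nat n * g - f)"
      by (rule puiseux_posI[of _ "lead_exp g"]) (use n z le in \<open>auto simp: pcoeff_of_nat_mult\<close>)
    then show "\<exists>n. f \<le> of_nat n * g" by (auto simp: less_eq_puiseux_def)
  next
    assume "\<exists>n. f \<le> of_nat n * g"
    then obtain n where n: "f \<le> of_nat n * g" by blast
    show "lead_exp f \<le> lead_exp g"
    proof (rule ccontr)
      assume lt: "\<not> lead_exp f \<le> lead_exp g"
      have "puiseux_pos (f - of_nat n * g)"
        by (rule puiseux_posI[of _ "lead_exp f"]) (use c z lt in \<open>auto simp: pcoeff_of_nat_mult\<close>)
      then have "of_nat n * g < f" by (simp add: less_puiseux_def)
      then show False using n by simp
    qed
  qed
  then show ?thesis using p by (simp add: rval_pos)
qed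

lemma rval_surj: "\<exists>f. rval f = r"
proof -
  have p: "\<exists>f. rval f = r" if "0 < r" for r
  proof -
    have "lead_exp (pmono 1 (ln r)) = ln r" by (rule lead_exp_eqI) (auto simp: pcoeff_pmono)
    moreover have "0 < pmono 1 (ln r)"
    proof -
      have "puiseux_pos (pmono 1 (ln r))" by (rule puiseux_posI[of _ "ln r"]) (auto simp: pcoeff_pmono)
      then show ?thesis by (simp add: less_puiseux_def)
    qed
    ultimately show ?thesis using that by (intro exI[of _ "pmono 1 (ln r)"]) (simp add: rval_pos)
  qed
  then show ?thesis
  proof (cases r "0 :: real" rule: linorder_cases)
    case less
    then obtain f where "rval f = - r" using p[of "- r"] by auto
    then show ?thesis by (intro exI[of _ "- f"]) simp
  qed (use p rval_zero in blast)+
qed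


lemma rval_one [simp]: "rval 1 = 1"
  using rval_mult[of 1 1] by simp

lemma rval_of_nat: "0 < n \<Longrightarrow> rval (of_nat n) = 1"
proof (rule antisym)
  assume n: "0 < n"
  show "rval (of_nat n) \<le> 1" using rval_le_iff[of "of_nat n" 1] by auto
  have "1 \<le> of_nat 1 * (of_nat n :: puiseux)" using n by (simp add: Suc_leI)
  then show "1 \<le> rval (of_nat n)" using rval_le_iff[of 1 "of_nat n"] by (metis rval_one of_nat_0_le_iff zero_le_one)
qed

lemma sval_vec_signed: "sval_vec x \<in> signed_vecs"
  by (simp add: sval_vec_def signed_vecs_def sval_tsigned)

lemma to_vec_sval_vec: "to_vec (sval_vec x) = (\<lambda>i. rval (x $ i))"
  by (simp add: to_vec_def sval_vec_def rval_def)

section \<open>Valuations of halfspaces and polyhedral cones\<close>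

text \<open>Otherwise a negative term \<open>- g\<close> exceeds all positive terms by more than any
  integer factor, in particular by the number of coordinates, and the other summands together cannot
  compensate it.\<close>

lemma dot_nonneg_imp_half:
  fixes a x :: "'d::finite \<Rightarrow> puiseux"
  assumes nonneg: "0 \<le> (\<Sum>j\<in>UNIV. a j * x j)"
  shows "half (\<lambda>i. rval (a i)) (\<lambda>i. rval (x i))"
proof (rule ccontr)
  assume "\<not> ?thesis"
  then obtain i where i: "a i * x i < 0" and lt: "\<And>j. rval (a j * x j) < rval (- (a i * x i))"
    unfolding half_iff_neg by (auto simp flip: rval_mult simp: not_le simp del: rval_mult)
  define g where "g = - (a i * x i)"
  have g: "0 < g" using i by (simp add: g_def)
  let ?N = "CARD('d)"
  have b: "of_nat ?N * (a j * x j) \<le> g" for j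
  proof (cases "0 \<le> a j * x j")
    case True
    then have "\<not> (\<exists>n. g \<le> of_nat n * (a j * x j))"
      using lt[of j] rval_le_iff[of g "a j * x j"] g by (simp flip: g_def)
    then have "\<not> g \<le> of_nat ?N * (a j * x j)" by blast
    then show ?thesis by simp
  next
    case False
    then have "of_nat ?N * (a j * x j) \<le> 0" by (simp add: mult_nonneg_nonpos)
    then show ?thesis using g by linarith
  qed
  have "of_nat ?N * (\<Sum>j\<in>UNIV - {i}. a j * x j) \<le> (\<Sum>j\<in>UNIV - {i}. g)"
    unfolding sum_distrib_left by (rule sum_mono) (rule b)
  also have "\<dots> = of_nat ?N * g - g" by (simp add: algebra_simps of_nat_diff)
  finally have "of_nat ?N * ((\<Sum>j\<in>UNIV - {i}. a j * x j) + a i * x i) \<le> - g"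
    by (simp add: g_def algebra_simps)
  moreover have "(\<Sum>j\<in>UNIV. a j * x j) = (\<Sum>j\<in>UNIV - {i}. a j * x j) + a i * x i"
    by (subst sum.remove[of _ i]) auto
  ultimately have "of_nat ?N * (\<Sum>j\<in>UNIV. a j * x j) \<le> - g" by simp
  moreover have "0 \<le> of_nat ?N * (\<Sum>j\<in>UNIV. a j * x j)" using nonneg by simp
  ultimately show False using g by linarith
qed

lemma half_dominating_term:
  fixes a m :: "'d::finite \<Rightarrow> puiseux"
  assumes "half (\<lambda>i. rval (a i)) (\<lambda>i. rval (m i))"
  obtains i n where "0 \<le> a i * m i" "(\<Sum>j\<in>UNIV. \<bar>a j * m j\<bar>) \<le> of_nat n * (a i * m i)"
proof -
  obtain i where i: "\<And>j. rval \<bar>a j * m j\<bar> \<le> rval (a i * m i)"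
    using assms unfolding half_def by (auto simp: rval_abs)
  have p: "0 \<le> a i * m i"
    using i[of i] rval_nonneg_iff[of "\<bar>a i * m i\<bar>"] rval_nonneg_iff[of "a i * m i"] by (metis abs_ge_zero order_trans)
  have "\<forall>j. \<exists>n. \<bar>a j * m j\<bar> \<le> of_nat n * (a i * m i)" using i rval_le_iff[OF abs_ge_zero p] by blast
  then obtain n where n: "\<And>j. \<bar>a j * m j\<bar> \<le> of_nat (n j) * (a i * m i)" by metis
  have "(\<Sum>j\<in>UNIV. \<bar>a j * m j\<bar>) \<le> (\<Sum>j\<in>UNIV. of_nat (n j) * (a i * m i))" by (rule sum_mono) (rule n)
  also have "\<dots> = of_nat (\<Sum>j\<in>UNIV. n j) * (a i * m i)" by (simp add: sum_distrib_right)
  finally show thesis using p that by blast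
qed

text \<open>An arbitrary lift is corrected in the coordinate of the dominating term: an integer
  factor does not change its valuation and makes the term outweigh all others.\<close>

lemma half_lift:
  fixes a :: "'d::finite \<Rightarrow> puiseux"
  assumes "half (\<lambda>i. rval (a i)) \<xi>"
  obtains x where "\<And>i. rval (x i) = \<xi> i" "0 \<le> (\<Sum>j\<in>UNIV. a j * x j)"
proof -
  obtain m where m: "\<And>i. rval (m i) = \<xi> i"
    using choice[of "\<lambda>i f. rval f = \<xi> i"] rval_surj by blast
  then have "half (\<lambda>i. rval (a i)) (\<lambda>i. rval (m i))" using assms by simp
  then obtain i n where i: "0 \<le> a i * m i" "(\<Sum>j\<in>UNIV. \<bar>a j * m j\<bar>) \<le> of_nat n * (a i * m i)"
    by (rule half_dominating_term)
  define x where "x = m(i := of_nat (Suc n) * m i)"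
  have "(\<Sum>j\<in>UNIV. a j * x j) = (\<Sum>j\<in>UNIV. a j * m j + (if j = i then of_nat n * (a i * m i) else 0))"
    by (rule sum.cong) (auto simp: x_def algebra_simps)
  also have "\<dots> = (\<Sum>j\<in>UNIV. a j * m j) + of_nat n * (a i * m i)" by (simp add: sum.distrib)
  finally have "(\<Sum>j\<in>UNIV. a j * x j) = (\<Sum>j\<in>UNIV. a j * m j) + of_nat n * (a i * m i)" .
  moreover have "\<bar>\<Sum>j\<in>UNIV. a j * m j\<bar> \<le> (\<Sum>j\<in>UNIV. \<bar>a j * m j\<bar>)" by (rule sum_abs)
  ultimately have "0 \<le> (\<Sum>j\<in>UNIV. a j * x j)" using i(2) by linarith
  moreover have "rval (x j) = \<xi> j" for j
    using m rval_of_nat[of "Suc n"] by (simp add: x_def del: of_nat_Suc)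
  ultimately show thesis using that by blast
qed

lemma sval_vec_linear_halfspace:
  fixes a :: "puiseux ^ 'd::finite"
  shows "sval_vec ` {x. 0 \<le> (\<Sum>j\<in>UNIV. a $ j * x $ j)} =
    {x \<in> signed_vecs. half (to_vec (sval_vec a)) (to_vec x)}"
proof (intro equalityI subsetI)
  fix w assume "w \<in> sval_vec ` {x. 0 \<le> (\<Sum>j\<in>UNIV. a $ j * x $ j)}"
  then show "w \<in> {x \<in> signed_vecs. half (to_vec (sval_vec a)) (to_vec x)}"
    using dot_nonneg_imp_half[of "($) a"] by (auto simp: to_vec_sval_vec sval_vec_signed)
next
  fix w assume w: "w \<in> {x \<in> signed_vecs. half (to_vec (sval_vec a)) (to_vec x)}"
  then obtain x where x: "\<And>i. rval (x i) = to_vec w i" "0 \<le> (\<Sum>j\<in>UNIV. a $ j * x j)"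
    using half_lift[of "($) a" "to_vec w"] by (auto simp: to_vec_sval_vec)
  have "to_vec (sval_vec (\<chi> i. x i)) = to_vec w" using x(1) by (simp add: to_vec_sval_vec)
  then have "sval_vec (\<chi> i. x i) = w" using w by (metis (no_types, lifting) of_vec_to_vec sval_vec_signed mem_Collect_eq)
  then show "w \<in> sval_vec ` {x. 0 \<le> (\<Sum>j\<in>UNIV. a $ j * x $ j)}"
    using x(2) by (intro image_eqI[of _ _ "\<chi> i. x i"]) auto
qed

text \<open>
  The fibre of a real number under \<open>rval\<close> is the union of the boxes
  \<open>[m / n, n * m]\<close> around any of its points \<open>m\<close>.
\<close>

lemma rval_eq_of_box:
  assumes n: "0 < n" and z: "min (m / of_nat n) (of_nat n * m) \<le> z" "z \<le> max (m / of_nat n) (of_nat n * m)"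
  shows "rval z = rval m"
proof -
  have N: "(1 :: puiseux) \<le> of_nat n" using n by (simp add: Suc_leI)
  have p: "rval z = rval m" if "0 < m" "m / of_nat n \<le> z" "z \<le> of_nat n * m" for m z :: puiseux
  proof (rule antisym)
    have z0: "0 \<le> z" using that n by (meson divide_nonneg_nonneg less_imp_le of_nat_0_le_iff order_trans)
    show "rval z \<le> rval m" using rval_le_iff[OF z0, of m] that by auto
    have "m \<le> of_nat n * z" using that(2) n by (simp add: divide_le_eq mult.commute)
    then show "rval m \<le> rval z" using rval_le_iff[OF _ z0, of m] that(1) by auto
  qed
  have le: "m / of_nat n \<le> of_nat n * m" if "0 \<le> m" for m :: puiseux
  proof -
    have "m / of_nat n \<le> m" using mult_left_mono[OF N that] n by (simp add: divide_le_eq)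
    also have "m \<le> of_nat n * m" using mult_right_mono[OF N that] by (simp only: mult_1)
    finally show ?thesis .
  qed
  show ?thesis
  proof (cases m "0 :: puiseux" rule: linorder_cases)
    case less
    then show ?thesis using p[of "- m" "- z"] le[of "- m"] z by (simp add: min_def max_def split: if_splits)
  next
    case equal
    then show ?thesis using z by simp
  next
    case greater
    then show ?thesis using p[of m z] le[of m] z by (simp add: min_def max_def split: if_splits)
  qed
qed

text \<open>Since \<open>b\<close> and \<open>e\<close> are nonnegative, the left side is at most
  \<open>(b - e) * p\<close> for each point \<open>p\<close> of the box; the bounds evaluate this at
  the ends \<open>r * m\<close> and \<open>s * m\<close>.\<close>

lemma box_term_bounds:
  fixes b e m r s :: "'k::linordered_field"
  assumes "0 \<le> b" "0 \<le> e" "0 \<le> r" "r \<le> s"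
  shows "b * min (r * m) (s * m) - e * max (r * m) (s * m) \<le> r * \<bar>(e - b) * m\<bar>"
    and "b * min (r * m) (s * m) - e * max (r * m) (s * m) \<le> - (s * ((e - b) * m))"
proof -
  show "b * min (r * m) (s * m) - e * max (r * m) (s * m) \<le> - (s * ((e - b) * m))"
  proof (cases "0 \<le> m")
    case True
    then have "r * m \<le> s * m" using assms by (simp add: mult_right_mono)
    moreover have "b * (r * m) \<le> b * (s * m)" using calculation assms by (simp add: mult_left_mono)
    ultimately show ?thesis by (simp add: min_def max_def algebra_simps)
  next
    case False
    then have "s * m \<le> r * m" using assms by (simp add: mult_right_mono_neg)
    moreover have "e * (s * m) \<le> e * (r * m)" using calculation assms by (simp add: mult_left_mono)
    ultimately show ?thesis by (auto simp: min_def max_def algebra_simps)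
  qed
  have "b * min (r * m) (s * m) - e * max (r * m) (s * m) \<le> - (r * ((e - b) * m))"
  proof -
    have "b * min (r * m) (s * m) \<le> b * (r * m)" using assms by (simp add: mult_left_mono)
    moreover have "e * (r * m) \<le> e * max (r * m) (s * m)" using assms by (simp add: mult_left_mono)
    ultimately show ?thesis by (simp add: algebra_simps)
  qed
  also have "\<dots> \<le> r * \<bar>(e - b) * m\<bar>"
    using mult_left_mono[OF abs_ge_minus_self[of "(e - b) * m"] assms(3)] by simp
  finally show "b * min (r * m) (s * m) - e * max (r * m) (s * m) \<le> r * \<bar>(e - b) * m\<bar>" .
qed

text \<open>At the end \<open>n * m\<close> of the box the dominating term contributes at most
  \<open>- n\<close> times its value, while at the end \<open>m / n\<close> the other terms are
  bounded by \<open>1 / n\<close> times their total size. For large \<open>n\<close> the former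
  wins.\<close>

lemma box_certificate_bound:
  fixes b e m :: "'d::finite \<Rightarrow> puiseux"
  assumes be: "\<And>j. 0 \<le> b j" "\<And>j. 0 \<le> e j"
    and h: "half (\<lambda>j. rval (e j - b j)) (\<lambda>j. rval (m j))"
  shows "\<exists>n0. \<forall>n. n0 \<le> n \<longrightarrow> 0 < n \<longrightarrow>
    (\<Sum>j\<in>UNIV. b j * min (m j / of_nat n) (of_nat n * m j)) \<le>
    (\<Sum>j\<in>UNIV. e j * max (m j / of_nat n) (of_nat n * m j))"
proof -
  obtain i n0 where i: "0 \<le> (e i - b i) * m i"
    "(\<Sum>j\<in>UNIV. \<bar>(e j - b j) * m j\<bar>) \<le> of_nat n0 * ((e i - b i) * m i)"
    using half_dominating_term[OF h] by blast
  show ?thesis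
  proof (intro exI[of _ n0] allI impI)
    fix n assume n: "n0 \<le> n" "0 < n"
    define s where "s = (of_nat n :: puiseux)"
    define r where "r = 1 / s"
    have s: "1 \<le> s" "of_nat n0 \<le> s" "r * s = 1" "0 \<le> r" using n by (auto simp: s_def r_def Suc_leI)
    have rs: "r \<le> s"
    proof -
      have "r * 1 \<le> r * s" by (rule mult_left_mono[OF s(1,4)])
      then show ?thesis using s by simp
    qed
    let ?T = "\<lambda>j. b j * min (r * m j) (s * m j) - e j * max (r * m j) (s * m j)"
    let ?p = "(e i - b i) * m i"
    have "(\<Sum>j\<in>UNIV - {i}. ?T j) \<le> (\<Sum>j\<in>UNIV - {i}. r * \<bar>(e j - b j) * m j\<bar>)"
      by (intro sum_mono box_term_bounds be s rs)
    also have "\<dots> \<le> (\<Sum>j\<in>UNIV. r * \<bar>(e j - b j) * m j\<bar>)"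
      by (rule sum_mono2) (use s(4) in auto)
    also have "\<dots> = r * (\<Sum>j\<in>UNIV. \<bar>(e j - b j) * m j\<bar>)" by (simp add: sum_distrib_left)
    also have "\<dots> \<le> r * (of_nat n0 * ?p)" by (rule mult_left_mono[OF i(2) s(4)])
    also have "\<dots> \<le> r * (s * ?p)" by (rule mult_left_mono[OF mult_right_mono[OF s(2) i(1)] s(4)])
    also have "\<dots> = ?p" using s(3) by (simp only: mult.assoc[symmetric] mult_1)
    also have "?p \<le> s * ?p" using mult_right_mono[OF s(1) i(1)] by (simp only: mult_1)
    finally have "(\<Sum>j\<in>UNIV - {i}. ?T j) \<le> s * ?p" .
    moreover have "?T i \<le> - (s * ?p)" by (intro box_term_bounds be s rs)
    moreover have "(\<Sum>j\<in>UNIV. ?T j) = ?T i + (\<Sum>j\<in>UNIV - {i}. ?T j)" by (subst sum.remove[of _ i]) auto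
    ultimately have "(\<Sum>j\<in>UNIV. ?T j) \<le> 0" by linarith
    then show "(\<Sum>j\<in>UNIV. b j * min (m j / of_nat n) (of_nat n * m j)) \<le>
        (\<Sum>j\<in>UNIV. e j * max (m j / of_nat n) (of_nat n * m j))"
      by (simp add: sum_subtractf r_def s_def)
  qed
qed

text \<open>The box enters as extra rows. A multiplier \<open>y\<close> annihilates all variables,
  so its upper bound part minus its lower bound part is a nonnegative combination of the rows of
  \<open>A\<close>, hence an inequality valid on \<open>P\<close>. Conversely, the tropical form of
  this inequality prevents \<open>y\<close> from refuting a large box around a lift of
  \<open>w\<close>.\<close>

theorem sval_vec_polyhedral_cone:
  fixes P :: "(puiseux ^ 'd::finite) set"
  assumes "is_polyhedral_cone P"
  shows "\<exists>A. finite A \<and> sval_vec ` P = {x \<in> signed_vecs. \<forall>a\<in>A. half a (to_vec x)}"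
proof -
  obtain n :: nat and A :: "nat \<Rightarrow> puiseux ^ 'd"
    where P: "P = {x. \<forall>i<n. 0 \<le> (\<Sum>j\<in>UNIV. A i $ j * x $ j)}"
    using assms unfolding is_polyhedral_cone_def by blast
  define R :: "(nat + 'd + 'd) set" where "R = {..<n} <+> (UNIV <+> UNIV)"
  \<comment> \<open>\<open>Inl i\<close> is a row of the cone; \<open>Inr (Inl k)\<close> and
    \<open>Inr (Inr k)\<close> bound coordinate \<open>k\<close> from below and from above.\<close>
  define C :: "nat + 'd + 'd \<Rightarrow> 'd \<Rightarrow> puiseux" where
    "C = case_sum (\<lambda>i j. A i $ j) (case_sum (\<lambda>k j. if j = k then 1 else 0) (\<lambda>k j. if j = k then - 1 else 0))"
  have sumR: "sum f R = (\<Sum>i<n. f (Inl i)) + ((\<Sum>k\<in>UNIV. f (Inr (Inl k))) + (\<Sum>k\<in>UNIV. f (Inr (Inr k))))"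
    for f :: "nat + 'd + 'd \<Rightarrow> puiseux"
    unfolding R_def by (simp add: sum.Plus o_def del: UNIV_Plus_UNIV)
  have "finite R" by (simp add: R_def)
  from uniform_Farkas[OF this, of C] obtain Y where Y: "finite Y"
    "\<And>y r. y \<in> Y \<Longrightarrow> r \<in> R \<Longrightarrow> 0 \<le> y r" "\<And>y j. y \<in> Y \<Longrightarrow> (\<Sum>r\<in>R. y r * C r j) = 0"
    "\<And>\<beta>. (\<And>y. y \<in> Y \<Longrightarrow> (\<Sum>r\<in>R. y r * \<beta> r) \<le> 0) \<Longrightarrow> \<exists>z. \<forall>r\<in>R. \<beta> r \<le> (\<Sum>j\<in>UNIV. C r j * z j)"
    by blast
  define a where "a y = (\<lambda>j. y (Inr (Inr j)) - y (Inr (Inl j)))" for y :: "nat + 'd + 'd \<Rightarrow> puiseux"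
  have a: "a y j = (\<Sum>i<n. y (Inl i) * A i $ j)" if "y \<in> Y" for y j
  proof -
    have "(\<Sum>k\<in>UNIV. y (Inr (Inl k)) * (if j = k then 1 else 0)) = y (Inr (Inl j))"
      "(\<Sum>k\<in>UNIV. y (Inr (Inr k)) * (if j = k then - 1 else 0)) = - y (Inr (Inr j))"
      by (simp_all add: if_distrib[of "(*) _"] cong: if_cong)
    then show ?thesis using Y(3)[OF that, of j] unfolding sumR a_def by (simp add: C_def algebra_simps)
  qed
  let ?A = "(\<lambda>y j. rval (a y j)) ` Y"
  have "sval_vec ` P = {x \<in> signed_vecs. \<forall>a\<in>?A. half a (to_vec x)}"
  proof (intro equalityI subsetI)
    fix w assume "w \<in> sval_vec ` P"
    then obtain x where x: "x \<in> P" "w = sval_vec x" by blast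
    have "half (\<lambda>j. rval (a y j)) (\<lambda>j. rval (x $ j))" if y: "y \<in> Y" for y
    proof (rule dot_nonneg_imp_half)
      have "(\<Sum>j\<in>UNIV. a y j * x $ j) = (\<Sum>j\<in>UNIV. \<Sum>i<n. y (Inl i) * (A i $ j * x $ j))"
        by (simp add: a[OF y] sum_distrib_right mult.assoc)
      also have "\<dots> = (\<Sum>i<n. y (Inl i) * (\<Sum>j\<in>UNIV. A i $ j * x $ j))"
        by (subst sum.swap) (simp add: sum_distrib_left)
      also have "0 \<le> \<dots>"
      proof (rule sum_nonneg)
        fix i assume "i \<in> {..<n}"
        then show "0 \<le> y (Inl i) * (\<Sum>j\<in>UNIV. A i $ j * x $ j)"
          by (intro mult_nonneg_nonneg Y(2)[OF y]) (use x(1) P in \<open>auto simp: R_def\<close>)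
      qed
      finally show "0 \<le> (\<Sum>j\<in>UNIV. a y j * x $ j)" .
    qed
    then show "w \<in> {x \<in> signed_vecs. \<forall>a\<in>?A. half a (to_vec x)}"
      by (simp add: x(2) sval_vec_signed to_vec_sval_vec)
  next
    fix w assume w: "w \<in> {x \<in> signed_vecs. \<forall>a\<in>?A. half a (to_vec x)}"
    obtain m where m: "\<And>i. rval (m i) = to_vec w i"
      using choice[of "\<lambda>i f. rval f = to_vec w i"] rval_surj by blast
    let ?l = "\<lambda>n j. min (m j / of_nat n) (of_nat n * m j)" and ?u = "\<lambda>n j. max (m j / of_nat n) (of_nat n * m j)"
    let ?S = "\<lambda>y n0. \<forall>n. n0 \<le> n \<longrightarrow> 0 < n \<longrightarrow>
        (\<Sum>j\<in>UNIV. y (Inr (Inl j)) * ?l n j) \<le> (\<Sum>j\<in>UNIV. y (Inr (Inr j)) * ?u n j)"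
    have "\<exists>n0. ?S y n0" if y: "y \<in> Y" for y
    proof -
      have "half (\<lambda>j. rval (a y j)) (to_vec w)" using w y by blast
      then have h: "half (\<lambda>j. rval (y (Inr (Inr j)) - y (Inr (Inl j)))) (\<lambda>j. rval (m j))" by (simp add: a_def m)
      have nn: "0 \<le> y (Inr (Inl j))" "0 \<le> y (Inr (Inr j))" for j
        using Y(2)[OF y] by (auto simp: R_def)
      show ?thesis by (rule box_certificate_bound[OF nn h])
    qed
    then obtain n0 where n0: "\<forall>y\<in>Y. ?S y (n0 y)" using bchoice[of Y ?S] by blast
    \<comment> \<open>The sum dominates all thresholds at once, and \<open>Suc\<close> keeps the box
      parameter positive.\<close>
    define N where "N = Suc (\<Sum>y\<in>Y. n0 y)"
    have N: "n0 y \<le> N" if "y \<in> Y" for y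
      using member_le_sum[OF that, of n0] Y(1) by (simp add: N_def)
    define \<beta> where "\<beta> = case_sum (\<lambda>_ :: nat. 0) (case_sum (?l N) (\<lambda>j. - ?u N j))"
    have "\<exists>z. \<forall>r\<in>R. \<beta> r \<le> (\<Sum>j\<in>UNIV. C r j * z j)"
    proof (rule Y(4))
      fix y assume y: "y \<in> Y"
      show "(\<Sum>r\<in>R. y r * \<beta> r) \<le> 0"
        using n0[rule_format, OF y N[OF y]] unfolding sumR by (simp add: \<beta>_def N_def sum_negf)
    qed
    then obtain z where z: "\<And>r. r \<in> R \<Longrightarrow> \<beta> r \<le> (\<Sum>j\<in>UNIV. C r j * z j)" by blast
    have zA: "0 \<le> (\<Sum>j\<in>UNIV. A i $ j * z j)" if "i < n" for i
      using z[of "Inl i"] that by (auto simp: R_def \<beta>_def C_def)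
    have e: "(\<Sum>j\<in>UNIV. C (Inr (Inl k)) j * z j) = z k" "(\<Sum>j\<in>UNIV. C (Inr (Inr k)) j * z j) = - z k" for k
    proof -
      have "(\<Sum>j\<in>UNIV. C (Inr (Inl k)) j * z j) = (\<Sum>j\<in>UNIV. if j = k then z j else 0)"
        "(\<Sum>j\<in>UNIV. C (Inr (Inr k)) j * z j) = (\<Sum>j\<in>UNIV. if j = k then - z j else 0)"
        by (rule sum.cong; simp add: C_def)+
      then show "(\<Sum>j\<in>UNIV. C (Inr (Inl k)) j * z j) = z k" "(\<Sum>j\<in>UNIV. C (Inr (Inr k)) j * z j) = - z k"
        by simp_all
    qed
    have "rval (z k) = to_vec w k" for k
    proof -
      have "?l N k \<le> z k" using z[of "Inr (Inl k)"] unfolding e by (auto simp: R_def \<beta>_def)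
      moreover have "z k \<le> ?u N k" using z[of "Inr (Inr k)"] unfolding e by (auto simp: R_def \<beta>_def)
      ultimately show ?thesis using rval_eq_of_box[of N "m k" "z k"] m by (simp add: N_def)
    qed
    then have "to_vec (sval_vec (\<chi> i. z i)) = to_vec w" by (simp add: to_vec_sval_vec)
    then have "sval_vec (\<chi> i. z i) = w"
      using w by (metis (no_types, lifting) of_vec_to_vec sval_vec_signed mem_Collect_eq)
    moreover have "(\<chi> i. z i) \<in> P" using zA by (simp add: P)
    ultimately show "w \<in> sval_vec ` P" by blast
  qed
  then show ?thesis using Y(1) by (intro exI[of _ ?A]) simp
qed

section \<open>The four descriptions\<close>

text \<open>In the real model \<open>cone_TC M\<close> is a \<open>tc_cone\<close> containing the
  generators. Conversely, the hull is cut out by linear halfspaces; these are TC-convex, so those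
  containing \<open>M\<close> contain \<open>conv_TC M\<close>.\<close>

lemma cone_TC_eq_hull:
  fixes M :: "(symtrop ^ 'd::finite) set"
  assumes M: "finite M" "M \<noteq> {}" "M \<subseteq> signed_vecs"
  shows "cone_TC M = {x \<in> signed_vecs. to_vec x \<in> tc_cone hull (to_vec ` M)}"
proof (intro equalityI subsetI)
  fix x assume x: "x \<in> {x \<in> signed_vecs. to_vec x \<in> tc_cone hull (to_vec ` M)}"
  have "y \<in> cone_TC M" if "y \<in> M" for y
  proof -
    have "of_vec (to_vec y) \<in> cone_TC M"
      unfolding cone_TC_iff[OF M(3)] using conv_TC_superset[OF M(3)] that
      by (intro exI[of _ 1] conjI bexI[of _ y]) auto
    then show ?thesis using that M(3) by auto
  qed
  then have "to_vec ` M \<subseteq> {v. of_vec v \<in> cone_TC M}" using M(3) by auto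
  then have "tc_cone hull (to_vec ` M) \<subseteq> {v. of_vec v \<in> cone_TC M}"
    by (rule hull_minimal) (rule tc_cone_cone_TC[OF M(3,2)])
  then have "of_vec (to_vec x) \<in> cone_TC M" using x by blast
  then show "x \<in> cone_TC M" using x by simp
next
  fix x assume "x \<in> cone_TC M"
  then obtain l y where lx: "x = l *s y" "l \<in> tnonneg" "y \<in> conv_TC M" unfolding cone_TC_def by blast
  obtain A where A: "tc_cone hull (to_vec ` M) = {x. \<forall>a\<in>A. half a x}"
    using tc_cone_hull_finite_halfspaces[of "to_vec ` M"] M(1) by blast
  have y: "y \<in> signed_vecs" "half a (to_vec y)" if "a \<in> A" for a
  proof -
    have "M \<subseteq> {x \<in> signed_vecs. half a (to_vec x)}"
      using A hull_subset[of "to_vec ` M" tc_cone] M(3) that by blast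
    then have "conv_TC M \<subseteq> {x \<in> signed_vecs. half a (to_vec x)}"
      using TC_convex_halfspace[of a] unfolding conv_TC_def signed_Inter_def by blast
    then show "y \<in> signed_vecs" "half a (to_vec y)" using lx(3) by blast+
  qed
  have ys: "y \<in> signed_vecs" using lx(3) TC_convex_conv_TC[of M] by (auto simp: TC_convex_def)
  have "to_vec y \<in> tc_cone hull (to_vec ` M)" using y A by blast
  moreover have "0 \<le> to_real l" "l \<in> tsigned" using lx(2) by (auto simp: tnonneg_def tpos_def tsigned_def)
  ultimately have "(\<lambda>i. to_real l * to_vec y i) \<in> tc_cone hull (to_vec ` M)"
    using tc_cone_scale[OF tc_cone_hull] by blast
  moreover have "to_vec x = (\<lambda>i. to_real l * to_vec y i)" by (simp add: lx(1) to_vec_def)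
  moreover have "x \<in> signed_vecs" using ys \<open>l \<in> tsigned\<close> by (simp add: lx(1) signed_vecs_def)
  ultimately show "x \<in> {x \<in> signed_vecs. to_vec x \<in> tc_cone hull (to_vec ` M)}" by simp
qed

lemma signed_Inter_halfspaces:
  fixes A :: "('d::finite \<Rightarrow> real) set"
  shows "signed_Inter ((\<lambda>a. {x \<in> signed_vecs. half a (to_vec x)}) ` (A - {\<lambda>_. 0})) =
    {x \<in> signed_vecs. \<forall>a\<in>A. half a (to_vec x)}"
proof -
  have "half (\<lambda>_. 0) x" for x :: "'d \<Rightarrow> real" by (simp add: half_def)
  then show ?thesis by (auto simp: signed_Inter_def)
qed

lemma is_closed_linear_halfspace_iff:
  fixes H :: "(symtrop ^ 'd::finite) set"
  shows "is_closed_linear_halfspace H \<longleftrightarrow>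
    (\<exists>a. a \<noteq> (\<lambda>_. 0) \<and> H = {x \<in> signed_vecs. half a (to_vec x)})"
proof -
  have H: "closed_halfspace 0 (of_vec a) = {x \<in> signed_vecs. half a (to_vec x)}" for a :: "'d \<Rightarrow> real"
    using closed_linear_halfspace_iff[OF of_vec_signed, of _ a] by (auto simp: closed_halfspace_def)
  show ?thesis
  proof
    assume "is_closed_linear_halfspace H"
    then obtain a where a: "a \<in> signed_vecs" "a \<noteq> 0" "H = closed_halfspace 0 a"
      unfolding is_closed_linear_halfspace_def by blast
    then show "\<exists>a. a \<noteq> (\<lambda>_. 0) \<and> H = {x \<in> signed_vecs. half a (to_vec x)}"
      using H[of "to_vec a"] of_vec_eq_0_iff[of "to_vec a"] by (intro exI[of _ "to_vec a"]) simp
  next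
    assume "\<exists>a. a \<noteq> (\<lambda>_. 0) \<and> H = {x \<in> signed_vecs. half a (to_vec x)}"
    then obtain a where "a \<noteq> (\<lambda>_. 0)" "H = closed_halfspace 0 (of_vec a)" using H by blast
    then show "is_closed_linear_halfspace H"
      unfolding is_closed_linear_halfspace_def using of_vec_eq_0_iff[of a] of_vec_signed[of a] by blast
  qed
qed

lemma is_linear_halfspace_sval_iff:
  fixes K :: "(symtrop ^ 'd::finite) set"
  shows "(\<exists>H. is_linear_halfspace H \<and> K = sval_vec ` H) \<longleftrightarrow> is_closed_linear_halfspace K"
proof
  assume "\<exists>H. is_linear_halfspace H \<and> K = sval_vec ` H"
  then obtain a :: "puiseux ^ 'd" where a: "a \<noteq> 0"
    "K = {x \<in> signed_vecs. half (to_vec (sval_vec a)) (to_vec x)}"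
    unfolding is_linear_halfspace_def using sval_vec_linear_halfspace by blast
  moreover have "to_vec (sval_vec a) \<noteq> (\<lambda>_. 0)"
    using a(1) by (auto simp: to_vec_sval_vec fun_eq_iff vec_eq_iff)
  ultimately show "is_closed_linear_halfspace K" unfolding is_closed_linear_halfspace_iff by blast
next
  assume "is_closed_linear_halfspace K"
  then obtain a where a: "a \<noteq> (\<lambda>_. 0)" "K = {x \<in> signed_vecs. half a (to_vec x)}"
    unfolding is_closed_linear_halfspace_iff by blast
  obtain m where m: "\<And>i. rval (m i) = a i"
    using choice[of "\<lambda>i f. rval f = a i"] rval_surj by blast
  define b where "b = (\<chi> i. m i)"
  have b: "to_vec (sval_vec b) = a" using m by (simp add: to_vec_sval_vec b_def)
  have "b \<noteq> 0"
  proof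
    assume "b = 0"
    then have "to_vec (sval_vec b) = (\<lambda>_. 0)" by (simp add: to_vec_sval_vec)
    then show False using a(1) b by simp
  qed
  then have "is_linear_halfspace {x. 0 \<le> (\<Sum>j\<in>UNIV. b $ j * x $ j)}"
    unfolding is_linear_halfspace_def by blast
  moreover have "K = sval_vec ` {x. 0 \<le> (\<Sum>j\<in>UNIV. b $ j * x $ j)}"
    unfolding sval_vec_linear_halfspace b by (rule a(2))
  ultimately show "\<exists>H. is_linear_halfspace H \<and> K = sval_vec ` H" by blast
qed

lemma finite_halfspaces_iff:
  fixes X :: "(symtrop ^ 'd::finite) set"
  shows "(\<exists>F. finite F \<and> (\<forall>H\<in>F. is_closed_linear_halfspace H) \<and> X = signed_Inter F) \<longleftrightarrow>
    (\<exists>A. finite A \<and> X = {x \<in> signed_vecs. \<forall>a\<in>A. half a (to_vec x)})"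
proof
  assume "\<exists>F. finite F \<and> (\<forall>H\<in>F. is_closed_linear_halfspace H) \<and> X = signed_Inter F"
  then obtain F where F: "finite F" "\<forall>H\<in>F. is_closed_linear_halfspace H" "X = signed_Inter F" by blast
  have "\<forall>H\<in>F. \<exists>a. H = {x \<in> signed_vecs. half a (to_vec x)}"
    using F(2) unfolding is_closed_linear_halfspace_iff by blast
  then obtain a where a: "\<forall>H\<in>F. H = {x \<in> signed_vecs. half (a H) (to_vec x)}"
    using bchoice[of F "\<lambda>H a. H = {x \<in> signed_vecs. half a (to_vec x)}"] by blast
  have "X = {x \<in> signed_vecs. \<forall>b\<in>a ` F. half b (to_vec x)}"
    unfolding F(3) signed_Inter_def using a by blast
  then show "\<exists>A. finite A \<and> X = {x \<in> signed_vecs. \<forall>a\<in>A. half a (to_vec x)}" using F(1) by blast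
next
  assume "\<exists>A. finite A \<and> X = {x \<in> signed_vecs. \<forall>a\<in>A. half a (to_vec x)}"
  then obtain A where A: "finite A" "X = {x \<in> signed_vecs. \<forall>a\<in>A. half a (to_vec x)}" by blast
  let ?F = "(\<lambda>a. {x \<in> signed_vecs. half a (to_vec x)}) ` (A - {\<lambda>_. 0})"
  have "finite ?F" "X = signed_Inter ?F" using A signed_Inter_halfspaces by auto
  moreover have "\<forall>H\<in>?F. is_closed_linear_halfspace H" unfolding is_closed_linear_halfspace_iff by blast
  ultimately show "\<exists>F. finite F \<and> (\<forall>H\<in>F. is_closed_linear_halfspace H) \<and> X = signed_Inter F" by blast
qed

lemma finite_halfspaces_iff_cone_TC:
  fixes X :: "(symtrop ^ 'd::finite) set"
  shows "(\<exists>A. finite A \<and> X = {x \<in> signed_vecs. \<forall>a\<in>A. half a (to_vec x)}) \<longleftrightarrow>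
    (\<exists>M. finite M \<and> M \<noteq> {} \<and> M \<subseteq> signed_vecs \<and> X = cone_TC M)"
proof
  assume "\<exists>A. finite A \<and> X = {x \<in> signed_vecs. \<forall>a\<in>A. half a (to_vec x)}"
  then obtain A where A: "finite A" "X = {x \<in> signed_vecs. \<forall>a\<in>A. half a (to_vec x)}" by blast
  obtain G where G: "finite G" "{x. \<forall>a\<in>A. half a x} = tc_cone hull G"
    using halfspace_intersection_finitely_generated[OF A(1)] by blast
  \<comment> \<open>Adding the zero vector makes the generating set nonempty and does not change the
    hull.\<close>
  let ?G = "insert (\<lambda>_. 0) G"
  have "tc_cone hull ?G = tc_cone hull G"
  proof
    show "tc_cone hull ?G \<subseteq> tc_cone hull G"
      using tc_cone_zero[OF tc_cone_hull] hull_subset[of G tc_cone] by (intro hull_minimal tc_cone_hull) auto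
    show "tc_cone hull G \<subseteq> tc_cone hull ?G" by (rule hull_mono) blast
  qed
  moreover have "to_vec ` of_vec ` ?G = ?G" by (simp add: image_image)
  moreover have "cone_TC (of_vec ` ?G) = {x \<in> signed_vecs. to_vec x \<in> tc_cone hull (to_vec ` of_vec ` ?G)}"
    by (rule cone_TC_eq_hull) (use G(1) in auto)
  ultimately have "X = cone_TC (of_vec ` ?G)" using A(2) G(2) by auto
  then show "\<exists>M. finite M \<and> M \<noteq> {} \<and> M \<subseteq> signed_vecs \<and> X = cone_TC M"
    using G(1) by (intro exI[of _ "of_vec ` ?G"]) auto
next
  assume "\<exists>M. finite M \<and> M \<noteq> {} \<and> M \<subseteq> signed_vecs \<and> X = cone_TC M"
  then obtain M where M: "finite M" "M \<noteq> {}" "M \<subseteq> signed_vecs" "X = cone_TC M" by blast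
  obtain A where "finite A" "tc_cone hull (to_vec ` M) = {x. \<forall>a\<in>A. half a x}"
    using tc_cone_hull_finite_halfspaces[of "to_vec ` M"] M(1) by blast
  then show "\<exists>A. finite A \<and> X = {x \<in> signed_vecs. \<forall>a\<in>A. half a (to_vec x)}"
    unfolding M(4) cone_TC_eq_hull[OF M(1-3)] by auto
qed

theorem theorem6p5:
  fixes X :: "(symtrop ^ 'd) set"
  assumes "X \<subseteq> signed_vecs"
  shows
    "((\<exists>F. finite F \<and> (\<forall>H\<in>F. is_closed_linear_halfspace H) \<and> X = signed_Inter F)
      \<longleftrightarrow>
       (\<exists>M. finite M \<and> M \<noteq> {} \<and> M \<subseteq> signed_vecs \<and> X = cone_TC M)) \<and>
     ((\<exists>M. finite M \<and> M \<noteq> {} \<and> M \<subseteq> signed_vecs \<and> X = cone_TC M)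
      \<longleftrightarrow>
       (\<exists>F :: (puiseux ^ 'd) set set. finite F \<and> (\<forall>P\<in>F. is_polyhedral_cone P) \<and>
         signed_Inter ((\<lambda>P. sval_vec ` P) ` F) = X)) \<and>
     ((\<exists>F :: (puiseux ^ 'd) set set. finite F \<and> (\<forall>P\<in>F. is_polyhedral_cone P) \<and>
         signed_Inter ((\<lambda>P. sval_vec ` P) ` F) = X)
      \<longleftrightarrow>
       (\<exists>F :: (puiseux ^ 'd) set set. finite F \<and> (\<forall>H\<in>F. is_linear_halfspace H) \<and>
         signed_Inter ((\<lambda>H. sval_vec ` H) ` F) = X))"
    (is "(?i \<longleftrightarrow> ?ii) \<and> (_ \<longleftrightarrow> ?iii) \<and> (_ \<longleftrightarrow> ?iv)")
proof -
  \<comment> \<open>All conditions are compared with \<open>?fin\<close>, the description by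
    finitely many vectors in the real model. For (iii) it suffices that a linear halfspace is a
    polyhedral cone with one row.\<close>
  let ?fin = "\<exists>A. finite A \<and> X = {x \<in> signed_vecs. \<forall>a\<in>A. half a (to_vec x)}"
  have i_fin: "?i \<longleftrightarrow> ?fin" by (rule finite_halfspaces_iff)
  have ii_fin: "?fin \<longleftrightarrow> ?ii" by (rule finite_halfspaces_iff_cone_TC)
  have i_iv: ?iv if ?i
  proof -
    obtain F where F: "finite F" "\<forall>K\<in>F. is_closed_linear_halfspace K" "X = signed_Inter F" using \<open>?i\<close> by blast
    have "\<forall>K\<in>F. \<exists>H. is_linear_halfspace H \<and> K = sval_vec ` H"
      using F(2) is_linear_halfspace_sval_iff by blast
    then obtain h where h: "\<forall>K\<in>F. is_linear_halfspace (h K) \<and> K = sval_vec ` h K"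
      using bchoice[of F "\<lambda>K H. is_linear_halfspace H \<and> K = sval_vec ` H"] by blast
    then have "(\<lambda>H. sval_vec ` H) ` h ` F = F" by (force simp: image_image)
    then show ?thesis using F h by (intro exI[of _ "h ` F"]) simp
  qed
  have iv_iii: ?iii if ?iv
  proof -
    have "is_polyhedral_cone H" if H: "is_linear_halfspace H" for H :: "(puiseux ^ 'd) set"
    proof -
      obtain a where "H = {x. 0 \<le> (\<Sum>j\<in>UNIV. a $ j * x $ j)}"
        using H unfolding is_linear_halfspace_def by blast
      then show ?thesis unfolding is_polyhedral_cone_def by (intro exI[of _ 1] exI[of _ "\<lambda>_. a"]) simp
    qed
    then show ?thesis using \<open>?iv\<close> by blast
  qed
  have iii_fin: ?fin if ?iii
  proof -
    obtain F :: "(puiseux ^ 'd) set set" where F: "finite F" "\<forall>P\<in>F. is_polyhedral_cone P"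
      "signed_Inter ((\<lambda>P. sval_vec ` P) ` F) = X" using \<open>?iii\<close> by blast
    let ?Q = "\<lambda>P A. finite A \<and> sval_vec ` P = {x \<in> signed_vecs. \<forall>a\<in>A. half a (to_vec x)}"
    have "\<forall>P\<in>F. \<exists>A. ?Q P A" using F(2) sval_vec_polyhedral_cone by blast
    then obtain A where A: "\<forall>P\<in>F. ?Q P (A P)" using bchoice[of F ?Q] by blast
    have "X = {x \<in> signed_vecs. \<forall>a\<in>\<Union>(A ` F). half a (to_vec x)}"
      unfolding F(3)[symmetric] signed_Inter_def using A by auto
    moreover have "finite (\<Union>(A ` F))" using F(1) A by blast
    ultimately show ?thesis by blast
  qed
  show ?thesis using i_fin ii_fin i_iv iv_iii iii_fin by argo
qed

end
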